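(* Let $G$ be a Lie group with canonical symmetric connection $\nabla$. (i) Any left- or right-invariant vector field on $G$ is a symmetry (affine collineation) of $\nabla$. (ii) Any left- or right-invariant one-form on $G$ engenders a first integral of the geodesic system of $\nabla$: if the one-form is $\alpha=\alpha_i\,dx^i$ in a coordinate system $(x^i)$ on $G$, with induced fiber coordinates $(u^i)$ on $TG$, the function $\alpha_iu^i$ on $TG$ is constant along geodesics.
   Context: The canonical symmetric connection $\nabla$ on a Lie group $G$ is the linear connection determined by $\nabla_XY=\frac12[X,Y]$ for left-invariant vector fields $X,Y$ (extended by linearity and the Leibniz rule); the same formula holds for right-invariant vector fields. A vector field $W$ is a symmetry, or affine collineation, of a symmetric linear connection $\nabla$ if for all vector fields $X,Y$ $$\nabla_X\nabla_YW-\nabla_{\nabla_XY}W-R(W,X)Y=0,$$ where the curvature sign convention is $R(X,Y)Z=\nabla_{[X,Y]}Z-\nabla_X\nabla_YZ+\nabla_Y\nabla_XZ$. Summation over repeated indices is understood. *)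

theory Defs
  imports
    "HOL-Analysis.Analysis"
    "HOL-Algebra.Group"
    "HOL-Library.Function_Algebras"
begin

section \<open>Smooth maps between open sets of normed spaces\<close>

text \<open>Both notions are meant for open \<open>S\<close> and finite-dimensional domains, where the existence
  and continuity of all iterated directional derivatives is the usual \<open>C\<^sup>k\<close> condition.\<close>

primrec Ck_on :: "nat \<Rightarrow> 'e::real_normed_vector set \<Rightarrow> ('e \<Rightarrow> 'f::real_normed_vector) \<Rightarrow> bool" where
  "Ck_on 0 S f \<longleftrightarrow> continuous_on S f"
| "Ck_on (Suc k) S f \<longleftrightarrow> (\<forall>x\<in>S. f differentiable (at x)) \<and>
     (\<forall>v. Ck_on k S (\<lambda>x. frechet_derivative f (at x) v))"

definition smooth_on :: "'e::real_normed_vector set \<Rightarrow> ('e \<Rightarrow> 'f::real_normed_vector) \<Rightarrow> bool" where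
  "smooth_on S f \<longleftrightarrow> (\<forall>k. Ck_on k S f)"


section \<open>Smooth manifolds\<close>

text \<open>A chart is a pair of its domain and its coordinate map; the values of the coordinate map
  outside the domain are irrelevant.\<close>

type_synonym ('a, 'e) chart = "'a set \<times> ('a \<Rightarrow> 'e)"

record ('a, 'e) manifold =
  topo :: "'a topology"
  atlas :: "('a, 'e) chart set"

abbreviation points :: "('a, 'e) manifold \<Rightarrow> 'a set" where
  "points M \<equiv> topspace (topo M)"

definition is_chart :: "'a topology \<Rightarrow> ('a, 'e::real_normed_vector) chart \<Rightarrow> bool" where
  "is_chart T = (\<lambda>(U, \<phi>). openin T U \<and> open (\<phi> ` U) \<and>
     homeomorphic_map (subtopology T U) (top_of_set (\<phi> ` U)) \<phi>)"

definition compatible :: "('a, 'e::real_normed_vector) chart \<Rightarrow> ('a, 'e) chart \<Rightarrow> bool" where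
  "compatible = (\<lambda>(U, \<phi>) (V, \<psi>). smooth_on (\<phi> ` (U \<inter> V)) (\<psi> \<circ> inv_into U \<phi>) \<and>
     smooth_on (\<psi> ` (U \<inter> V)) (\<phi> \<circ> inv_into V \<psi>))"

text \<open>The atlas is maximal, so its members are exactly the local coordinate systems.\<close>

definition smooth_manifold :: "('a, 'e::euclidean_space) manifold \<Rightarrow> bool" where
  "smooth_manifold M \<longleftrightarrow>
     Hausdorff_space (topo M) \<and> second_countable (topo M) \<and>
     (\<forall>c\<in>atlas M. is_chart (topo M) c) \<and>
     (\<Union>(fst ` atlas M) = points M) \<and>
     (\<forall>c\<in>atlas M. \<forall>d\<in>atlas M. compatible c d) \<and>
     (\<forall>c. is_chart (topo M) c \<and> (\<forall>d\<in>atlas M. compatible c d) \<longrightarrow> c \<in> atlas M)"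

text \<open>Products and intervals carry an atlas that is not maximal; this is enough for testing
  smoothness of maps.\<close>

definition prod_manifold :: "('a, 'e) manifold \<Rightarrow> ('b, 'f) manifold \<Rightarrow> ('a \<times> 'b, 'e \<times> 'f) manifold" where
  "prod_manifold M N = \<lparr>topo = prod_topology (topo M) (topo N),
     atlas = {(U \<times> V, map_prod \<phi> \<psi>) | U \<phi> V \<psi>. (U, \<phi>) \<in> atlas M \<and> (V, \<psi>) \<in> atlas N}\<rparr>"

definition interval_manifold :: "real set \<Rightarrow> (real, real) manifold" where
  "interval_manifold I = \<lparr>topo = top_of_set I, atlas = {(I, \<lambda>t. t)}\<rparr>"

definition smooth_map ::
  "('a, 'e::real_normed_vector) manifold \<Rightarrow> ('b, 'f::real_normed_vector) manifold \<Rightarrow> ('a \<Rightarrow> 'b) \<Rightarrow> bool" where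
  "smooth_map M N F \<longleftrightarrow> continuous_map (topo M) (topo N) F \<and>
     (\<forall>(U, \<phi>)\<in>atlas M. \<forall>(V, \<psi>)\<in>atlas N.
        smooth_on (\<phi> ` {p \<in> U. F p \<in> V}) (\<psi> \<circ> F \<circ> inv_into U \<phi>))"

definition smooth_fun_on :: "('a, 'e::real_normed_vector) manifold \<Rightarrow> 'a set \<Rightarrow> ('a \<Rightarrow> real) \<Rightarrow> bool" where
  "smooth_fun_on M W f \<longleftrightarrow> (\<forall>(U, \<phi>)\<in>atlas M. smooth_on (\<phi> ` (U \<inter> W)) (f \<circ> inv_into U \<phi>))"

definition smooth_near :: "('a, 'e::real_normed_vector) manifold \<Rightarrow> 'a \<Rightarrow> ('a \<Rightarrow> real) \<Rightarrow> bool" where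
  "smooth_near M p f \<longleftrightarrow> (\<exists>W. openin (topo M) W \<and> p \<in> W \<and> smooth_fun_on M W f)"


section \<open>Tangent vectors and vector fields\<close>

text \<open>A tangent vector at \<open>p\<close> is the operator \<open>f \<mapsto> (f \<circ> \<gamma>)'(0)\<close> defined by a smooth curve \<open>\<gamma>\<close>
  through \<open>p\<close>, acting on the functions that are smooth near \<open>p\<close>. It is extended by \<open>0\<close> to all other
  functions, and vector fields by \<open>0\<close> to points outside the manifold, so that each of these objects
  has one representative only and the pointwise operations on functions are the linear operations.\<close>

type_synonym 'a tangent = "('a \<Rightarrow> real) \<Rightarrow> real"
type_synonym 'a vfield = "'a \<Rightarrow> 'a tangent"

definition open_interval :: "real set \<Rightarrow> bool" where
  "open_interval I \<longleftrightarrow> open I \<and> is_interval I"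

definition smooth_curve :: "('a, 'e::real_normed_vector) manifold \<Rightarrow> real set \<Rightarrow> (real \<Rightarrow> 'a) \<Rightarrow> bool" where
  "smooth_curve M I \<gamma> \<longleftrightarrow> open_interval I \<and> smooth_map (interval_manifold I) M \<gamma>"

definition velocity :: "('a, 'e::real_normed_vector) manifold \<Rightarrow> (real \<Rightarrow> 'a) \<Rightarrow> real \<Rightarrow> 'a tangent" where
  "velocity M \<gamma> t = (\<lambda>f. if smooth_near M (\<gamma> t) f then deriv (f \<circ> \<gamma>) t else 0)"

definition tangent_space :: "('a, 'e::real_normed_vector) manifold \<Rightarrow> 'a \<Rightarrow> 'a tangent set" where
  "tangent_space M p = {velocity M \<gamma> 0 | \<gamma> I. smooth_curve M I \<gamma> \<and> 0 \<in> I \<and> \<gamma> 0 = p}"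

definition differential ::
  "('b, 'f::real_normed_vector) manifold \<Rightarrow> ('a \<Rightarrow> 'b) \<Rightarrow> 'a \<Rightarrow> 'a tangent \<Rightarrow> 'b tangent" where
  "differential N F p v = (\<lambda>f. if smooth_near N (F p) f then v (f \<circ> F) else 0)"

definition vector_field :: "('a, 'e::real_normed_vector) manifold \<Rightarrow> 'a vfield \<Rightarrow> bool" where
  "vector_field M X \<longleftrightarrow>
     (\<forall>p\<in>points M. X p \<in> tangent_space M p) \<and> (\<forall>p. p \<notin> points M \<longrightarrow> X p = 0) \<and>
     (\<forall>W f. openin (topo M) W \<and> smooth_fun_on M W f \<longrightarrow> smooth_fun_on M W (\<lambda>p. X p f))"

definition fun_scale :: "('a \<Rightarrow> real) \<Rightarrow> 'a vfield \<Rightarrow> 'a vfield" where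
  "fun_scale f X = (\<lambda>p h. f p * X p h)"

definition lie_bracket :: "('a, 'e::real_normed_vector) manifold \<Rightarrow> 'a vfield \<Rightarrow> 'a vfield \<Rightarrow> 'a vfield" where
  "lie_bracket M X Y = (\<lambda>p f. if smooth_near M p f
     then X p (\<lambda>q. Y q f) - Y p (\<lambda>q. X q f) else 0)"


section \<open>Coordinates and one-forms\<close>

definition coord :: "('a, real^'n) chart \<Rightarrow> 'n \<Rightarrow> 'a \<Rightarrow> real" where
  "coord c i = (\<lambda>p. snd c p $ i)"

definition coord_vector :: "('a, real^'n) manifold \<Rightarrow> ('a, real^'n) chart \<Rightarrow> 'n \<Rightarrow> 'a vfield" where
  "coord_vector M c i = (\<lambda>p f. if smooth_near M p f
     then frechet_derivative (f \<circ> inv_into (fst c) (snd c)) (at (snd c p)) (axis i 1) else 0)"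

text \<open>The induced fiber coordinates on the tangent bundle: \<open>u\<^sup>i(v) = dx\<^sup>i(v) = v(x\<^sup>i)\<close>.\<close>

definition fiber_coord :: "('a, real^'n) chart \<Rightarrow> 'n \<Rightarrow> 'a tangent \<Rightarrow> real" where
  "fiber_coord c i v = v (coord c i)"

definition form_coeff :: "('a, real^'n) manifold \<Rightarrow> ('a, real^'n) chart \<Rightarrow>
    ('a \<Rightarrow> 'a tangent \<Rightarrow> real) \<Rightarrow> 'n \<Rightarrow> 'a \<Rightarrow> real" where
  "form_coeff M c \<alpha> i = (\<lambda>p. \<alpha> p (coord_vector M c i p))"

definition one_form :: "('a, real^'n) manifold \<Rightarrow> ('a \<Rightarrow> 'a tangent \<Rightarrow> real) \<Rightarrow> bool" where
  "one_form M \<alpha> \<longleftrightarrow>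
     (\<forall>p\<in>points M. \<forall>v\<in>tangent_space M p. \<forall>w\<in>tangent_space M p. \<forall>a b.
        \<alpha> p (\<lambda>f. a * v f + b * w f) = a * \<alpha> p v + b * \<alpha> p w) \<and>
     (\<forall>c\<in>atlas M. \<forall>i. smooth_fun_on M (fst c) (form_coeff M c \<alpha> i))"


section \<open>Linear connections\<close>

definition linear_connection ::
  "('a, 'e::real_normed_vector) manifold \<Rightarrow> ('a vfield \<Rightarrow> 'a vfield \<Rightarrow> 'a vfield) \<Rightarrow> bool" where
  "linear_connection M nabla \<longleftrightarrow>
     (\<forall>X Y. vector_field M X \<and> vector_field M Y \<longrightarrow> vector_field M (nabla X Y)) \<and>
     (\<forall>X X' Y. vector_field M X \<and> vector_field M X' \<and> vector_field M Y \<longrightarrow>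
        nabla (X + X') Y = nabla X Y + nabla X' Y) \<and>
     (\<forall>X Y Y'. vector_field M X \<and> vector_field M Y \<and> vector_field M Y' \<longrightarrow>
        nabla X (Y + Y') = nabla X Y + nabla X Y') \<and>
     (\<forall>f X Y. smooth_fun_on M (points M) f \<and> vector_field M X \<and> vector_field M Y \<longrightarrow>
        nabla (fun_scale f X) Y = fun_scale f (nabla X Y)) \<and>
     (\<forall>f X Y. smooth_fun_on M (points M) f \<and> vector_field M X \<and> vector_field M Y \<longrightarrow>
        nabla X (fun_scale f Y) = fun_scale (\<lambda>p. X p f) Y + fun_scale f (nabla X Y))"

text \<open>This is the negative of the other common sign convention.\<close>

definition curvature :: "('a, 'e::real_normed_vector) manifold \<Rightarrow>
    ('a vfield \<Rightarrow> 'a vfield \<Rightarrow> 'a vfield) \<Rightarrow> 'a vfield \<Rightarrow> 'a vfield \<Rightarrow> 'a vfield \<Rightarrow> 'a vfield" where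
  "curvature M nabla X Y Z =
     nabla (lie_bracket M X Y) Z - nabla X (nabla Y Z) + nabla Y (nabla X Z)"

definition affine_collineation :: "('a, 'e::real_normed_vector) manifold \<Rightarrow>
    ('a vfield \<Rightarrow> 'a vfield \<Rightarrow> 'a vfield) \<Rightarrow> 'a vfield \<Rightarrow> bool" where
  "affine_collineation M nabla W \<longleftrightarrow> vector_field M W \<and>
     (\<forall>X Y. vector_field M X \<and> vector_field M Y \<longrightarrow>
        nabla X (nabla Y W) - nabla (nabla X Y) W - curvature M nabla W X Y = 0)"

text \<open>Christoffel symbols \<open>\<Gamma> i j k\<close> in a chart, \<open>\<nabla>\<^bsub>\<partial>\<^sub>j\<^esub> \<partial>\<^sub>k = \<Gamma>\<^sup>i\<^sub>j\<^sub>k \<partial>\<^sub>i\<close>. The coordinate fields are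
  defined on the chart domain only whereas \<open>nabla\<close> acts on global fields, so the symbols are
  specified by the resulting local expression
  \<open>(\<nabla>\<^sub>X Y)\<^sup>i = X(Y\<^sup>i) + \<Gamma>\<^sup>i\<^sub>j\<^sub>k X\<^sup>j Y\<^sup>k\<close>, which determines them on the domain.\<close>

definition christoffel :: "('a, real^'n) manifold \<Rightarrow> ('a vfield \<Rightarrow> 'a vfield \<Rightarrow> 'a vfield) \<Rightarrow>
    ('a, real^'n) chart \<Rightarrow> ('n \<Rightarrow> 'n \<Rightarrow> 'n \<Rightarrow> 'a \<Rightarrow> real) \<Rightarrow> bool" where
  "christoffel M nabla c \<Gamma> \<longleftrightarrow>
     (\<forall>X Y. vector_field M X \<and> vector_field M Y \<longrightarrow> (\<forall>p\<in>fst c. \<forall>i.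
        fiber_coord c i (nabla X Y p) =
          X p (\<lambda>q. fiber_coord c i (Y q)) +
          (\<Sum>j\<in>UNIV. \<Sum>k\<in>UNIV. \<Gamma> i j k p * fiber_coord c j (X p) * fiber_coord c k (Y p))))"

definition geodesic :: "('a, real^'n) manifold \<Rightarrow> ('a vfield \<Rightarrow> 'a vfield \<Rightarrow> 'a vfield) \<Rightarrow>
    real set \<Rightarrow> (real \<Rightarrow> 'a) \<Rightarrow> bool" where
  "geodesic M nabla I \<gamma> \<longleftrightarrow> smooth_curve M I \<gamma> \<and>
     (\<forall>c\<in>atlas M. \<exists>\<Gamma>. christoffel M nabla c \<Gamma> \<and>
        (\<forall>t\<in>I. \<gamma> t \<in> fst c \<longrightarrow> (\<forall>i.
           deriv (deriv (coord c i \<circ> \<gamma>)) t +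
           (\<Sum>j\<in>UNIV. \<Sum>k\<in>UNIV. \<Gamma> i j k (\<gamma> t) *
              deriv (coord c j \<circ> \<gamma>) t * deriv (coord c k \<circ> \<gamma>) t) = 0)))"

text \<open>\<open>F p v\<close> is the value of the function \<open>F\<close> on the tangent bundle at the tangent vector \<open>v\<close> at \<open>p\<close>.\<close>

definition first_integral :: "('a, real^'n) manifold \<Rightarrow> ('a vfield \<Rightarrow> 'a vfield \<Rightarrow> 'a vfield) \<Rightarrow>
    ('a \<Rightarrow> 'a tangent \<Rightarrow> real) \<Rightarrow> bool" where
  "first_integral M nabla F \<longleftrightarrow>
     (\<forall>I \<gamma>. geodesic M nabla I \<gamma> \<longrightarrow> (\<lambda>t. F (\<gamma> t) (velocity M \<gamma> t)) constant_on I)"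


section \<open>Lie groups\<close>

definition lie_group :: "('a, 'b) monoid_scheme \<Rightarrow> ('a, 'e::euclidean_space) manifold \<Rightarrow> bool" where
  "lie_group G M \<longleftrightarrow> group G \<and> smooth_manifold M \<and> carrier G = points M \<and>
     smooth_map (prod_manifold M M) M (\<lambda>(x, y). x \<otimes>\<^bsub>G\<^esub> y) \<and>
     smooth_map M M (\<lambda>x. inv\<^bsub>G\<^esub> x)"

definition left_invariant_field ::
  "('a, 'b) monoid_scheme \<Rightarrow> ('a, 'e::real_normed_vector) manifold \<Rightarrow> 'a vfield \<Rightarrow> bool" where
  "left_invariant_field G M X \<longleftrightarrow> vector_field M X \<and>
     (\<forall>g\<in>carrier G. \<forall>h\<in>carrier G. differential M (\<lambda>x. g \<otimes>\<^bsub>G\<^esub> x) h (X h) = X (g \<otimes>\<^bsub>G\<^esub> h))"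

definition right_invariant_field ::
  "('a, 'b) monoid_scheme \<Rightarrow> ('a, 'e::real_normed_vector) manifold \<Rightarrow> 'a vfield \<Rightarrow> bool" where
  "right_invariant_field G M X \<longleftrightarrow> vector_field M X \<and>
     (\<forall>g\<in>carrier G. \<forall>h\<in>carrier G. differential M (\<lambda>x. x \<otimes>\<^bsub>G\<^esub> g) h (X h) = X (h \<otimes>\<^bsub>G\<^esub> g))"

definition left_invariant_form ::
  "('a, 'b) monoid_scheme \<Rightarrow> ('a, real^'n) manifold \<Rightarrow> ('a \<Rightarrow> 'a tangent \<Rightarrow> real) \<Rightarrow> bool" where
  "left_invariant_form G M \<alpha> \<longleftrightarrow> one_form M \<alpha> \<and>
     (\<forall>g\<in>carrier G. \<forall>h\<in>carrier G. \<forall>v\<in>tangent_space M h.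
        \<alpha> (g \<otimes>\<^bsub>G\<^esub> h) (differential M (\<lambda>x. g \<otimes>\<^bsub>G\<^esub> x) h v) = \<alpha> h v)"

definition right_invariant_form ::
  "('a, 'b) monoid_scheme \<Rightarrow> ('a, real^'n) manifold \<Rightarrow> ('a \<Rightarrow> 'a tangent \<Rightarrow> real) \<Rightarrow> bool" where
  "right_invariant_form G M \<alpha> \<longleftrightarrow> one_form M \<alpha> \<and>
     (\<forall>g\<in>carrier G. \<forall>h\<in>carrier G. \<forall>v\<in>tangent_space M h.
        \<alpha> (h \<otimes>\<^bsub>G\<^esub> g) (differential M (\<lambda>x. x \<otimes>\<^bsub>G\<^esub> g) h v) = \<alpha> h v)"

text \<open>Left-invariant fields span every tangent space, so by linearity and the Leibniz rule
  there is exactly one such connection (as an operation on smooth vector fields).\<close>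

definition canonical_connection :: "('a, 'b) monoid_scheme \<Rightarrow> ('a, 'e::real_normed_vector) manifold \<Rightarrow>
    ('a vfield \<Rightarrow> 'a vfield \<Rightarrow> 'a vfield) \<Rightarrow> bool" where
  "canonical_connection G M nabla \<longleftrightarrow> linear_connection M nabla \<and>
     (\<forall>X Y. left_invariant_field G M X \<and> left_invariant_field G M Y \<longrightarrow>
        nabla X Y = fun_scale (\<lambda>_. 1/2) (lie_bracket M X Y))"

end

theory Submission
  imports Defs
begin

text \<open>Left-invariant fields provide a global frame of smooth vector fields, and they commute with
  right-invariant ones: in charts, \<open>f(x y)\<close> is a smooth function of two variables, left-invariant fields
  differentiate in \<open>y\<close>, right-invariant fields in \<open>x\<close>, and mixed second derivatives agree. Everything else is
  algebra with these two facts (lemmas \<open>vector_field_induct\<close> and \<open>left_right_commute\<close>).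

  Collineations. The canonical connection is torsion-free, since this is a tensorial identity
  and holds on left-invariant fields. For a torsion-free connection the collineation condition for \<open>W\<close> says that
  \<open>[W, \<nabla>\<^sub>X Y] = \<nabla>\<^bsub>[W,X]\<^esub> Y + \<nabla>\<^sub>X [W,Y]\<close> for all \<open>X\<close> and \<open>Y\<close>, and this again is tensorial in \<open>X\<close> and \<open>Y\<close>, so that
  left-invariant \<open>X\<close> and \<open>Y\<close> suffice. There \<open>\<nabla>\<^sub>X Y\<close> is half the bracket. If \<open>W\<close> is left-invariant, the condition is
  half the Jacobi identity; if \<open>W\<close> is right-invariant, all brackets with \<open>W\<close> vanish.

  First integrals. An invariant form is constant on every field \<open>X\<close> that is invariant on the same side, and invariant
  fields satisfy \<open>\<nabla>\<^sub>X X = 0\<close>: for a left-invariant \<open>X\<close> because \<open>[X,X] = 0\<close>, and for a right-invariant \<open>X\<close> by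
  comparison at each point with the left-invariant field of the same value there, which commutes with \<open>X\<close>.
  Extending the velocity of a geodesic at one instant to such a field shows that the derivative of \<open>\<alpha>\<^sub>i u\<^sup>i\<close> vanishes
  at that instant (lemma \<open>first_integral_of_autoparallel_fields\<close>).\<close>

section \<open>Maps of class \<open>C\<^sup>k\<close> on open sets\<close>

lemma Ck_on_cong:
  assumes "open S" "\<forall>x\<in>S. f x = g x" "Ck_on k S f"
  shows "Ck_on k S g"
  using assms(2,3)
proof (induction k arbitrary: f g)
  case 0
  then show ?case by (simp cong: continuous_on_cong)
next
  case (Suc k)
  have d: "f differentiable (at x)" if "x \<in> S" for x
    using Suc.prems that by simp
  have eq: "frechet_derivative f (at x) = frechet_derivative g (at x)" if "x \<in> S" for x
    using frechet_derivative_transform_within_open[OF d[OF that] assms(1) that] Suc.prems by auto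
  have "g differentiable (at x)" if "x \<in> S" for x
    using d[OF that] has_derivative_transform_within_open[OF _ assms(1) that] Suc.prems(1)
    unfolding differentiable_def by blast
  moreover have "Ck_on k S (\<lambda>x. frechet_derivative g (at x) v)" for v
    using Suc.IH[of "\<lambda>x. frechet_derivative f (at x) v"] Suc.prems eq by auto
  ultimately show ?case by simp
qed

text \<open>For sums, products, compositions and reciprocals, membership in \<open>C\<^sup>k\<close> is proved by induction on \<open>k\<close>:
  this rule reduces the step to writing down the derivative, which is built from maps
  of class \<open>C\<^sup>k\<close> by operations already covered.\<close>

lemma Ck_on_Suc_intro:
  assumes "open S" "\<And>x. x \<in> S \<Longrightarrow> (f has_derivative D x) (at x)"
    "\<And>v. Ck_on k S (\<lambda>x. D x v)"
  shows "Ck_on (Suc k) S f"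
proof -
  have "frechet_derivative f (at x) = D x" if "x \<in> S" for x
    using frechet_derivative_at[OF assms(2)[OF that]] by simp
  then have "Ck_on k S (\<lambda>x. frechet_derivative f (at x) v)" for v
    using Ck_on_cong[OF assms(1) _ assms(3)[of v], of "\<lambda>x. frechet_derivative f (at x) v"] by simp
  then show ?thesis
    using assms(2) by (auto simp: differentiable_def)
qed

lemma Ck_on_Suc_has_derivative:
  assumes "Ck_on (Suc k) S f" "x \<in> S"
  shows "(f has_derivative frechet_derivative f (at x)) (at x)"
  using assms by (simp add: frechet_derivative_works[symmetric])

lemma Ck_on_Suc_derivative: "Ck_on (Suc k) S f \<Longrightarrow> Ck_on k S (\<lambda>x. frechet_derivative f (at x) v)"
  by (simp only: Ck_on.simps)

lemma Ck_on_Suc_weaken: "Ck_on (Suc k) S f \<Longrightarrow> Ck_on k S f"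
proof (induction k arbitrary: f)
  case 0
  then have "\<forall>x\<in>S. isCont f x"
    by (auto intro: differentiable_imp_continuous_within)
  then show ?case
    by (simp add: continuous_at_imp_continuous_on)
next
  case (Suc k)
  have "Ck_on (Suc k) S (\<lambda>x. frechet_derivative f (at x) v)" for v
    using Suc.prems unfolding Ck_on.simps(2)[of "Suc k"] by blast
  then have "Ck_on k S (\<lambda>x. frechet_derivative f (at x) v)" for v
    by (rule Suc.IH)
  then show ?case
    using Suc.prems unfolding Ck_on.simps(2) by blast
qed

lemma Ck_on_subset: "Ck_on k S f \<Longrightarrow> T \<subseteq> S \<Longrightarrow> Ck_on k T f"
  by (induction k arbitrary: f) (auto intro: continuous_on_subset)

lemma Ck_on_local:
  assumes "\<And>x. x \<in> S \<Longrightarrow> \<exists>T. open T \<and> x \<in> T \<and> Ck_on k T f"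
  shows "Ck_on k S f"
  using assms
proof (induction k arbitrary: f)
  case 0
  have "isCont f x" if "x \<in> S" for x
    using 0[OF that] by (auto simp: continuous_on_eq_continuous_at)
  then show ?case
    by (simp add: continuous_at_imp_continuous_on)
next
  case (Suc k)
  have "f differentiable (at x)" if "x \<in> S" for x
    using Suc.prems[OF that] by auto
  moreover have "Ck_on k S (\<lambda>x. frechet_derivative f (at x) v)" for v
  proof (rule Suc.IH)
    fix x assume "x \<in> S"
    then show "\<exists>T. open T \<and> x \<in> T \<and> Ck_on k T (\<lambda>x. frechet_derivative f (at x) v)"
      using Suc.prems by fastforce
  qed
  ultimately show ?case by simp
qed

lemma Ck_on_const: "open S \<Longrightarrow> Ck_on k S (\<lambda>x. c)"
proof (induction k arbitrary: c)
  case (Suc k)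
  show ?case
    by (rule Ck_on_Suc_intro[OF Suc.prems, where D = "\<lambda>x v. 0"]) (auto intro: Suc)
qed auto

lemma Ck_on_linear:
  assumes "bounded_linear h" "open S" shows "Ck_on k S h"
proof (cases k)
  case 0
  then show ?thesis
    using assms by (simp add: linear_continuous_on)
next
  case (Suc n)
  show ?thesis
    unfolding Suc
    by (rule Ck_on_Suc_intro[OF assms(2), where D = "\<lambda>x. h"])
      (auto intro: assms Ck_on_const bounded_linear_imp_has_derivative)
qed

lemma Ck_on_add:
  assumes "open S" "Ck_on k S f" "Ck_on k S g"
  shows "Ck_on k S (\<lambda>x. f x + g x)"
  using assms(2,3)
proof (induction k arbitrary: f g)
  case 0
  then show ?case by (auto intro: continuous_intros)
next
  case (Suc k)
  show ?case
    by (rule Ck_on_Suc_intro[OF assms(1)])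
      (auto intro!: has_derivative_add Ck_on_Suc_has_derivative[OF Suc.prems(1)]
         Ck_on_Suc_has_derivative[OF Suc.prems(2)] Suc.IH Suc.prems(1,2)[simplified, THEN conjunct2, rule_format])
qed

lemma Ck_on_bilinear:
  assumes "bounded_bilinear pr" "open S" "Ck_on k S f" "Ck_on k S g"
  shows "Ck_on k S (\<lambda>x. pr (f x) (g x))"
  using assms(3,4)
proof (induction k arbitrary: f g)
  case 0
  then show ?case using bounded_bilinear.continuous_on[OF assms(1)] by auto
next
  case (Suc k)
  have d: "Ck_on k S (\<lambda>x. frechet_derivative f (at x) v)" "Ck_on k S (\<lambda>x. frechet_derivative g (at x) v)" for v
    using Suc.prems by auto
  show ?case
    by (rule Ck_on_Suc_intro[OF assms(2), where D = "\<lambda>x v. pr (f x) (frechet_derivative g (at x) v)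
         + pr (frechet_derivative f (at x) v) (g x)"])
      (auto intro!: bounded_bilinear.FDERIV[OF assms(1)] Ck_on_Suc_has_derivative[OF Suc.prems(1)]
         Ck_on_Suc_has_derivative[OF Suc.prems(2)] Ck_on_add Suc.IH assms d Ck_on_Suc_weaken[OF Suc.prems(1)]
         Ck_on_Suc_weaken[OF Suc.prems(2)])
qed

lemma Ck_on_sum:
  assumes "open S" "\<And>i. i \<in> I \<Longrightarrow> Ck_on k S (f i)"
  shows "Ck_on k S (\<lambda>x. \<Sum>i\<in>I. f i x)"
  using assms(2)
  by (induction I rule: infinite_finite_induct) (auto intro: Ck_on_add Ck_on_const assms(1))

lemma Ck_on_linear_comp:
  assumes "bounded_linear h" "open S" "Ck_on k S f"
  shows "Ck_on k S (\<lambda>x. h (f x))"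
  using assms(3)
proof (induction k arbitrary: f)
  case 0
  then show ?case using bounded_linear.continuous_on[OF assms(1)] by auto
next
  case (Suc k)
  show ?case
    by (rule Ck_on_Suc_intro[OF assms(2), where D = "\<lambda>x v. h (frechet_derivative f (at x) v)"])
      (use Suc.prems in \<open>auto intro!: bounded_linear.has_derivative[OF assms(1)] Suc.IH
         Ck_on_Suc_has_derivative[OF Suc.prems(1)]\<close>)
qed

text \<open>The codomain of the inner map is finite-dimensional so that the derivative of the composition can be
  written as a finite sum of products over a basis: the operator-valued map \<open>x \<mapsto> Dg(f x)\<close> itself
  is not covered by the directional definition of \<open>C\<^sup>k\<close>.\<close>

lemma Ck_on_compose:
  fixes f :: "'e::real_normed_vector \<Rightarrow> 'f::euclidean_space"
  assumes "open S" "open T" "Ck_on k S f" "Ck_on k T g" "f ` S \<subseteq> T"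
  shows "Ck_on k S (\<lambda>x. g (f x))"
  using assms(3,4)
proof (induction k arbitrary: g)
  case 0
  then show ?case using assms(5) by (auto intro: continuous_on_compose2)
next
  case (Suc k)
  have f: "Ck_on k S (\<lambda>x. frechet_derivative f (at x) v)" for v
    using Suc.prems by auto
  have g: "Ck_on k T (\<lambda>x. frechet_derivative g (at x) v)" for v
    using Suc.prems by auto
  have D: "((\<lambda>x. g (f x)) has_derivative
      (\<lambda>v. \<Sum>b\<in>Basis. (frechet_derivative f (at x) v \<bullet> b) *\<^sub>R frechet_derivative g (at (f x)) b)) (at x)"
    if "x \<in> S" for x
  proof -
    have fx: "(f has_derivative frechet_derivative f (at x)) (at x)"
      by (rule Ck_on_Suc_has_derivative[OF Suc.prems(1) that])
    have "f x \<in> T" using that assms(5) by auto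
    then have gx: "(g has_derivative frechet_derivative g (at (f x))) (at (f x))"
      by (rule Ck_on_Suc_has_derivative[OF Suc.prems(2)])
    have L: "linear (frechet_derivative g (at (f x)))"
      by (rule has_derivative_linear[OF gx])
    have "frechet_derivative g (at (f x)) u = (\<Sum>b\<in>Basis. (u \<bullet> b) *\<^sub>R frechet_derivative g (at (f x)) b)" for u
    proof -
      have "frechet_derivative g (at (f x)) u = frechet_derivative g (at (f x)) (\<Sum>b\<in>Basis. (u \<bullet> b) *\<^sub>R b)"
        by (simp only: euclidean_representation)
      also have "\<dots> = (\<Sum>b\<in>Basis. (u \<bullet> b) *\<^sub>R frechet_derivative g (at (f x)) b)"
        by (simp only: linear_sum[OF L] linear_cmul[OF L])
      finally show ?thesis .
    qed
    moreover have "((\<lambda>x. g (f x)) has_derivative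
        (\<lambda>v. frechet_derivative g (at (f x)) (frechet_derivative f (at x) v))) (at x)"
      using diff_chain_at[OF fx gx] by (simp add: comp_def)
    ultimately show ?thesis
      by (blast intro: has_derivative_eq_rhs)
  qed
  have "Ck_on k S (\<lambda>x. frechet_derivative f (at x) v \<bullet> b)" for v b
    by (rule Ck_on_linear_comp[OF bounded_linear_inner_left assms(1) f])
  moreover have "Ck_on k S (\<lambda>x. frechet_derivative g (at (f x)) b)" for b
    by (rule Suc.IH[OF Ck_on_Suc_weaken[OF Suc.prems(1)] g])
  ultimately have "Ck_on k S (\<lambda>x. (frechet_derivative f (at x) v \<bullet> b) *\<^sub>R frechet_derivative g (at (f x)) b)" for v b
    by (rule Ck_on_bilinear[OF bounded_bilinear_scaleR assms(1)])
  then show ?case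
    by (intro Ck_on_Suc_intro[OF assms(1) D] Ck_on_sum assms(1))
qed

lemma Ck_on_inverse:
  fixes f :: "'e::real_normed_vector \<Rightarrow> real"
  assumes "open S" "Ck_on k S f" "\<And>x. x \<in> S \<Longrightarrow> f x \<noteq> 0"
  shows "Ck_on k S (\<lambda>x. inverse (f x))"
  using assms(2)
proof (induction k)
  case 0
  then show ?case using assms(3) by (auto intro: continuous_intros)
next
  case (Suc k)
  have f: "Ck_on k S (\<lambda>x. frechet_derivative f (at x) v)" for v
    using Suc.prems by auto
  have i: "Ck_on k S (\<lambda>x. inverse (f x))"
    by (rule Suc.IH[OF Ck_on_Suc_weaken[OF Suc.prems]])
  have D: "((\<lambda>x. inverse (f x)) has_derivative
      (\<lambda>v. (inverse (f x) * inverse (f x)) * (- 1 * frechet_derivative f (at x) v))) (at x)" if "x \<in> S" for x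
    using Deriv.has_derivative_inverse[OF assms(3)[OF that] Ck_on_Suc_has_derivative[OF Suc.prems that]]
    by (simp add: algebra_simps)
  have n: "Ck_on k S (\<lambda>x. - 1 * frechet_derivative f (at x) v)" for v
    by (rule Ck_on_bilinear[OF bounded_bilinear_mult assms(1) Ck_on_const[OF assms(1)] f])
  show ?case
    by (rule Ck_on_Suc_intro[OF assms(1) D], assumption)
      (rule Ck_on_bilinear[OF bounded_bilinear_mult assms(1)
        Ck_on_bilinear[OF bounded_bilinear_mult assms(1) i i] n])
qed

lemma Ck_on_Pair:
  assumes "open S" "Ck_on k S f" "Ck_on k S g"
  shows "Ck_on k S (\<lambda>x. (f x, g x))"
proof -
  have "Ck_on k S (\<lambda>x. (f x, 0) + (0, g x))"
    by (rule Ck_on_add[OF assms(1) Ck_on_linear_comp[OF _ assms(1,2)] Ck_on_linear_comp[OF _ assms(1,3)]])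
       (auto intro: bounded_linear_Pair bounded_linear_ident bounded_linear_zero)
  then show ?thesis by simp
qed

lemma frechet_derivative_along_line:
  assumes "f differentiable (at (x + t *\<^sub>R v))"
  shows "((\<lambda>t. f (x + t *\<^sub>R v)) has_real_derivative frechet_derivative f (at (x + t *\<^sub>R v)) v) (at t)"
proof -
  have f: "(f has_derivative frechet_derivative f (at (x + t *\<^sub>R v))) (at (x + t *\<^sub>R v))"
    using assms by (simp add: frechet_derivative_works)
  have l: "((\<lambda>t. x + t *\<^sub>R v) has_derivative (\<lambda>h. h *\<^sub>R v)) (at t)"
    by (auto intro!: derivative_eq_intros)
  have "((\<lambda>t. f (x + t *\<^sub>R v)) has_derivative
      (\<lambda>h. frechet_derivative f (at (x + t *\<^sub>R v)) (h *\<^sub>R v))) (at t)"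
    using diff_chain_at[OF l f] by (simp add: comp_def)
  then show ?thesis
    unfolding has_field_derivative_def
    by (rule has_derivative_eq_rhs) (simp add: linear_cmul[OF has_derivative_linear[OF f]] fun_eq_iff)
qed

text \<open>The second difference of \<open>f\<close> along the parallelogram spanned by \<open>h u\<close> and \<open>h v\<close> does not change when \<open>u\<close> and
  \<open>v\<close> are exchanged. Two applications of the mean value theorem turn it into \<open>h\<^sup>2\<close> times the second
  derivative at an intermediate point, and that derivative is continuous.\<close>

lemma second_derivative_limit:
  fixes f :: "'e::real_normed_vector \<Rightarrow> real"
  assumes S: "open S" "x \<in> S" and f: "Ck_on 2 S f" and e: "0 < e"
  shows "\<exists>d>0. \<forall>h. 0 < h \<and> h < d \<longrightarrow>
    \<bar>(f (x + h *\<^sub>R u + h *\<^sub>R v) - f (x + h *\<^sub>R u) - f (x + h *\<^sub>R v) + f x) -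
      h^2 * frechet_derivative (\<lambda>y. frechet_derivative f (at y) u) (at x) v\<bar> \<le> e * h^2"
proof -
  define g where "g = (\<lambda>y. frechet_derivative f (at y) u)"
  define B where "B = (\<lambda>y. frechet_derivative g (at y) v)"
  have f1: "\<And>y. y \<in> S \<Longrightarrow> f differentiable (at y)"
    using f by (simp add: numeral_2_eq_2)
  have g1: "\<And>y. y \<in> S \<Longrightarrow> g differentiable (at y)"
    using f by (simp add: numeral_2_eq_2 g_def)
  have "continuous_on S B"
    using f by (simp add: numeral_2_eq_2 g_def B_def)
  then have "continuous (at x) B"
    using S continuous_on_eq_continuous_at by blast
  then obtain r where r: "r > 0" "\<And>y. dist y x < r \<Longrightarrow> dist (B y) (B x) < e"
    using e unfolding continuous_at_eps_delta by blast
  obtain s where s: "s > 0" "ball x s \<subseteq> S"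
    using S openE by blast
  \<comment> \<open>For \<open>0 \<le> a, b \<le> h < d\<close> the point \<open>x + a u + b v\<close> stays within \<open>min r s\<close> of \<open>x\<close>.\<close>
  define d where "d = min r s / (norm u + norm v + 1)"
  have d: "d > 0" using r s by (auto simp: d_def intro!: divide_pos_pos add_nonneg_pos)
  have near: "x + a *\<^sub>R u + b *\<^sub>R v \<in> S" "\<bar>B (x + a *\<^sub>R u + b *\<^sub>R v) - B x\<bar> \<le> e"
    if "0 \<le> a" "a \<le> h" "0 \<le> b" "b \<le> h" "h < d" for a b h
  proof -
    have "norm (a *\<^sub>R u + b *\<^sub>R v) \<le> \<bar>a\<bar> * norm u + \<bar>b\<bar> * norm v"
      using norm_triangle_ineq[of "a *\<^sub>R u" "b *\<^sub>R v"] by simp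
    also have "\<dots> \<le> h * norm u + h * norm v"
      using that by (intro add_mono mult_right_mono) auto
    also have "\<dots> \<le> h * (norm u + norm v + 1)"
      using that by (simp add: algebra_simps)
    also have "\<dots> < d * (norm u + norm v + 1)"
      using that by (intro mult_strict_right_mono) (auto intro: add_nonneg_pos)
    also have "\<dots> = min r s"
      using add_nonneg_pos[of "norm u + norm v" 1] by (simp add: d_def)
    finally have "dist (x + a *\<^sub>R u + b *\<^sub>R v) x < min r s"
      by (simp add: dist_norm add.assoc)
    then show "x + a *\<^sub>R u + b *\<^sub>R v \<in> S" "\<bar>B (x + a *\<^sub>R u + b *\<^sub>R v) - B x\<bar> \<le> e"
      using s(2) r(2)[of "x + a *\<^sub>R u + b *\<^sub>R v"] by (auto simp: dist_commute dist_real_def)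
  qed
  show ?thesis
  proof (intro exI[of _ d] conjI d allI impI, goal_cases)
    case (1 h)
    define k where "k = (\<lambda>t. f ((x + h *\<^sub>R v) + t *\<^sub>R u) - f (x + t *\<^sub>R u))"
    have k': "(k has_real_derivative
        (g ((x + h *\<^sub>R v) + t *\<^sub>R u) - g (x + t *\<^sub>R u))) (at t)" if "0 \<le> t" "t \<le> h" for t
      unfolding k_def g_def
      using near(1)[of t h h] near(1)[of t h 0] that 1
      by (intro DERIV_diff frechet_derivative_along_line f1) (auto simp: algebra_simps)
    obtain a where a: "0 < a" "a < h" "k h - k 0 = (h - 0) * (g ((x + h *\<^sub>R v) + a *\<^sub>R u) - g (x + a *\<^sub>R u))"
      using MVT2[of 0 h k "\<lambda>t. g ((x + h *\<^sub>R v) + t *\<^sub>R u) - g (x + t *\<^sub>R u)"] k' 1 by auto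
    have l': "((\<lambda>t. g ((x + a *\<^sub>R u) + t *\<^sub>R v)) has_real_derivative
        B ((x + a *\<^sub>R u) + t *\<^sub>R v)) (at t)" if "0 \<le> t" "t \<le> h" for t
      unfolding B_def
      using near(1)[of a h t] that 1 a
      by (intro frechet_derivative_along_line g1) (auto simp: algebra_simps)
    obtain b where b: "0 < b" "b < h"
      "g ((x + a *\<^sub>R u) + h *\<^sub>R v) - g ((x + a *\<^sub>R u) + 0 *\<^sub>R v) = (h - 0) * B ((x + a *\<^sub>R u) + b *\<^sub>R v)"
      using MVT2[of 0 h "\<lambda>t. g ((x + a *\<^sub>R u) + t *\<^sub>R v)" "\<lambda>t. B ((x + a *\<^sub>R u) + t *\<^sub>R v)"] l' 1 by auto
    have "f (x + h *\<^sub>R u + h *\<^sub>R v) - f (x + h *\<^sub>R u) - f (x + h *\<^sub>R v) + f x = k h - k 0"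
      by (simp add: k_def algebra_simps)
    also have "\<dots> = h^2 * B (x + a *\<^sub>R u + b *\<^sub>R v)"
      using a(3) b(3) by (simp add: algebra_simps power2_eq_square)
    finally have "\<bar>(f (x + h *\<^sub>R u + h *\<^sub>R v) - f (x + h *\<^sub>R u) - f (x + h *\<^sub>R v) + f x) - h^2 * B x\<bar>
        = \<bar>h^2 * (B (x + a *\<^sub>R u + b *\<^sub>R v) - B x)\<bar>"
      by (simp only: right_diff_distrib)
    also have "\<dots> = \<bar>B (x + a *\<^sub>R u + b *\<^sub>R v) - B x\<bar> * h^2"
      by (simp add: abs_mult)
    also have "\<dots> \<le> e * h^2"
      using near(2)[of a h b] a b 1 by (intro mult_right_mono) auto
    finally show ?case by (simp add: B_def g_def)
  qed
qed

lemma second_derivative_symmetric: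
  fixes f :: "'e::real_normed_vector \<Rightarrow> real"
  assumes "open S" "x \<in> S" "Ck_on 2 S f"
  shows "frechet_derivative (\<lambda>y. frechet_derivative f (at y) u) (at x) v =
    frechet_derivative (\<lambda>y. frechet_derivative f (at y) v) (at x) u" (is "?A = ?B")
proof (rule ccontr)
  assume "?A \<noteq> ?B"
  \<comment> \<open>Two errors of \<open>e h\<^sup>2\<close> cannot add up to the distance \<open>3 e h\<^sup>2\<close>.\<close>
  define e where "e = \<bar>?A - ?B\<bar> / 3"
  have e: "e > 0" using \<open>?A \<noteq> ?B\<close> by (simp add: e_def)
  obtain d1 where d1: "d1 > 0" "\<And>h. 0 < h \<Longrightarrow> h < d1 \<Longrightarrow>
    \<bar>(f (x + h *\<^sub>R u + h *\<^sub>R v) - f (x + h *\<^sub>R u) - f (x + h *\<^sub>R v) + f x) - h^2 * ?A\<bar> \<le> e * h^2"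
    using second_derivative_limit[OF assms e, of u v] by blast
  obtain d2 where d2: "d2 > 0" "\<And>h. 0 < h \<Longrightarrow> h < d2 \<Longrightarrow>
    \<bar>(f (x + h *\<^sub>R v + h *\<^sub>R u) - f (x + h *\<^sub>R v) - f (x + h *\<^sub>R u) + f x) - h^2 * ?B\<bar> \<le> e * h^2"
    using second_derivative_limit[OF assms e, of v u] by blast
  define h where "h = min d1 d2 / 2"
  have h: "0 < h" "h < d1" "h < d2" using d1 d2 by (auto simp: h_def min_def)
  have "x + h *\<^sub>R v + h *\<^sub>R u = x + h *\<^sub>R u + h *\<^sub>R v" by simp
  then have "\<bar>(f (x + h *\<^sub>R u + h *\<^sub>R v) - f (x + h *\<^sub>R u) - f (x + h *\<^sub>R v) + f x) - h^2 * ?B\<bar> \<le> e * h^2"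
    using d2(2)[OF h(1,3)] by (simp add: algebra_simps)
  then have "\<bar>h^2 * ?A - h^2 * ?B\<bar> \<le> 2 * (e * h^2)"
    using d1(2)[OF h(1,2)] by linarith
  then have "h^2 * \<bar>?A - ?B\<bar> \<le> h^2 * (2 * e)"
    by (simp only: right_diff_distrib[symmetric] abs_mult abs_power2) (simp only: mult_ac)
  then have "\<bar>?A - ?B\<bar> \<le> 2 * e"
    using h by (simp only: mult_le_cancel_left_pos zero_less_power)
  then show False using e by (simp add: e_def)
qed

section \<open>Charts and functions smooth near a point\<close>

locale manifold_locale =
  fixes M :: "('a, real^'n) manifold"
  assumes smooth_manifold: "smooth_manifold M"
begin

abbreviation chart_inv :: "('a, real^'n) chart \<Rightarrow> real^'n \<Rightarrow> 'a" where
  "chart_inv c \<equiv> inv_into (fst c) (snd c)"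

lemma chart_at: "p \<in> points M \<Longrightarrow> \<exists>c\<in>atlas M. p \<in> fst c"
proof -
  assume "p \<in> points M"
  moreover have "\<Union>(fst ` atlas M) = points M"
    using smooth_manifold by (simp add: smooth_manifold_def)
  ultimately show "\<exists>c\<in>atlas M. p \<in> fst c" by blast
qed

context
  fixes c assumes c: "c \<in> atlas M"
begin

lemma chart_props: "openin (topo M) (fst c)" "open (snd c ` fst c)"
    "homeomorphic_map (subtopology (topo M) (fst c)) (top_of_set (snd c ` fst c)) (snd c)"
proof -
  have "is_chart (topo M) c"
    using c smooth_manifold by (simp add: smooth_manifold_def)
  then show "openin (topo M) (fst c)" "open (snd c ` fst c)"
    "homeomorphic_map (subtopology (topo M) (fst c)) (top_of_set (snd c ` fst c)) (snd c)"
    by (auto simp: is_chart_def case_prod_beta)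
qed

lemma chart_subset: "fst c \<subseteq> points M"
  using chart_props(1) by (rule openin_subset)

lemma chart_inj: "inj_on (snd c) (fst c)"
  using homeomorphic_imp_injective_map[OF chart_props(3)] chart_subset by (simp add: inf.absorb2)

lemma chart_inv_left [simp]: "p \<in> fst c \<Longrightarrow> chart_inv c (snd c p) = p"
  by (rule inv_into_f_f[OF chart_inj])

lemma open_chart_image:
  assumes "openin (topo M) W" shows "open (snd c ` (fst c \<inter> W))"
proof -
  have "openin (subtopology (topo M) (fst c)) (fst c \<inter> W)"
    using assms by (simp add: openin_subtopology_Int2)
  then have "openin (top_of_set (snd c ` fst c)) (snd c ` (fst c \<inter> W))"
    using homeomorphic_map_openness_eq[OF chart_props(3)] by blast
  then show ?thesis
    using chart_props(2) openin_open_trans by blast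
qed

lemma openin_chart_vimage:
  assumes "open T" shows "openin (topo M) {p \<in> fst c. snd c p \<in> T}"
proof -
  have "continuous_map (subtopology (topo M) (fst c)) (top_of_set (snd c ` fst c)) (snd c)"
    by (rule homeomorphic_imp_continuous_map[OF chart_props(3)])
  then have "continuous_map (subtopology (topo M) (fst c)) euclidean (snd c)"
    by (simp add: continuous_map_in_subtopology)
  then have "openin (subtopology (topo M) (fst c)) {p \<in> topspace (subtopology (topo M) (fst c)). snd c p \<in> T}"
    using assms openin_continuous_map_preimage by fastforce
  then have "openin (subtopology (topo M) (fst c)) {p \<in> fst c. snd c p \<in> T}"
    using chart_subset by (simp add: inf.absorb2)
  then show ?thesis
    using chart_props(1) openin_trans_full by blast
qed

lemma transition_smooth:
  assumes "d \<in> atlas M"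
  shows "Ck_on k (snd c ` (fst c \<inter> fst d)) (\<lambda>x. snd d (chart_inv c x))"
proof -
  have "compatible c d"
    using smooth_manifold c assms by (simp add: smooth_manifold_def)
  then show ?thesis
    by (simp add: compatible_def smooth_on_def comp_def case_prod_beta)
qed

end

text \<open>Smoothness is defined by all charts at once; compatibility of the charts makes it enough to test one
  chart around the point. The further facts on smooth functions rest on this criterion and
  the calculus in Euclidean space.\<close>

lemma smooth_near_iff:
  assumes c: "c \<in> atlas M" and p: "p \<in> fst c"
  shows "smooth_near M p f \<longleftrightarrow> (\<exists>T. open T \<and> snd c p \<in> T \<and> T \<subseteq> snd c ` fst c \<and>
     (\<forall>k. Ck_on k T (\<lambda>x. f (chart_inv c x))))"
proof
  assume "smooth_near M p f"
  then obtain W where W: "openin (topo M) W" "p \<in> W" "smooth_fun_on M W f"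
    unfolding smooth_near_def by blast
  have "smooth_on (snd c ` (fst c \<inter> W)) (f \<circ> chart_inv c)"
    using W(3) c by (simp add: smooth_fun_on_def case_prod_beta)
  then show "\<exists>T. open T \<and> snd c p \<in> T \<and> T \<subseteq> snd c ` fst c \<and> (\<forall>k. Ck_on k T (\<lambda>x. f (chart_inv c x)))"
    using open_chart_image[OF c W(1)] p W(2)
    by (intro exI[of _ "snd c ` (fst c \<inter> W)"]) (auto simp: smooth_on_def comp_def)
next
  assume "\<exists>T. open T \<and> snd c p \<in> T \<and> T \<subseteq> snd c ` fst c \<and> (\<forall>k. Ck_on k T (\<lambda>x. f (chart_inv c x)))"
  then obtain T where T: "open T" "snd c p \<in> T" "\<And>k. Ck_on k T (\<lambda>x. f (chart_inv c x))"
    by blast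
  define W where "W = {q \<in> fst c. snd c q \<in> T}"
  have W: "openin (topo M) W" "p \<in> W"
    using openin_chart_vimage[OF c T(1)] p T(2) by (auto simp: W_def)
  have "Ck_on k (snd d ` (fst d \<inter> W)) (\<lambda>x. f (chart_inv d x))" if d: "d \<in> atlas M" for d k
  proof (rule Ck_on_cong)
    show o: "open (snd d ` (fst d \<inter> W))"
      by (rule open_chart_image[OF d W(1)])
    show "Ck_on k (snd d ` (fst d \<inter> W)) (\<lambda>x. (\<lambda>y. f (chart_inv c y)) (snd c (chart_inv d x)))"
    proof (rule Ck_on_compose[OF o T(1)])
      show "Ck_on k (snd d ` (fst d \<inter> W)) (\<lambda>x. snd c (chart_inv d x))"
        by (rule Ck_on_subset[OF transition_smooth[OF d c]]) (auto simp: W_def)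
      show "(\<lambda>x. snd c (chart_inv d x)) ` snd d ` (fst d \<inter> W) \<subseteq> T"
        by (auto simp: d W_def)
    qed (rule T(3))
    show "\<forall>x\<in>snd d ` (fst d \<inter> W). f (chart_inv c (snd c (chart_inv d x))) = f (chart_inv d x)"
      by (auto simp: d c W_def)
  qed
  then have "smooth_fun_on M W f"
    by (simp add: smooth_fun_on_def smooth_on_def comp_def case_prod_beta)
  then show "smooth_near M p f"
    using W unfolding smooth_near_def by blast
qed

lemma smooth_near_point: "smooth_near M p f \<Longrightarrow> p \<in> points M"
  unfolding smooth_near_def using openin_subset by blast

lemma smooth_near_nbhd:
  assumes "smooth_near M p f"
  shows "\<exists>W. openin (topo M) W \<and> p \<in> W \<and> (\<forall>q\<in>W. smooth_near M q f)"
  using assms unfolding smooth_near_def by blast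

lemma smooth_fun_on_iff:
  assumes W: "openin (topo M) W"
  shows "smooth_fun_on M W f \<longleftrightarrow> (\<forall>p\<in>W. smooth_near M p f)"
proof
  assume "smooth_fun_on M W f"
  then show "\<forall>p\<in>W. smooth_near M p f"
    using W unfolding smooth_near_def by blast
next
  assume f: "\<forall>p\<in>W. smooth_near M p f"
  have "Ck_on k (snd d ` (fst d \<inter> W)) (\<lambda>x. f (chart_inv d x))" if d: "d \<in> atlas M" for d k
  proof (rule Ck_on_local)
    fix x assume "x \<in> snd d ` (fst d \<inter> W)"
    then obtain p where "p \<in> fst d" "p \<in> W" "x = snd d p" by blast
    then show "\<exists>T. open T \<and> x \<in> T \<and> Ck_on k T (\<lambda>x. f (chart_inv d x))"
      using smooth_near_iff[OF d, of p f] f by blast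
  qed
  then show "smooth_fun_on M W f"
    by (simp add: smooth_fun_on_def smooth_on_def comp_def case_prod_beta)
qed

lemma smooth_near_cong:
  assumes W: "openin (topo M) W" "p \<in> W" and eq: "\<And>q. q \<in> W \<Longrightarrow> f q = g q" and f: "smooth_near M p f"
  shows "smooth_near M p g"
proof -
  obtain c where c: "c \<in> atlas M" "p \<in> fst c"
    using chart_at smooth_near_point[OF f] by blast
  obtain T where T: "open T" "snd c p \<in> T" "T \<subseteq> snd c ` fst c" "\<And>k. Ck_on k T (\<lambda>x. f (chart_inv c x))"
    using f smooth_near_iff[OF c] by blast
  define T' where "T' = T \<inter> snd c ` (fst c \<inter> W)"
  have o: "open T'" "snd c p \<in> T'" "T' \<subseteq> snd c ` fst c"
    using T open_chart_image[OF c(1) W(1)] c W(2) by (auto simp: T'_def)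
  have "\<forall>x\<in>T'. f (chart_inv c x) = g (chart_inv c x)"
    using c eq by (auto simp: T'_def)
  then have "Ck_on k T' (\<lambda>x. g (chart_inv c x))" for k
    by (rule Ck_on_cong[OF o(1)]) (rule Ck_on_subset[OF T(4)], auto simp: T'_def)
  then show ?thesis
    using o smooth_near_iff[OF c] by blast
qed

text \<open>A common schema for sums and products: shrink to the intersection of the
  two coordinate neighbourhoods on which the operands are smooth.\<close>

lemma smooth_near_combine:
  assumes comb: "\<And>T k. open T \<Longrightarrow> Ck_on k T (\<lambda>x. f (chart_inv c x)) \<Longrightarrow>
      Ck_on k T (\<lambda>x. g (chart_inv c x)) \<Longrightarrow> Ck_on k T (\<lambda>x. h (chart_inv c x))"
    and c: "c \<in> atlas M" "p \<in> fst c" and f: "smooth_near M p f" and g: "smooth_near M p g"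
  shows "smooth_near M p h"
proof -
  obtain T where T: "open T" "snd c p \<in> T" "T \<subseteq> snd c ` fst c" "\<And>k. Ck_on k T (\<lambda>x. f (chart_inv c x))"
    using f smooth_near_iff[OF c] by blast
  obtain S where S: "open S" "snd c p \<in> S" "S \<subseteq> snd c ` fst c" "\<And>k. Ck_on k S (\<lambda>x. g (chart_inv c x))"
    using g smooth_near_iff[OF c] by blast
  have "Ck_on k (S \<inter> T) (\<lambda>x. h (chart_inv c x))" for k
    by (rule comb) (use S T in \<open>auto intro: Ck_on_subset[OF T(4)] Ck_on_subset[OF S(4)]\<close>)
  then show ?thesis
    using S T by (subst smooth_near_iff[OF c]) (intro exI[of _ "S \<inter> T"], auto)
qed

lemma smooth_near_add: "smooth_near M p f \<Longrightarrow> smooth_near M p g \<Longrightarrow> smooth_near M p (\<lambda>q. f q + g q)"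
  using chart_at[OF smooth_near_point] smooth_near_combine[of f _ g "\<lambda>q. f q + g q"] Ck_on_add by blast

lemma smooth_near_mult: "smooth_near M p f \<Longrightarrow> smooth_near M p g \<Longrightarrow> smooth_near M p (\<lambda>q. f q * g q)"
  using chart_at[OF smooth_near_point] smooth_near_combine[of f _ g "\<lambda>q. f q * g q"]
    Ck_on_bilinear[OF bounded_bilinear_mult] by blast

lemma smooth_near_const:
  assumes "p \<in> points M" shows "smooth_near M p (\<lambda>q. a)"
proof -
  obtain c where c: "c \<in> atlas M" "p \<in> fst c"
    using chart_at assms by blast
  show ?thesis
    using c chart_props(2)[OF c(1)] by (subst smooth_near_iff[OF c]) (auto intro: Ck_on_const)
qed

lemma smooth_near_cmult: "smooth_near M p f \<Longrightarrow> smooth_near M p (\<lambda>q. a * f q)"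
  by (intro smooth_near_mult smooth_near_const smooth_near_point)

lemma smooth_near_diff: "smooth_near M p f \<Longrightarrow> smooth_near M p g \<Longrightarrow> smooth_near M p (\<lambda>q. f q - g q)"
  using smooth_near_add[OF _ smooth_near_cmult[of p g "-1"]] by simp

lemma smooth_near_sum:
  assumes "p \<in> points M" "\<And>i. i \<in> I \<Longrightarrow> smooth_near M p (f i)"
  shows "smooth_near M p (\<lambda>q. \<Sum>i\<in>I. f i q)"
  using assms(2)
  by (induction I rule: infinite_finite_induct) (auto intro: smooth_near_add smooth_near_const assms(1))

lemma smooth_near_prod:
  assumes "p \<in> points M" "\<And>i. i \<in> I \<Longrightarrow> smooth_near M p (f i)"
  shows "smooth_near M p (\<lambda>q. \<Prod>i\<in>I. f i q)"
  using assms(2)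
  by (induction I rule: infinite_finite_induct) (auto intro: smooth_near_mult smooth_near_const assms(1))

lemma smooth_near_inverse:
  assumes f: "smooth_near M p f" and nz: "f p \<noteq> 0"
  shows "smooth_near M p (\<lambda>q. inverse (f q))"
proof -
  obtain c where c: "c \<in> atlas M" "p \<in> fst c"
    using chart_at smooth_near_point[OF f] by blast
  obtain T where T: "open T" "snd c p \<in> T" "T \<subseteq> snd c ` fst c" "\<And>k. Ck_on k T (\<lambda>x. f (chart_inv c x))"
    using f smooth_near_iff[OF c] by blast
  define S where "S = T \<inter> (\<lambda>x. f (chart_inv c x)) -` (- {0})"
  have "continuous_on T (\<lambda>x. f (chart_inv c x))"
    using T(4)[of 0] by simp
  then have S: "open S"
    using T(1) unfolding S_def by (intro continuous_open_preimage) auto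
  have "Ck_on k S (\<lambda>x. inverse (f (chart_inv c x)))" for k
    by (rule Ck_on_inverse[OF S Ck_on_subset[OF T(4)]]) (auto simp: S_def)
  then show ?thesis
    using S T c nz by (subst smooth_near_iff[OF c]) (intro exI[of _ S], auto simp: S_def)
qed

lemma smooth_near_coord:
  assumes c: "c \<in> atlas M" "p \<in> fst c"
  shows "smooth_near M p (coord c i)"
proof -
  have "Ck_on k (snd c ` fst c) (\<lambda>x. coord c i (chart_inv c x))" for k
    by (rule Ck_on_cong[OF chart_props(2)[OF c(1)] _ Ck_on_linear[OF bounded_linear_vec_nth[of i] chart_props(2)[OF c(1)]]])
      (auto simp: coord_def c(1))
  then show ?thesis
    using c chart_props(2)[OF c(1)] by (subst smooth_near_iff[OF c]) auto
qed

section \<open>Tangent vectors in coordinates\<close>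

text \<open>The tangent vector with components \<open>u\<close> in the chart \<open>c\<close>. Every tangent vector has this form
  (lemma \<open>tangent_space_eq\<close> below), which replaces curves by linear algebra.\<close>

definition tangent_of_coords :: "('a, real^'n) chart \<Rightarrow> 'a \<Rightarrow> real^'n \<Rightarrow> 'a tangent" where
  "tangent_of_coords c p u = (\<lambda>f. if smooth_near M p f
     then frechet_derivative (\<lambda>x. f (chart_inv c x)) (at (snd c p)) u else 0)"

lemma coord_vector_eq: "coord_vector M c i p = tangent_of_coords c p (axis i 1)"
  unfolding coord_vector_def tangent_of_coords_def comp_def ..

lemma smooth_near_has_derivative:
  assumes c: "c \<in> atlas M" "p \<in> fst c" and f: "smooth_near M p f"
  shows "((\<lambda>x. f (chart_inv c x)) has_derivative
    frechet_derivative (\<lambda>x. f (chart_inv c x)) (at (snd c p))) (at (snd c p))"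
proof -
  obtain T where T: "open T" "snd c p \<in> T" "T \<subseteq> snd c ` fst c" "\<And>k. Ck_on k T (\<lambda>x. f (chart_inv c x))"
    using f smooth_near_iff[OF c] by blast
  show ?thesis
    by (rule Ck_on_Suc_has_derivative[OF T(4) T(2)])
qed

lemma tangent_of_coords_eqI:
  assumes c: "c \<in> atlas M" "p \<in> fst c" and f: "smooth_near M p f"
    and D: "((\<lambda>x. f (chart_inv c x)) has_derivative D) (at (snd c p))"
  shows "tangent_of_coords c p u f = D u"
  using f frechet_derivative_at[OF D] by (simp add: tangent_of_coords_def)

lemma tangent_of_coords_coord:
  assumes c: "c \<in> atlas M" "p \<in> fst c"
  shows "tangent_of_coords c p u (coord c i) = u $ i"
proof (rule tangent_of_coords_eqI[OF c smooth_near_coord[OF c]])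
  have "((\<lambda>x. x $ i) has_derivative (\<lambda>x. x $ i)) (at (snd c p))"
    by (rule bounded_linear_imp_has_derivative[OF bounded_linear_vec_nth])
  then show "((\<lambda>x. coord c i (chart_inv c x)) has_derivative (\<lambda>x. x $ i)) (at (snd c p))"
    by (rule has_derivative_transform_within_open[OF _ chart_props(2)[OF c(1)]])
       (use c in \<open>auto simp: coord_def\<close>)
qed

lemma tangent_of_coords_linear:
  assumes c: "c \<in> atlas M" "p \<in> fst c"
  shows "tangent_of_coords c p (a *\<^sub>R u + b *\<^sub>R w) f =
    a * tangent_of_coords c p u f + b * tangent_of_coords c p w f"
proof (cases "smooth_near M p f")
  case True
  have "linear (frechet_derivative (\<lambda>x. f (chart_inv c x)) (at (snd c p)))"
    by (rule has_derivative_linear[OF smooth_near_has_derivative[OF c True]])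
  then show ?thesis
    using True by (simp add: tangent_of_coords_def linear_add linear_cmul)
qed (simp add: tangent_of_coords_def)

lemma tangent_of_coords_expand:
  assumes c: "c \<in> atlas M" "p \<in> fst c"
  shows "tangent_of_coords c p u f = (\<Sum>i\<in>UNIV. u $ i * coord_vector M c i p f)"
proof (cases "smooth_near M p f")
  case True
  let ?L = "frechet_derivative (\<lambda>x. f (chart_inv c x)) (at (snd c p))"
  have L: "linear ?L"
    by (rule has_derivative_linear[OF smooth_near_has_derivative[OF c True]])
  have "?L u = ?L (\<Sum>i\<in>UNIV. u $ i *s axis i 1)"
    by (simp add: basis_expansion)
  also have "\<dots> = (\<Sum>i\<in>UNIV. u $ i * ?L (axis i 1))"
    by (simp add: linear_sum[OF L] linear_cmul[OF L] scalar_mult_eq_scaleR)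
  finally show ?thesis
    using True by (simp add: tangent_of_coords_def coord_vector_eq)
qed (simp add: tangent_of_coords_def coord_vector_eq)

text \<open>The atlas of an interval uses the identity as its only chart, so that the inverse chart in the
  definition of smoothness disappears.\<close>

lemma smooth_curve_chart:
  assumes \<gamma>: "smooth_curve M I \<gamma>" and c: "c \<in> atlas M"
  shows "open {t \<in> I. \<gamma> t \<in> fst c}" "Ck_on k {t \<in> I. \<gamma> t \<in> fst c} (\<lambda>t. snd c (\<gamma> t))"
proof -
  have I: "open I" and cont: "continuous_map (top_of_set I) (topo M) \<gamma>"
    and sm: "smooth_map (interval_manifold I) M \<gamma>"
    using \<gamma> by (auto simp: smooth_curve_def open_interval_def smooth_map_def interval_manifold_def)
  have "openin (top_of_set I) {t \<in> I. \<gamma> t \<in> fst c}"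
    using openin_continuous_map_preimage[OF cont chart_props(1)[OF c]] by simp
  then show o: "open {t \<in> I. \<gamma> t \<in> fst c}"
    using I openin_open_trans by blast
  have "smooth_on ((\<lambda>t. t) ` {t \<in> I. \<gamma> t \<in> fst c}) (snd c \<circ> \<gamma> \<circ> inv_into I (\<lambda>t. t))"
    using sm c by (simp add: smooth_map_def interval_manifold_def case_prod_beta)
  then have K: "Ck_on k {t \<in> I. \<gamma> t \<in> fst c} (\<lambda>t. snd c (\<gamma> (inv_into I (\<lambda>t. t) t)))"
    by (simp add: smooth_on_def comp_def)
  have "inv_into I (\<lambda>t. t) t = t" if "t \<in> I" for t
    using inv_into_f_f[of "\<lambda>t. t" I t] that by (simp add: inj_on_def)
  then show "Ck_on k {t \<in> I. \<gamma> t \<in> fst c} (\<lambda>t. snd c (\<gamma> t))"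
    by (intro Ck_on_cong[OF o _ K]) simp
qed

lemma smooth_curve_point: "smooth_curve M I \<gamma> \<Longrightarrow> t \<in> I \<Longrightarrow> \<gamma> t \<in> points M"
  unfolding smooth_curve_def smooth_map_def interval_manifold_def continuous_map_def by auto

lemma smooth_curve_has_derivative:
  assumes \<gamma>: "smooth_curve M I \<gamma>" and t: "t \<in> I" and f: "smooth_near M (\<gamma> t) f"
  shows "((\<lambda>s. f (\<gamma> s)) has_real_derivative velocity M \<gamma> t f) (at t)"
    and "c \<in> atlas M \<Longrightarrow> \<gamma> t \<in> fst c \<Longrightarrow>
      velocity M \<gamma> t f = tangent_of_coords c (\<gamma> t) (\<chi> i. deriv (coord c i \<circ> \<gamma>) t) f"
proof -
  have main: "((\<lambda>s. f (\<gamma> s)) has_real_derivative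
      tangent_of_coords c (\<gamma> t) (\<chi> i. deriv (coord c i \<circ> \<gamma>) t) f) (at t)"
    if c: "c \<in> atlas M" "\<gamma> t \<in> fst c" for c
  proof -
    let ?S = "{t \<in> I. \<gamma> t \<in> fst c}"
    define A where "A = frechet_derivative (\<lambda>t. snd c (\<gamma> t)) (at t)"
    have A: "((\<lambda>t. snd c (\<gamma> t)) has_derivative A) (at t)"
      unfolding A_def
      by (rule Ck_on_Suc_has_derivative[OF smooth_curve_chart(2)[OF \<gamma> c(1)]]) (use t c in auto)
    have Ai: "((\<lambda>t. snd c (\<gamma> t) $ i) has_derivative (\<lambda>h. A h $ i)) (at t)" for i
      by (rule bounded_linear.has_derivative[OF bounded_linear_vec_nth A])
    have A_lin: "A h = h *\<^sub>R A 1" for h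
      using linear_cmul[OF has_derivative_linear[OF A], of h 1] by simp
    have "((\<lambda>t. snd c (\<gamma> t) $ i) has_real_derivative A 1 $ i) (at t)" for i
      unfolding has_field_derivative_def
      by (rule has_derivative_eq_rhs[OF Ai]) (rule ext, subst A_lin, simp)
    then have A1: "A 1 = (\<chi> i. deriv (coord c i \<circ> \<gamma>) t)"
      by (simp add: vec_eq_iff coord_def comp_def DERIV_imp_deriv[THEN sym])
    let ?L = "frechet_derivative (\<lambda>x. f (chart_inv c x)) (at (snd c (\<gamma> t)))"
    have L: "((\<lambda>x. f (chart_inv c x)) has_derivative ?L) (at (snd c (\<gamma> t)))"
      by (rule smooth_near_has_derivative[OF c f])
    have "((\<lambda>s. f (chart_inv c (snd c (\<gamma> s)))) has_derivative (\<lambda>h. ?L (A h))) (at t)"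
      using diff_chain_at[OF A L] by (simp add: comp_def)
    then have "((\<lambda>s. f (\<gamma> s)) has_derivative (\<lambda>h. ?L (A h))) (at t)"
      by (rule has_derivative_transform_within_open[OF _ smooth_curve_chart(1)[OF \<gamma> c(1)]])
         (use t c in auto)
    moreover have "?L (A h) = ?L (A 1) * h" for h
      by (subst A_lin) (simp add: linear_cmul[OF has_derivative_linear[OF L]])
    ultimately have "((\<lambda>s. f (\<gamma> s)) has_real_derivative ?L (A 1)) (at t)"
      unfolding has_field_derivative_def by (blast intro: has_derivative_eq_rhs)
    then show ?thesis
      using f by (simp add: tangent_of_coords_def A1)
  qed
  have v: "velocity M \<gamma> t f = tangent_of_coords c (\<gamma> t) (\<chi> i. deriv (coord c i \<circ> \<gamma>) t) f"
    if "c \<in> atlas M" "\<gamma> t \<in> fst c" for c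
    using main[OF that] f by (simp add: velocity_def comp_def DERIV_imp_deriv)
  then show "c \<in> atlas M \<Longrightarrow> \<gamma> t \<in> fst c \<Longrightarrow>
      velocity M \<gamma> t f = tangent_of_coords c (\<gamma> t) (\<chi> i. deriv (coord c i \<circ> \<gamma>) t) f" .
  obtain d where d: "d \<in> atlas M" "\<gamma> t \<in> fst d"
    using chart_at smooth_curve_point[OF \<gamma> t] by blast
  show "((\<lambda>s. f (\<gamma> s)) has_real_derivative velocity M \<gamma> t f) (at t)"
    unfolding v[OF d] by (rule main[OF d])
qed

lemma velocity_eq:
  assumes \<gamma>: "smooth_curve M I \<gamma>" and t: "t \<in> I" and c: "c \<in> atlas M" "\<gamma> t \<in> fst c"
  shows "velocity M \<gamma> t = tangent_of_coords c (\<gamma> t) (\<chi> i. deriv (coord c i \<circ> \<gamma>) t)"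
proof
  fix f show "velocity M \<gamma> t f = tangent_of_coords c (\<gamma> t) (\<chi> i. deriv (coord c i \<circ> \<gamma>) t) f"
    using smooth_curve_has_derivative(2)[OF \<gamma> t _ c, of f]
    by (cases "smooth_near M (\<gamma> t) f") (auto simp: velocity_def tangent_of_coords_def)
qed

text \<open>The tangent vector with components \<open>u\<close> is the velocity of the curve that is the straight line
  \<open>t \<mapsto> x + t u\<close> in the chart, for \<open>t\<close> so small that the line stays in the range of the chart.\<close>

lemma tangent_of_coords_in_tangent_space:
  assumes c: "c \<in> atlas M" "p \<in> fst c"
  shows "tangent_of_coords c p u \<in> tangent_space M p"
proof -
  have "open ((\<lambda>t. snd c p + t *\<^sub>R u) -` (snd c ` fst c))"
    by (intro open_vimage chart_props(2)[OF c(1)] continuous_intros)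
  moreover have "(0::real) \<in> (\<lambda>t. snd c p + t *\<^sub>R u) -` (snd c ` fst c)"
    using c by auto
  ultimately obtain e where e: "e > 0" "ball 0 e \<subseteq> (\<lambda>t. snd c p + t *\<^sub>R u) -` (snd c ` fst c)"
    using openE by blast
  define I where "I = ball (0::real) e"
  define \<gamma> where "\<gamma> = (\<lambda>t. chart_inv c (snd c p + t *\<^sub>R u))"
  have mem: "\<gamma> t \<in> fst c" "snd c (\<gamma> t) = snd c p + t *\<^sub>R u" if "t \<in> I" for t
  proof -
    have "snd c p + t *\<^sub>R u \<in> snd c ` fst c"
      using e(2) that unfolding I_def by blast
    then show "\<gamma> t \<in> fst c" "snd c (\<gamma> t) = snd c p + t *\<^sub>R u"
      unfolding \<gamma>_def by (rule inv_into_into, rule f_inv_into_f)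
  qed
  have I: "open_interval I"
    by (simp add: open_interval_def I_def is_interval_convex_1)
  have op: "open {t \<in> I. \<gamma> t \<in> W}" if W: "openin (topo M) W" for W
  proof -
    have "{t \<in> I. \<gamma> t \<in> W} = I \<inter> (\<lambda>t. snd c p + t *\<^sub>R u) -` (snd c ` (fst c \<inter> W))"
    proof (intro equalityI subsetI)
      fix t assume t: "t \<in> {t \<in> I. \<gamma> t \<in> W}"
      then show "t \<in> I \<inter> (\<lambda>t. snd c p + t *\<^sub>R u) -` (snd c ` (fst c \<inter> W))"
        using mem[of t] by (auto intro!: image_eqI[of _ _ "\<gamma> t"])
    next
      fix t assume "t \<in> I \<inter> (\<lambda>t. snd c p + t *\<^sub>R u) -` (snd c ` (fst c \<inter> W))"
      then obtain q where "t \<in> I" "q \<in> fst c" "q \<in> W" "snd c p + t *\<^sub>R u = snd c q" by auto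
      then show "t \<in> {t \<in> I. \<gamma> t \<in> W}"
        by (simp add: \<gamma>_def c)
    qed
    moreover have "open ((\<lambda>t. snd c p + t *\<^sub>R u) -` (snd c ` (fst c \<inter> W)))"
      by (intro open_vimage open_chart_image[OF c(1) W] continuous_intros)
    ultimately show ?thesis
      by (auto simp: I_def)
  qed
  have cont: "continuous_map (top_of_set I) (topo M) \<gamma>"
    unfolding continuous_map_def
  proof (intro conjI allI impI)
    show "\<gamma> \<in> topspace (top_of_set I) \<rightarrow> points M"
      using mem(1) chart_subset[OF c(1)] by auto
    fix W assume "openin (topo M) W"
    then show "openin (top_of_set I) {x \<in> topspace (top_of_set I). \<gamma> x \<in> W}"
      using op[of W] by (auto intro!: open_subset)
  qed
  have sm: "Ck_on k {t \<in> I. \<gamma> t \<in> fst d} (\<lambda>t. snd d (\<gamma> (inv_into I (\<lambda>t. t) t)))"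
    if d: "d \<in> atlas M" for d k
  proof (rule Ck_on_cong)
    show o: "open {t \<in> I. \<gamma> t \<in> fst d}"
      by (rule op[OF chart_props(1)[OF d]])
    show "Ck_on k {t \<in> I. \<gamma> t \<in> fst d} (\<lambda>t. (\<lambda>x. snd d (chart_inv c x)) (snd c p + t *\<^sub>R u))"
    proof (rule Ck_on_compose[OF o _ _ transition_smooth[OF c(1) d]])
      show "open (snd c ` (fst c \<inter> fst d))"
        by (rule open_chart_image[OF c(1) chart_props(1)[OF d]])
      show "Ck_on k {t \<in> I. \<gamma> t \<in> fst d} (\<lambda>t. snd c p + t *\<^sub>R u)"
        by (intro Ck_on_add o Ck_on_const Ck_on_linear bounded_linear_scaleR_left)
      show "(\<lambda>t. snd c p + t *\<^sub>R u) ` {t \<in> I. \<gamma> t \<in> fst d} \<subseteq> snd c ` (fst c \<inter> fst d)"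
      proof
        fix x assume "x \<in> (\<lambda>t. snd c p + t *\<^sub>R u) ` {t \<in> I. \<gamma> t \<in> fst d}"
        then obtain t where "t \<in> I" "\<gamma> t \<in> fst d" "x = snd c p + t *\<^sub>R u" by blast
        then show "x \<in> snd c ` (fst c \<inter> fst d)"
          using mem[of t] by (auto intro!: image_eqI[of _ _ "\<gamma> t"])
      qed
    qed
    have "inv_into I (\<lambda>t. t) t = t" if "t \<in> I" for t
      using inv_into_f_f[of "\<lambda>t. t" I t] that by (simp add: inj_on_def)
    then show "\<forall>t\<in>{t \<in> I. \<gamma> t \<in> fst d}. snd d (chart_inv c (snd c p + t *\<^sub>R u)) =
        snd d (\<gamma> (inv_into I (\<lambda>t. t) t))"
      by (simp add: \<gamma>_def)
  qed
  have \<gamma>: "smooth_curve M I \<gamma>"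
    unfolding smooth_curve_def smooth_map_def interval_manifold_def
    using I cont sm by (simp add: smooth_on_def comp_def case_prod_beta)
  have I0: "0 \<in> I" and \<gamma>0: "\<gamma> 0 = p"
    using e c by (auto simp: I_def \<gamma>_def)
  have "deriv (coord c i \<circ> \<gamma>) 0 = u $ i" for i
  proof (rule DERIV_imp_deriv)
    have "((\<lambda>t. snd c p $ i + t * u $ i) has_real_derivative u $ i) (at 0)"
      by (auto intro!: derivative_eq_intros)
    moreover have "snd c p $ i + t * u $ i = (coord c i \<circ> \<gamma>) t" if "t \<in> I" for t
      using mem(2)[OF that] by (simp add: coord_def)
    ultimately show "((coord c i \<circ> \<gamma>) has_real_derivative u $ i) (at 0)"
      using I0 I unfolding has_field_derivative_def open_interval_def
      by (metis (no_types, lifting) has_derivative_transform_within_open)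
  qed
  then have "(\<chi> i. deriv (coord c i \<circ> \<gamma>) 0) = u"
    by (simp add: vec_eq_iff)
  then have "velocity M \<gamma> 0 = tangent_of_coords c p u"
    using velocity_eq[OF \<gamma> I0, of c] c \<gamma>0 by simp
  moreover have "velocity M \<gamma> 0 \<in> tangent_space M p"
    using \<gamma> I0 \<gamma>0 unfolding tangent_space_def by blast
  ultimately show ?thesis by simp
qed

lemma tangent_space_point: "v \<in> tangent_space M p \<Longrightarrow> p \<in> points M"
  unfolding tangent_space_def using smooth_curve_point by blast

lemma tangent_space_eq:
  assumes c: "c \<in> atlas M" "p \<in> fst c"
  shows "tangent_space M p = range (tangent_of_coords c p)"
proof
  show "tangent_space M p \<subseteq> range (tangent_of_coords c p)"
    unfolding tangent_space_def using velocity_eq[OF _ _ c(1)] c(2) by blast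
  show "range (tangent_of_coords c p) \<subseteq> tangent_space M p"
    using tangent_of_coords_in_tangent_space[OF c] by blast
qed

lemma velocity_in_tangent_space:
  assumes "smooth_curve M I \<gamma>" "t \<in> I"
  shows "velocity M \<gamma> t \<in> tangent_space M (\<gamma> t)"
proof -
  obtain c where c: "c \<in> atlas M" "\<gamma> t \<in> fst c"
    using chart_at smooth_curve_point[OF assms] by blast
  show ?thesis
    unfolding velocity_eq[OF assms c] by (rule tangent_of_coords_in_tangent_space[OF c])
qed

lemma coord_vector_in_tangent_space:
  "c \<in> atlas M \<Longrightarrow> p \<in> fst c \<Longrightarrow> coord_vector M c i p \<in> tangent_space M p"
  by (simp add: coord_vector_eq tangent_of_coords_in_tangent_space)

lemma tangent_lincomb:
  assumes "v \<in> tangent_space M p" "w \<in> tangent_space M p"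
  shows "(\<lambda>f. a * v f + b * w f) \<in> tangent_space M p"
proof -
  obtain c where c: "c \<in> atlas M" "p \<in> fst c"
    using chart_at tangent_space_point[OF assms(1)] by blast
  obtain x y where "v = tangent_of_coords c p x" "w = tangent_of_coords c p y"
    using assms tangent_space_eq[OF c] by blast
  then have "(\<lambda>f. a * v f + b * w f) = tangent_of_coords c p (a *\<^sub>R x + b *\<^sub>R y)"
    by (simp add: fun_eq_iff tangent_of_coords_linear[OF c])
  then show ?thesis
    using tangent_of_coords_in_tangent_space[OF c] by simp
qed

context
  fixes v p assumes v: "v \<in> tangent_space M p"
begin

lemma tangent_coords:
  assumes c: "c \<in> atlas M" "p \<in> fst c"
  shows "v = tangent_of_coords c p (\<chi> i. v (coord c i))"
proof -
  obtain u where "v = tangent_of_coords c p u"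
    using v tangent_space_eq[OF c] by blast
  then show ?thesis
    by (simp add: tangent_of_coords_coord[OF c])
qed

lemma tangent_expand:
  assumes c: "c \<in> atlas M" "p \<in> fst c"
  shows "v f = (\<Sum>i\<in>UNIV. v (coord c i) * coord_vector M c i p f)"
  by (subst tangent_coords[OF c]) (simp add: tangent_of_coords_expand[OF c])

lemma tangent_nonsmooth: "\<not> smooth_near M p f \<Longrightarrow> v f = 0"
  using v by (auto simp: tangent_space_def velocity_def)

lemma tangent_eqI:
  assumes f: "smooth_near M p f" and c: "c \<in> atlas M" "p \<in> fst c"
    and D: "((\<lambda>x. f (chart_inv c x)) has_derivative D) (at (snd c p))"
  shows "v f = D (\<chi> i. v (coord c i))"
  by (subst tangent_coords[OF c]) (rule tangent_of_coords_eqI[OF c f D])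

lemma tangent_has_derivative:
  assumes f: "smooth_near M p f" and c: "c \<in> atlas M" "p \<in> fst c"
  shows "\<exists>D. ((\<lambda>x. f (chart_inv c x)) has_derivative D) (at (snd c p)) \<and> v f = D (\<chi> i. v (coord c i))"
  using tangent_eqI[OF f c] smooth_near_has_derivative[OF c f] by blast

lemma tangent_add:
  assumes f: "smooth_near M p f" and g: "smooth_near M p g"
  shows "v (\<lambda>q. f q + g q) = v f + v g"
proof -
  obtain c where c: "c \<in> atlas M" "p \<in> fst c"
    using chart_at smooth_near_point[OF f] by blast
  show ?thesis
    using tangent_has_derivative[OF f c] tangent_has_derivative[OF g c]
      tangent_eqI[OF smooth_near_add[OF f g] c has_derivative_add] by fastforce
qed

lemma tangent_mult:
  assumes f: "smooth_near M p f" and g: "smooth_near M p g"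
  shows "v (\<lambda>q. f q * g q) = f p * v g + v f * g p"
proof -
  obtain c where c: "c \<in> atlas M" "p \<in> fst c"
    using chart_at smooth_near_point[OF f] by blast
  show ?thesis
    using tangent_has_derivative[OF f c] tangent_has_derivative[OF g c]
      tangent_eqI[OF smooth_near_mult[OF f g] c has_derivative_mult] c by fastforce
qed

lemma tangent_const: "v (\<lambda>q. a) = 0"
proof -
  obtain c where c: "c \<in> atlas M" "p \<in> fst c"
    using chart_at tangent_space_point[OF v] by blast
  show ?thesis
    using tangent_eqI[OF smooth_near_const[OF tangent_space_point[OF v]] c has_derivative_const] .
qed

lemma tangent_cmult: "smooth_near M p f \<Longrightarrow> v (\<lambda>q. a * f q) = a * v f"
  using tangent_mult[OF smooth_near_const[OF tangent_space_point[OF v]]] by (simp add: tangent_const)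

lemma tangent_diff:
  assumes f: "smooth_near M p f" and g: "smooth_near M p g"
  shows "v (\<lambda>q. f q - g q) = v f - v g"
  using tangent_add[OF f smooth_near_cmult[OF g, of "-1"]] tangent_cmult[OF g, of "-1"] by simp

lemma tangent_sum:
  assumes "\<And>i. i \<in> I \<Longrightarrow> smooth_near M p (f i)"
  shows "v (\<lambda>q. \<Sum>i\<in>I. f i q) = (\<Sum>i\<in>I. v (f i))"
  using assms
  by (induction I rule: infinite_finite_induct)
     (simp_all add: tangent_const tangent_add smooth_near_sum tangent_space_point[OF v])

text \<open>Tangent vectors are local. If the functions are not smooth near the point, both values are the
  default value \<open>0\<close>.\<close>

lemma tangent_cong:
  assumes W: "openin (topo M) W" "p \<in> W" and eq: "\<And>q. q \<in> W \<Longrightarrow> f q = g q"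
  shows "v f = v g"
proof (cases "smooth_near M p f")
  case True
  obtain c where c: "c \<in> atlas M" "p \<in> fst c"
    using chart_at tangent_space_point[OF v] by blast
  have g: "smooth_near M p g"
    by (rule smooth_near_cong[OF W eq True])
  obtain D where D: "((\<lambda>x. f (chart_inv c x)) has_derivative D) (at (snd c p))"
      "v f = D (\<chi> i. v (coord c i))"
    using tangent_has_derivative[OF True c] by blast
  have "((\<lambda>x. g (chart_inv c x)) has_derivative D) (at (snd c p))"
    by (rule has_derivative_transform_within_open[OF D(1) open_chart_image[OF c(1) W(1)]])
       (use c W(2) eq in auto)
  then show ?thesis
    using tangent_eqI[OF g c] D(2) by simp
next
  case False
  then have "\<not> smooth_near M p g"
    using smooth_near_cong[OF W, of g f] eq by auto
  then show ?thesis
    using False tangent_nonsmooth by simp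
qed

end

section \<open>Vector fields and the Lie bracket\<close>

lemma vector_field_iff:
  "vector_field M X \<longleftrightarrow> (\<forall>p\<in>points M. X p \<in> tangent_space M p) \<and> (\<forall>p. p \<notin> points M \<longrightarrow> X p = 0) \<and>
     (\<forall>p f. smooth_near M p f \<longrightarrow> smooth_near M p (\<lambda>q. X q f))"
proof -
  have "(\<forall>W f. openin (topo M) W \<and> smooth_fun_on M W f \<longrightarrow> smooth_fun_on M W (\<lambda>p. X p f)) \<longleftrightarrow>
     (\<forall>p f. smooth_near M p f \<longrightarrow> smooth_near M p (\<lambda>q. X q f))" (is "?l = ?r")
  proof
    assume ?l then show ?r unfolding smooth_near_def by blast
  next
    assume ?r then show ?l using smooth_fun_on_iff by blast
  qed
  then show ?thesis unfolding vector_field_def by argo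
qed

lemma vector_fieldD:
  assumes "vector_field M X"
  shows "p \<in> points M \<Longrightarrow> X p \<in> tangent_space M p"
    and "smooth_near M p f \<Longrightarrow> smooth_near M p (\<lambda>q. X q f)"
    and "\<not> smooth_near M p f \<Longrightarrow> X p f = 0"
proof -
  show "p \<in> points M \<Longrightarrow> X p \<in> tangent_space M p" "smooth_near M p f \<Longrightarrow> smooth_near M p (\<lambda>q. X q f)"
    using assms vector_field_iff by auto
  show "\<not> smooth_near M p f \<Longrightarrow> X p f = 0"
    using assms vector_field_iff[of X] tangent_nonsmooth by (cases "p \<in> points M") auto
qed

lemma vector_field_eqI:
  assumes "vector_field M X" "vector_field M Y" "\<And>p f. smooth_near M p f \<Longrightarrow> X p f = Y p f"
  shows "X = Y"
  using vector_fieldD(3)[OF assms(1)] vector_fieldD(3)[OF assms(2)] assms(3) by (metis ext)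

lemma vector_field_add:
  assumes "vector_field M X" "vector_field M Y"
  shows "vector_field M (X + Y)"
  unfolding vector_field_iff
proof (intro conjI allI ballI impI)
  fix p assume "p \<in> points M"
  then show "(X + Y) p \<in> tangent_space M p"
    using tangent_lincomb[OF vector_fieldD(1)[OF assms(1)] vector_fieldD(1)[OF assms(2)], of p 1 1]
    by (simp add: plus_fun_def)
next
  fix p assume "p \<notin> points M"
  then show "(X + Y) p = 0"
    using assms by (simp add: vector_field_iff)
next
  fix p f assume "smooth_near M p f"
  then show "smooth_near M p (\<lambda>q. (X + Y) q f)"
    using smooth_near_add[OF vector_fieldD(2)[OF assms(1)] vector_fieldD(2)[OF assms(2)]] by simp
qed

lemma fun_scale_apply [simp]: "fun_scale a X p f = a p * X p f"
  by (simp add: fun_scale_def)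

abbreviation smooth_fun :: "('a \<Rightarrow> real) \<Rightarrow> bool" where
  "smooth_fun \<equiv> smooth_fun_on M (points M)"

lemma smooth_fun_iff: "smooth_fun a \<longleftrightarrow> (\<forall>p\<in>points M. smooth_near M p a)"
  by (rule smooth_fun_on_iff) simp

lemma smooth_fun_near: "smooth_fun a \<Longrightarrow> smooth_near M p f \<Longrightarrow> smooth_near M p a"
  using smooth_fun_iff smooth_near_point by blast

lemma vector_field_apply_smooth: "vector_field M X \<Longrightarrow> smooth_fun a \<Longrightarrow> smooth_fun (\<lambda>p. X p a)"
  using smooth_fun_iff vector_fieldD(2) by blast

lemma vector_field_fun_scale:
  assumes X: "vector_field M X" and a: "smooth_fun a"
  shows "vector_field M (fun_scale a X)"
  unfolding vector_field_iff
proof (intro conjI allI ballI impI)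
  fix p assume "p \<in> points M"
  then show "fun_scale a X p \<in> tangent_space M p"
    using tangent_lincomb[OF vector_fieldD(1)[OF X] vector_fieldD(1)[OF X], of p "a p" 0]
    by (simp add: fun_scale_def)
next
  fix p assume "p \<notin> points M"
  then show "fun_scale a X p = 0"
    using X by (simp add: vector_field_iff fun_eq_iff)
next
  fix p f assume f: "smooth_near M p f"
  show "smooth_near M p (\<lambda>q. fun_scale a X q f)"
    using smooth_near_mult[OF smooth_fun_near[OF a f] vector_fieldD(2)[OF X f]] by simp
qed

lemma coord_vector_smooth_near:
  assumes c: "c \<in> atlas M" "p \<in> fst c" and f: "smooth_near M p f"
  shows "smooth_near M p (\<lambda>q. coord_vector M c i q f)" (is ?smooth)
    and "coord_vector M c j p (\<lambda>q. coord_vector M c i q f) = coord_vector M c i p (\<lambda>q. coord_vector M c j q f)"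
proof -
  let ?f = "\<lambda>x. f (chart_inv c x)"
  obtain T where T: "open T" "snd c p \<in> T" "T \<subseteq> snd c ` fst c" "\<And>k. Ck_on k T ?f"
    using f smooth_near_iff[OF c] by blast
  have eq: "coord_vector M c i (chart_inv c x) f = frechet_derivative ?f (at x) (axis i 1)" if x: "x \<in> T" for i x
  proof -
    obtain q where q: "q \<in> fst c" "x = snd c q" using T(3) x by blast
    have "smooth_near M q f"
      using T x q by (subst smooth_near_iff[OF c(1) q(1)]) blast
    then show ?thesis
      using c q by (simp add: coord_vector_eq tangent_of_coords_def)
  qed
  have D: "Ck_on k T (\<lambda>x. frechet_derivative ?f (at x) (axis i 1))" for i k
    using T(4)[of "Suc k"] by simp
  have "Ck_on k T (\<lambda>x. coord_vector M c i (chart_inv c x) f)" for k i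
    by (rule Ck_on_cong[OF T(1) _ D[of k i]]) (simp add: eq)
  then have sm: "smooth_near M p (\<lambda>q. coord_vector M c i q f)" for i
    using T by (subst smooth_near_iff[OF c]) blast
  then show ?smooth .
  have "coord_vector M c j p (\<lambda>q. coord_vector M c i q f) =
      frechet_derivative (\<lambda>x. frechet_derivative ?f (at x) (axis i 1)) (at (snd c p)) (axis j 1)" for i j
  proof -
    have "((\<lambda>x. coord_vector M c i (chart_inv c x) f) has_derivative
        frechet_derivative (\<lambda>x. frechet_derivative ?f (at x) (axis i 1)) (at (snd c p))) (at (snd c p))"
      by (rule has_derivative_transform_within_open[OF Ck_on_Suc_has_derivative[OF D[of "Suc 0" i] T(2)] T(1,2)])
         (simp add: eq)
    from tangent_of_coords_eqI[OF c sm this] show ?thesis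
      by (simp add: coord_vector_eq)
  qed
  then show "coord_vector M c j p (\<lambda>q. coord_vector M c i q f) = coord_vector M c i p (\<lambda>q. coord_vector M c j q f)"
    using second_derivative_symmetric[OF T(1,2,4)] by simp
qed

lemma lie_bracket_apply:
  "smooth_near M p f \<Longrightarrow> lie_bracket M X Y p f = X p (\<lambda>q. Y q f) - Y p (\<lambda>q. X q f)"
  by (simp add: lie_bracket_def)

text \<open>The bracket is a tangent vector at each point although it is defined through second derivatives: by
  the product rule applied to \<open>Y f = Y\<^sup>i \<partial>\<^sub>i f\<close>, all second derivatives occur in the combination
  \<open>X\<^sup>j Y\<^sup>i (\<partial>\<^sub>j \<partial>\<^sub>i - \<partial>\<^sub>i \<partial>\<^sub>j) f\<close>, which vanishes.\<close>

lemma lie_bracket_coords: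
  assumes X: "vector_field M X" and Y: "vector_field M Y" and c: "c \<in> atlas M" "p \<in> fst c"
  shows "lie_bracket M X Y p = tangent_of_coords c p
    (\<chi> i. X p (\<lambda>q. Y q (coord c i)) - Y p (\<lambda>q. X q (coord c i)))"
proof
  fix f
  show "lie_bracket M X Y p f = tangent_of_coords c p
    (\<chi> i. X p (\<lambda>q. Y q (coord c i)) - Y p (\<lambda>q. X q (coord c i))) f"
  proof (cases "smooth_near M p f")
    case f: True
    have p: "p \<in> points M" using smooth_near_point[OF f] .
    have xi: "smooth_near M p (coord c i)" for i by (rule smooth_near_coord[OF c])
    have second: "X p (\<lambda>q. Y q f) =
        (\<Sum>i\<in>UNIV. \<Sum>j\<in>UNIV. Y p (coord c i) * (X p (coord c j) * coord_vector M c j p (\<lambda>q. coord_vector M c i q f)))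
        + (\<Sum>i\<in>UNIV. X p (\<lambda>q. Y q (coord c i)) * coord_vector M c i p f)"
      if X: "vector_field M X" and Y: "vector_field M Y" for X Y
    proof -
      have Xp: "X p \<in> tangent_space M p" by (rule vector_fieldD(1)[OF X p])
      have "X p (\<lambda>q. Y q f) = X p (\<lambda>q. \<Sum>i\<in>UNIV. Y q (coord c i) * coord_vector M c i q f)"
        by (rule tangent_cong[OF Xp chart_props(1)[OF c(1)] c(2)])
           (rule tangent_expand[OF vector_fieldD(1)[OF Y] c(1)], use chart_subset[OF c(1)] in auto)
      also have "\<dots> = (\<Sum>i\<in>UNIV. X p (\<lambda>q. Y q (coord c i) * coord_vector M c i q f))"
        by (intro tangent_sum[OF Xp] smooth_near_mult vector_fieldD(2)[OF Y] xi coord_vector_smooth_near(1)[OF c f])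
      also have "\<dots> = (\<Sum>i\<in>UNIV. Y p (coord c i) * X p (\<lambda>q. coord_vector M c i q f) +
          X p (\<lambda>q. Y q (coord c i)) * coord_vector M c i p f)"
        by (intro sum.cong refl tangent_mult[OF Xp] vector_fieldD(2)[OF Y] xi coord_vector_smooth_near(1)[OF c f])
      finally show ?thesis
        by (subst (asm) tangent_expand[OF Xp c, of "\<lambda>q. coord_vector M c i q f" for i])
           (simp add: sum.distrib sum_distrib_left)
    qed
    have "(\<Sum>i\<in>UNIV. \<Sum>j\<in>UNIV. Y p (coord c i) * (X p (coord c j) * coord_vector M c j p (\<lambda>q. coord_vector M c i q f)))
      = (\<Sum>j\<in>UNIV. \<Sum>i\<in>UNIV. Y p (coord c i) * (X p (coord c j) * coord_vector M c j p (\<lambda>q. coord_vector M c i q f)))"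
      by (rule sum.swap)
    also have "\<dots> = (\<Sum>j\<in>UNIV. \<Sum>i\<in>UNIV. X p (coord c j) * (Y p (coord c i) * coord_vector M c i p (\<lambda>q. coord_vector M c j q f)))"
      by (intro sum.cong refl) (simp add: coord_vector_smooth_near(2)[OF c f] mult.left_commute)
    finally show ?thesis
      using f by (simp add: lie_bracket_apply second[OF X Y] second[OF Y X] tangent_of_coords_expand[OF c]
         sum_subtractf left_diff_distrib)
  qed (simp add: lie_bracket_def tangent_of_coords_def)
qed

lemma vector_field_lie_bracket:
  assumes X: "vector_field M X" and Y: "vector_field M Y"
  shows "vector_field M (lie_bracket M X Y)"
  unfolding vector_field_iff
proof (intro conjI allI ballI impI)
  fix p assume "p \<in> points M"
  then obtain c where c: "c \<in> atlas M" "p \<in> fst c" using chart_at by blast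
  show "lie_bracket M X Y p \<in> tangent_space M p"
    unfolding lie_bracket_coords[OF X Y c] by (rule tangent_of_coords_in_tangent_space[OF c])
next
  fix p assume "p \<notin> points M"
  then show "lie_bracket M X Y p = 0"
    using smooth_near_point by (auto simp: lie_bracket_def fun_eq_iff)
next
  fix p f assume f: "smooth_near M p f"
  obtain W where W: "openin (topo M) W" "p \<in> W" "\<forall>q\<in>W. smooth_near M q f"
    using smooth_near_nbhd[OF f] by blast
  have "smooth_near M p (\<lambda>q. X q (\<lambda>r. Y r f) - Y q (\<lambda>r. X r f))"
    by (intro smooth_near_diff vector_fieldD(2)[OF X] vector_fieldD(2)[OF Y] f)
  then show "smooth_near M p (\<lambda>q. lie_bracket M X Y q f)"
    by (rule smooth_near_cong[OF W(1,2), rotated]) (use W(3) in \<open>simp add: lie_bracket_apply\<close>)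
qed

text \<open>The bracket is given by the commutator only where \<open>f\<close> is smooth. This is a neighbourhood of
  the point, which is all that a tangent vector sees.\<close>

lemma tangent_lie_bracket:
  assumes v: "v \<in> tangent_space M p" and X: "vector_field M X" and Y: "vector_field M Y"
    and f: "smooth_near M p f"
  shows "v (\<lambda>q. lie_bracket M X Y q f) = v (\<lambda>q. X q (\<lambda>r. Y r f)) - v (\<lambda>q. Y q (\<lambda>r. X r f))"
proof -
  obtain W where W: "openin (topo M) W" "p \<in> W" "\<forall>q\<in>W. smooth_near M q f"
    using smooth_near_nbhd[OF f] by blast
  have "v (\<lambda>q. lie_bracket M X Y q f) = v (\<lambda>q. X q (\<lambda>r. Y r f) - Y q (\<lambda>r. X r f))"
    by (rule tangent_cong[OF v W(1,2)]) (use W(3) in \<open>simp add: lie_bracket_apply\<close>)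
  also have "\<dots> = v (\<lambda>q. X q (\<lambda>r. Y r f)) - v (\<lambda>q. Y q (\<lambda>r. X r f))"
    by (intro tangent_diff[OF v] vector_fieldD(2)[OF X] vector_fieldD(2)[OF Y] f)
  finally show ?thesis .
qed

lemma lie_bracket_antisym: "lie_bracket M X Y p f = - lie_bracket M Y X p f"
  by (simp add: lie_bracket_def)

lemma lie_bracket_add:
  assumes X: "vector_field M X" and Y: "vector_field M Y" and Z: "vector_field M Z"
  shows "lie_bracket M X (Y + Z) = lie_bracket M X Y + lie_bracket M X Z"
proof (rule vector_field_eqI)
  fix p f assume f: "smooth_near M p f"
  have Xp: "X p \<in> tangent_space M p" by (rule vector_fieldD(1)[OF X smooth_near_point[OF f]])
  show "lie_bracket M X (Y + Z) p f = (lie_bracket M X Y + lie_bracket M X Z) p f"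
    using f by (simp add: lie_bracket_apply tangent_add[OF Xp vector_fieldD(2)[OF Y f] vector_fieldD(2)[OF Z f]])
qed (intro vector_field_lie_bracket vector_field_add X Y Z)+

lemma lie_bracket_fun_scale:
  assumes X: "vector_field M X" and Y: "vector_field M Y" and a: "smooth_fun a"
  shows "lie_bracket M X (fun_scale a Y) = fun_scale (\<lambda>p. X p a) Y + fun_scale a (lie_bracket M X Y)"
proof (rule vector_field_eqI)
  fix p f assume f: "smooth_near M p f"
  have Xp: "X p \<in> tangent_space M p" by (rule vector_fieldD(1)[OF X smooth_near_point[OF f]])
  show "lie_bracket M X (fun_scale a Y) p f = (fun_scale (\<lambda>p. X p a) Y + fun_scale a (lie_bracket M X Y)) p f"
    using f by (simp add: lie_bracket_apply tangent_mult[OF Xp smooth_fun_near[OF a f] vector_fieldD(2)[OF Y f]]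
      algebra_simps)
qed (intro vector_field_lie_bracket vector_field_add vector_field_fun_scale vector_field_apply_smooth[OF X a] X Y a)+

lemma lie_bracket_jacobi:
  assumes X: "vector_field M X" and Y: "vector_field M Y" and Z: "vector_field M Z"
  shows "lie_bracket M X (lie_bracket M Y Z) =
    lie_bracket M (lie_bracket M X Y) Z + lie_bracket M Y (lie_bracket M X Z)"
proof (rule vector_field_eqI)
  fix p f assume f: "smooth_near M p f"
  note p = smooth_near_point[OF f]
  note T = vector_fieldD(1)[OF X p] vector_fieldD(1)[OF Y p] vector_fieldD(1)[OF Z p]
  note S = vector_fieldD(2)[OF X f] vector_fieldD(2)[OF Y f] vector_fieldD(2)[OF Z f]
  show "lie_bracket M X (lie_bracket M Y Z) p f =
      (lie_bracket M (lie_bracket M X Y) Z + lie_bracket M Y (lie_bracket M X Z)) p f"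
    using f S by (simp add: lie_bracket_apply tangent_lie_bracket[OF T(1)] tangent_lie_bracket[OF T(2)]
      tangent_lie_bracket[OF T(3)] X Y Z)
qed (intro vector_field_lie_bracket vector_field_add X Y Z)+

section \<open>Smoothness of the multiplication\<close>

text \<open>A function on the manifold that is, in a chart, the restriction of a smooth function \<open>H\<close> to an affine
  subspace. With \<open>L y = (0, y)\<close> or \<open>L x = (x, 0)\<close> this computes partial derivatives of functions
  of two group elements, without charts on the product manifold.\<close>

lemma smooth_near_slice:
  fixes H :: "'e::euclidean_space \<Rightarrow> real"
  assumes c: "c \<in> atlas M" "p \<in> fst c" and S: "open S" "a + L (snd c p) \<in> S" and L: "bounded_linear L"
    and H: "\<And>k. Ck_on k S H"
    and eq: "\<And>q. q \<in> fst c \<Longrightarrow> a + L (snd c q) \<in> S \<Longrightarrow> h q = H (a + L (snd c q))"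
  shows "smooth_near M p h"
    and "v \<in> tangent_space M p \<Longrightarrow>
      v h = frechet_derivative H (at (a + L (snd c p))) (L (\<chi> i. v (coord c i)))"
proof -
  define T where "T = (\<lambda>x. a + L x) -` S \<inter> snd c ` fst c"
  have "continuous_on UNIV L"
    using L by (rule linear_continuous_on)
  then have T: "open T" "snd c p \<in> T" "T \<subseteq> snd c ` fst c"
    using c S chart_props(2)[OF c(1)]
    by (auto simp: T_def intro!: open_Int open_vimage continuous_intros)
  have eqT: "H (a + L x) = h (chart_inv c x)" if "x \<in> T" for x
    using that c(1) by (auto simp: T_def eq)
  have "Ck_on k T (\<lambda>x. H (a + L x))" for k
    by (rule Ck_on_compose[OF T(1) S(1) Ck_on_add[OF T(1) Ck_on_const[OF T(1)] Ck_on_linear[OF L T(1)]] H])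
       (auto simp: T_def)
  then have "Ck_on k T (\<lambda>x. h (chart_inv c x))" for k
    by (rule Ck_on_cong[OF T(1), rotated]) (simp add: eqT)
  then show h: "smooth_near M p h"
    using T by (subst smooth_near_iff[OF c]) blast
  have L': "((\<lambda>x. a + L x) has_derivative L) (at (snd c p))"
    using has_derivative_add[OF has_derivative_const bounded_linear_imp_has_derivative[OF L]] by simp
  have "((\<lambda>x. H (a + L x)) has_derivative
      (\<lambda>u. frechet_derivative H (at (a + L (snd c p))) (L u))) (at (snd c p))"
    using diff_chain_at[OF L' Ck_on_Suc_has_derivative[OF H S(2)]] by (simp add: comp_def)
  then have "((\<lambda>x. h (chart_inv c x)) has_derivative
      (\<lambda>u. frechet_derivative H (at (a + L (snd c p))) (L u))) (at (snd c p))"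
    by (rule has_derivative_transform_within_open[OF _ T(1,2)]) (rule eqT)
  from tangent_eqI[OF _ h c this] show "v \<in> tangent_space M p \<Longrightarrow>
      v h = frechet_derivative H (at (a + L (snd c p))) (L (\<chi> i. v (coord c i)))" .
qed

text \<open>This is the chain rule, for maps whose smoothness is expressed by pulling back functions. Continuity at the
  point has to be required separately: it provides the neighbourhood on which the chart around the image
  point may be inserted.\<close>

lemma differential_in_tangent_space:
  assumes v: "v \<in> tangent_space M p" and \<Phi>p: "\<Phi> p \<in> points M"
    and smooth: "\<And>f. smooth_near M (\<Phi> p) f \<Longrightarrow> smooth_near M p (\<lambda>q. f (\<Phi> q))"
    and cont: "\<And>W. openin (topo M) W \<Longrightarrow> \<Phi> p \<in> W \<Longrightarrow>
      \<exists>V. openin (topo M) V \<and> p \<in> V \<and> (\<forall>q\<in>V. \<Phi> q \<in> W)"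
  shows "differential M \<Phi> p v \<in> tangent_space M (\<Phi> p)"
proof -
  obtain c where c: "c \<in> atlas M" "p \<in> fst c"
    using chart_at tangent_space_point[OF v] by blast
  obtain e where e: "e \<in> atlas M" "\<Phi> p \<in> fst e"
    using chart_at \<Phi>p by blast
  obtain V where V: "openin (topo M) V" "p \<in> V" "\<And>q. q \<in> V \<Longrightarrow> \<Phi> q \<in> fst e"
    using cont[OF chart_props(1)[OF e(1)] e(2)] by blast
  have "\<forall>i. \<exists>D. ((\<lambda>x. coord e i (\<Phi> (chart_inv c x))) has_derivative D) (at (snd c p)) \<and>
      v (\<lambda>q. coord e i (\<Phi> q)) = D (\<chi> i. v (coord c i))"
    using tangent_has_derivative[OF v smooth[OF smooth_near_coord[OF e]] c] by blast
  then obtain D where D: "\<And>i. ((\<lambda>x. coord e i (\<Phi> (chart_inv c x))) has_derivative D i) (at (snd c p))"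
      "\<And>i. v (\<lambda>q. coord e i (\<Phi> q)) = D i (\<chi> i. v (coord c i))"
    by metis
  have D': "((\<lambda>x. snd e (\<Phi> (chart_inv c x))) has_derivative (\<lambda>u. \<chi> i. D i u)) (at (snd c p))"
    using D(1) by (subst has_derivative_componentwise_within) (auto simp: Basis_vec_def inner_axis coord_def)
  have "differential M \<Phi> p v = tangent_of_coords e (\<Phi> p) (\<chi> i. v (\<lambda>q. coord e i (\<Phi> q)))"
  proof
    fix f
    show "differential M \<Phi> p v f = tangent_of_coords e (\<Phi> p) (\<chi> i. v (\<lambda>q. coord e i (\<Phi> q))) f"
    proof (cases "smooth_near M (\<Phi> p) f")
      case f: True
      let ?L = "frechet_derivative (\<lambda>x. f (chart_inv e x)) (at (snd e (\<Phi> p)))"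
      have L: "((\<lambda>x. f (chart_inv e x)) has_derivative ?L) (at (snd e (\<Phi> (chart_inv c (snd c p)))))"
        using smooth_near_has_derivative[OF e f] c by simp
      have "((\<lambda>x. f (chart_inv e (snd e (\<Phi> (chart_inv c x))))) has_derivative
          (\<lambda>u. ?L (\<chi> i. D i u))) (at (snd c p))"
        using diff_chain_at[OF D' L] by (simp add: comp_def)
      then have "((\<lambda>x. f (\<Phi> (chart_inv c x))) has_derivative (\<lambda>u. ?L (\<chi> i. D i u))) (at (snd c p))"
        by (rule has_derivative_transform_within_open[OF _ open_chart_image[OF c(1) V(1)]])
           (use c V e in auto)
      then have "v (\<lambda>q. f (\<Phi> q)) = ?L (\<chi> i. D i (\<chi> i. v (coord c i)))"
        by (rule tangent_eqI[OF v smooth[OF f] c])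
      then show ?thesis
        using f by (simp add: differential_def tangent_of_coords_def comp_def D(2))
    qed (simp add: differential_def tangent_of_coords_def)
  qed
  then show ?thesis
    using tangent_of_coords_in_tangent_space[OF e] by simp
qed

end

locale lie_group_locale =
  fixes G :: "('a, 'b) monoid_scheme" and M :: "('a, real^'n) manifold"
  assumes lie_group: "lie_group G M"

sublocale lie_group_locale \<subseteq> manifold_locale M
  using lie_group by unfold_locales (simp add: lie_group_def)

sublocale lie_group_locale \<subseteq> group G
  using lie_group by (simp add: lie_group_def)

context lie_group_locale
begin

lemma carrier_eq: "carrier G = points M"
  using lie_group by (simp add: lie_group_def)

lemma mult_continuous: "continuous_map (prod_topology (topo M) (topo M)) (topo M) (\<lambda>(x, y). x \<otimes>\<^bsub>G\<^esub> y)"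
  using lie_group by (simp add: lie_group_def smooth_map_def prod_manifold_def)

lemma mult_nbhd:
  assumes "g \<in> carrier G" "h \<in> carrier G" "openin (topo M) W" "g \<otimes>\<^bsub>G\<^esub> h \<in> W"
  shows "\<exists>A B. openin (topo M) A \<and> openin (topo M) B \<and> g \<in> A \<and> h \<in> B \<and> (\<forall>x\<in>A. \<forall>y\<in>B. x \<otimes>\<^bsub>G\<^esub> y \<in> W)"
proof -
  define Z where "Z = {z \<in> topspace (prod_topology (topo M) (topo M)). (case z of (x, y) \<Rightarrow> x \<otimes>\<^bsub>G\<^esub> y) \<in> W}"
  have "openin (prod_topology (topo M) (topo M)) Z"
    unfolding Z_def by (rule openin_continuous_map_preimage[OF mult_continuous assms(3)])
  moreover have "(g, h) \<in> Z"
    using assms carrier_eq by (simp add: Z_def)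
  ultimately obtain A B where "openin (topo M) A" "openin (topo M) B" "g \<in> A" "h \<in> B" "A \<times> B \<subseteq> Z"
    by (metis openin_prod_topology_alt)
  moreover have "x \<otimes>\<^bsub>G\<^esub> y \<in> W" if "(x, y) \<in> Z" for x y
    using that by (simp add: Z_def)
  ultimately show ?thesis
    by blast
qed

text \<open>The analysis of invariant fields goes through this lemma: in charts, \<open>f(x y)\<close> is a smooth function of
  the two vector variables. Its first partial derivatives at the identity in one variable are the values of invariant
  fields on \<open>f\<close>, and its mixed second derivatives compare their compositions.\<close>

lemma mult_smooth:
  assumes c: "c \<in> atlas M" "g \<in> fst c" and d: "d \<in> atlas M" "h \<in> fst d"
    and f: "smooth_near M (g \<otimes>\<^bsub>G\<^esub> h) f"
  shows "\<exists>S. open S \<and> (snd c g, snd d h) \<in> S \<and>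
    (\<forall>k. Ck_on k S (\<lambda>z. f (chart_inv c (fst z) \<otimes>\<^bsub>G\<^esub> chart_inv d (snd z)))) \<and>
    (\<forall>x\<in>fst c. \<forall>y\<in>fst d. (snd c x, snd d y) \<in> S \<longrightarrow> smooth_near M (x \<otimes>\<^bsub>G\<^esub> y) f)"
proof -
  have g: "g \<in> carrier G" and h: "h \<in> carrier G"
    using c d chart_subset[OF c(1)] chart_subset[OF d(1)] carrier_eq by auto
  obtain e where e: "e \<in> atlas M" "g \<otimes>\<^bsub>G\<^esub> h \<in> fst e"
    using chart_at smooth_near_point[OF f] by blast
  obtain T where T: "open T" "snd e (g \<otimes>\<^bsub>G\<^esub> h) \<in> T" "T \<subseteq> snd e ` fst e" "\<And>k. Ck_on k T (\<lambda>x. f (chart_inv e x))"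
    using f smooth_near_iff[OF e] by blast
  define W where "W = {q \<in> fst e. snd e q \<in> T}"
  have W: "openin (topo M) W" "g \<otimes>\<^bsub>G\<^esub> h \<in> W" "W \<subseteq> fst e"
    using openin_chart_vimage[OF e(1) T(1)] e T(2) by (auto simp: W_def)
  obtain A B where AB: "openin (topo M) A" "openin (topo M) B" "g \<in> A" "h \<in> B" "\<And>x y. x \<in> A \<Longrightarrow> y \<in> B \<Longrightarrow> x \<otimes>\<^bsub>G\<^esub> y \<in> W"
    using mult_nbhd[OF g h W(1,2)] by blast
  define S where "S = (snd c ` (fst c \<inter> A)) \<times> (snd d ` (fst d \<inter> B))"
  have S: "open S"
    unfolding S_def by (intro open_Times open_chart_image c d AB)
  have inS: "x \<in> A \<and> y \<in> B" if "x \<in> fst c" "y \<in> fst d" "(snd c x, snd d y) \<in> S" for x y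
    using that chart_inj[OF c(1)] chart_inj[OF d(1)] by (auto simp: S_def dest: inj_onD)
  let ?UV = "fst c \<times> fst d" and ?\<phi> = "map_prod (snd c) (snd d)"
  have inv: "inv_into ?UV ?\<phi> (snd c x, snd d y) = (x, y)" if "x \<in> fst c" "y \<in> fst d" for x y
    using inv_into_f_f[OF map_prod_inj_on[OF chart_inj[OF c(1)] chart_inj[OF d(1)]], of "(x, y)"] that by simp
  have "(?UV, ?\<phi>) \<in> atlas (prod_manifold M M)"
    using c(1) d(1) by (simp add: prod_manifold_def) (metis prod.collapse)
  then have "smooth_on (?\<phi> ` {z \<in> ?UV. (case z of (x, y) \<Rightarrow> x \<otimes>\<^bsub>G\<^esub> y) \<in> fst e})
      (snd e \<circ> (\<lambda>(x, y). x \<otimes>\<^bsub>G\<^esub> y) \<circ> inv_into ?UV ?\<phi>)"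
    using lie_group e(1) by (fastforce simp: lie_group_def smooth_map_def case_prod_beta)
  then have "Ck_on k (?\<phi> ` {z \<in> ?UV. (case z of (x, y) \<Rightarrow> x \<otimes>\<^bsub>G\<^esub> y) \<in> fst e})
      (\<lambda>z. snd e (case inv_into ?UV ?\<phi> z of (x, y) \<Rightarrow> x \<otimes>\<^bsub>G\<^esub> y))" for k
    by (simp add: smooth_on_def comp_def)
  moreover have "S \<subseteq> ?\<phi> ` {z \<in> ?UV. (case z of (x, y) \<Rightarrow> x \<otimes>\<^bsub>G\<^esub> y) \<in> fst e}"
    using AB(5) W(3) by (auto simp: S_def intro!: image_eqI[of _ ?\<phi> "(x, y)" for x y])
  ultimately have "Ck_on k S (\<lambda>z. snd e (case inv_into ?UV ?\<phi> z of (x, y) \<Rightarrow> x \<otimes>\<^bsub>G\<^esub> y))" for k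
    by (rule Ck_on_subset)
  moreover have "(\<lambda>z. snd e (case inv_into ?UV ?\<phi> z of (x, y) \<Rightarrow> x \<otimes>\<^bsub>G\<^esub> y)) ` S \<subseteq> T"
    using AB(5) by (auto simp: S_def inv W_def)
  ultimately have K: "Ck_on k S (\<lambda>z. f (chart_inv e (snd e (case inv_into ?UV ?\<phi> z of (x, y) \<Rightarrow> x \<otimes>\<^bsub>G\<^esub> y))))" for k
    by (rule Ck_on_compose[OF S T(1) _ T(4)])
  have E: "\<forall>z\<in>S. f (chart_inv e (snd e (case inv_into ?UV ?\<phi> z of (x, y) \<Rightarrow> x \<otimes>\<^bsub>G\<^esub> y))) =
      f (chart_inv c (fst z) \<otimes>\<^bsub>G\<^esub> chart_inv d (snd z))"
  proof
    fix z assume "z \<in> S"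
    then obtain x y where z: "z = (snd c x, snd d y)" "x \<in> fst c" "y \<in> fst d" "x \<in> A" "y \<in> B"
      by (auto simp: S_def)
    then have "x \<otimes>\<^bsub>G\<^esub> y \<in> fst e" using AB(5) W(3) by blast
    then show "f (chart_inv e (snd e (case inv_into ?UV ?\<phi> z of (x, y) \<Rightarrow> x \<otimes>\<^bsub>G\<^esub> y))) =
      f (chart_inv c (fst z) \<otimes>\<^bsub>G\<^esub> chart_inv d (snd z))"
      using z by (simp add: inv c d e)
  qed
  have CkS: "Ck_on k S (\<lambda>z. f (chart_inv c (fst z) \<otimes>\<^bsub>G\<^esub> chart_inv d (snd z)))" for k
    by (rule Ck_on_cong[OF S E K])
  have sm: "smooth_near M (x \<otimes>\<^bsub>G\<^esub> y) f" if "x \<in> fst c" "y \<in> fst d" "(snd c x, snd d y) \<in> S" for x y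
  proof -
    have "x \<otimes>\<^bsub>G\<^esub> y \<in> W" using AB(5) inS[OF that] by blast
    then have "x \<otimes>\<^bsub>G\<^esub> y \<in> fst e" "snd e (x \<otimes>\<^bsub>G\<^esub> y) \<in> T" by (auto simp: W_def)
    then show ?thesis
      using T by (subst smooth_near_iff[OF e(1)]) blast+
  qed
  have "(snd c g, snd d h) \<in> S"
    using c d AB(3,4) by (simp add: S_def)
  then show ?thesis
    using S CkS sm by (intro exI[of _ S]) simp
qed

section \<open>Invariant vector fields\<close>

lemma one_point: "\<one>\<^bsub>G\<^esub> \<in> points M"
  using one_closed carrier_eq by simp

lemma left_translation_smooth:
  assumes g: "g \<in> carrier G" and h: "h \<in> carrier G" and f: "smooth_near M (g \<otimes>\<^bsub>G\<^esub> h) f"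
  shows "smooth_near M h (\<lambda>x. f (g \<otimes>\<^bsub>G\<^esub> x))"
proof -
  obtain c d where c: "c \<in> atlas M" "g \<in> fst c" and d: "d \<in> atlas M" "h \<in> fst d"
    using chart_at g h carrier_eq by metis
  obtain S where S: "open S" "(snd c g, snd d h) \<in> S"
    "\<And>k. Ck_on k S (\<lambda>z. f (chart_inv c (fst z) \<otimes>\<^bsub>G\<^esub> chart_inv d (snd z)))"
    "\<And>x y. x \<in> fst c \<Longrightarrow> y \<in> fst d \<Longrightarrow> (snd c x, snd d y) \<in> S \<Longrightarrow> smooth_near M (x \<otimes>\<^bsub>G\<^esub> y) f"
    using mult_smooth[OF c d f] by meson
  have L: "bounded_linear (\<lambda>y. (0::real^'n, y))"
    by (intro bounded_linear_Pair bounded_linear_zero bounded_linear_ident)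
  show ?thesis
    by (rule smooth_near_slice(1)[OF d S(1) _ L S(3), of "(snd c g, 0)"]) (use S(2) c d in auto)
qed

lemma left_translation_tangent:
  assumes g: "g \<in> carrier G" and h: "h \<in> carrier G" and v: "v \<in> tangent_space M h"
  shows "differential M (\<lambda>x. g \<otimes>\<^bsub>G\<^esub> x) h v \<in> tangent_space M (g \<otimes>\<^bsub>G\<^esub> h)"
proof (rule differential_in_tangent_space[OF v])
  show "g \<otimes>\<^bsub>G\<^esub> h \<in> points M"
    using g h carrier_eq by auto
  show "\<And>f. smooth_near M (g \<otimes>\<^bsub>G\<^esub> h) f \<Longrightarrow> smooth_near M h (\<lambda>q. f (g \<otimes>\<^bsub>G\<^esub> q))"
    by (rule left_translation_smooth[OF g h])
  fix W assume "openin (topo M) W" "g \<otimes>\<^bsub>G\<^esub> h \<in> W"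
  from mult_nbhd[OF g h this]
  show "\<exists>V. openin (topo M) V \<and> h \<in> V \<and> (\<forall>q\<in>V. g \<otimes>\<^bsub>G\<^esub> q \<in> W)"
    by blast
qed

lemma left_invariant_apply:
  assumes "left_invariant_field G M X" "g \<in> carrier G" "h \<in> carrier G" "smooth_near M (g \<otimes>\<^bsub>G\<^esub> h) f"
  shows "X (g \<otimes>\<^bsub>G\<^esub> h) f = X h (\<lambda>x. f (g \<otimes>\<^bsub>G\<^esub> x))"
proof -
  have "differential M (\<lambda>x. g \<otimes>\<^bsub>G\<^esub> x) h (X h) f = X (g \<otimes>\<^bsub>G\<^esub> h) f"
    using assms(1-3) by (simp add: left_invariant_field_def)
  then show ?thesis
    using assms(4) by (simp add: differential_def comp_def)
qed

lemma right_invariant_apply: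
  assumes "right_invariant_field G M X" "g \<in> carrier G" "h \<in> carrier G" "smooth_near M (h \<otimes>\<^bsub>G\<^esub> g) f"
  shows "X (h \<otimes>\<^bsub>G\<^esub> g) f = X h (\<lambda>x. f (x \<otimes>\<^bsub>G\<^esub> g))"
proof -
  have "differential M (\<lambda>x. x \<otimes>\<^bsub>G\<^esub> g) h (X h) f = X (h \<otimes>\<^bsub>G\<^esub> g) f"
    using assms(1-3) by (simp add: right_invariant_field_def)
  then show ?thesis
    using assms(4) by (simp add: differential_def comp_def)
qed

text \<open>Pulling back along a left translation turns \<open>X (Y f)\<close> into the same
  expression for the pulled back function.\<close>

lemma left_invariant_lie_bracket:
  assumes X: "left_invariant_field G M X" and Y: "left_invariant_field G M Y"
  shows "left_invariant_field G M (lie_bracket M X Y)"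
proof -
  have vX: "vector_field M X" and vY: "vector_field M Y"
    using X Y by (simp_all add: left_invariant_field_def)
  have step: "X h (\<lambda>q. Y q (\<lambda>x. f (g \<otimes>\<^bsub>G\<^esub> x))) = X (g \<otimes>\<^bsub>G\<^esub> h) (\<lambda>q. Y q f)"
    if X: "left_invariant_field G M X" and Y: "left_invariant_field G M Y"
      and g: "g \<in> carrier G" and h: "h \<in> carrier G" and f: "smooth_near M (g \<otimes>\<^bsub>G\<^esub> h) f" for X Y g h f
  proof -
    have vX: "vector_field M X" and vY: "vector_field M Y"
      using X Y by (simp_all add: left_invariant_field_def)
    obtain W where W: "openin (topo M) W" "g \<otimes>\<^bsub>G\<^esub> h \<in> W" "\<forall>q\<in>W. smooth_near M q f"
      using smooth_near_nbhd[OF f] by blast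
    obtain V where V: "openin (topo M) V" "h \<in> V" "\<forall>y\<in>V. g \<otimes>\<^bsub>G\<^esub> y \<in> W"
      using mult_nbhd[OF g h W(1,2)] by blast
    have "X (g \<otimes>\<^bsub>G\<^esub> h) (\<lambda>q. Y q f) = X h (\<lambda>q. Y (g \<otimes>\<^bsub>G\<^esub> q) f)"
      by (rule left_invariant_apply[OF X g h vector_fieldD(2)[OF vY f]])
    also have "\<dots> = X h (\<lambda>q. Y q (\<lambda>x. f (g \<otimes>\<^bsub>G\<^esub> x)))"
    proof (rule tangent_cong[OF vector_fieldD(1)[OF vX] V(1,2)])
      show "h \<in> points M" using h carrier_eq by simp
      fix q assume "q \<in> V"
      then show "Y (g \<otimes>\<^bsub>G\<^esub> q) f = Y q (\<lambda>x. f (g \<otimes>\<^bsub>G\<^esub> x))"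
        using V(3) W(3) openin_subset[OF V(1)] carrier_eq
        by (intro left_invariant_apply[OF Y g]) auto
    qed
    finally show ?thesis by simp
  qed
  show ?thesis
    unfolding left_invariant_field_def
  proof (intro conjI ballI ext)
    fix g h f assume g: "g \<in> carrier G" and h: "h \<in> carrier G"
    show "differential M (\<lambda>x. g \<otimes>\<^bsub>G\<^esub> x) h (lie_bracket M X Y h) f = lie_bracket M X Y (g \<otimes>\<^bsub>G\<^esub> h) f"
    proof (cases "smooth_near M (g \<otimes>\<^bsub>G\<^esub> h) f")
      case f: True
      then show ?thesis
        using left_translation_smooth[OF g h f] step[OF X Y g h f] step[OF Y X g h f]
        by (simp add: differential_def lie_bracket_apply comp_def)
    qed (simp add: differential_def lie_bracket_def)
  qed (rule vector_field_lie_bracket[OF vX vY])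
qed

text \<open>Translate \<open>v\<close> back to a vector \<open>w\<close> at the identity and from there to every other point. The resulting field
  is smooth because its value on \<open>f\<close> at \<open>x\<close> is the derivative of \<open>f(x y)\<close> with respect to \<open>y\<close> at the identity
  in direction \<open>w\<close>, hence a partial derivative of a function that is smooth in \<open>x\<close> and \<open>y\<close> jointly.\<close>

lemma left_invariant_field_exists:
  assumes v: "v \<in> tangent_space M g"
  obtains X where "left_invariant_field G M X" "X g = v"
proof -
  have gM: "g \<in> points M" and g: "g \<in> carrier G"
    using tangent_space_point[OF v] carrier_eq by auto
  define w where "w = differential M (\<lambda>x. inv\<^bsub>G\<^esub> g \<otimes>\<^bsub>G\<^esub> x) g v"
  have w: "w \<in> tangent_space M \<one>\<^bsub>G\<^esub>"
    using left_translation_tangent[OF inv_closed[OF g] g v] g by (simp add: w_def)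
  define X where "X = (\<lambda>h. if h \<in> points M then differential M (\<lambda>x. h \<otimes>\<^bsub>G\<^esub> x) \<one>\<^bsub>G\<^esub> w else 0)"
  have Xap: "X h f = w (\<lambda>x. f (h \<otimes>\<^bsub>G\<^esub> x))" if f: "smooth_near M h f" for h f
    using f smooth_near_point[OF f] carrier_eq by (simp add: X_def differential_def comp_def)
  have Xns: "X h f = 0" if f: "\<not> smooth_near M h f" for h f
    using f carrier_eq by (simp add: X_def differential_def)
  have X: "vector_field M X"
    unfolding vector_field_iff
  proof (intro conjI allI ballI impI)
    fix h assume "h \<in> points M"
    then show "X h \<in> tangent_space M h"
      using left_translation_tangent[OF _ one_closed w, of h] carrier_eq by (simp add: X_def)
  next
    fix h assume "h \<notin> points M"
    then show "X h = 0" by (simp add: X_def)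
  next
    fix h f assume f: "smooth_near M h f"
    have h: "h \<in> carrier G" using smooth_near_point[OF f] carrier_eq by simp
    have f1: "smooth_near M (h \<otimes>\<^bsub>G\<^esub> \<one>\<^bsub>G\<^esub>) f" using f h by simp
    obtain c d where c: "c \<in> atlas M" "h \<in> fst c" and d: "d \<in> atlas M" "\<one>\<^bsub>G\<^esub> \<in> fst d"
      using chart_at h one_point carrier_eq by metis
    let ?F = "\<lambda>z. f (chart_inv c (fst z) \<otimes>\<^bsub>G\<^esub> chart_inv d (snd z))"
    obtain S where S: "open S" "(snd c h, snd d \<one>\<^bsub>G\<^esub>) \<in> S" "\<And>k. Ck_on k S ?F"
      "\<And>x y. x \<in> fst c \<Longrightarrow> y \<in> fst d \<Longrightarrow> (snd c x, snd d y) \<in> S \<Longrightarrow> smooth_near M (x \<otimes>\<^bsub>G\<^esub> y) f"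
      using mult_smooth[OF c d f1] by meson
    have L: "bounded_linear (\<lambda>y. (0::real^'n, y))" "bounded_linear (\<lambda>y. (y, 0::real^'n))"
      by (intro bounded_linear_Pair bounded_linear_zero bounded_linear_ident)+
    define b where "b = (0::real^'n, \<chi> i. w (coord d i))"
    have "X q f = frechet_derivative ?F (at (snd c q, snd d \<one>\<^bsub>G\<^esub>)) b"
      if q: "q \<in> fst c" "(snd c q, snd d \<one>\<^bsub>G\<^esub>) \<in> S" for q
    proof -
      have "q \<in> carrier G" using q chart_subset[OF c(1)] carrier_eq by auto
      then have "smooth_near M q f"
        using S(4)[OF q(1) d(2) q(2)] by simp
      then have "X q f = w (\<lambda>x. f (q \<otimes>\<^bsub>G\<^esub> x))" by (rule Xap)
      also have "\<dots> = frechet_derivative ?F (at ((snd c q, 0) + (0, snd d \<one>\<^bsub>G\<^esub>))) (0, \<chi> i. w (coord d i))"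
        by (rule smooth_near_slice(2)[OF d S(1) _ L(1) S(3) _ w]) (use c d q in auto)
      finally show ?thesis by (simp add: b_def)
    qed
    then show "smooth_near M h (\<lambda>q. X q f)"
      using S(2) Ck_on_Suc_derivative[OF S(3)]
      by (intro smooth_near_slice(1)[OF c S(1) _ L(2), of "(0, snd d \<one>\<^bsub>G\<^esub>)" "\<lambda>z. frechet_derivative ?F (at z) b"]) auto
  qed
  have inv: "left_invariant_field G M X"
    unfolding left_invariant_field_def
  proof (intro conjI ballI ext X)
    fix a h f assume a: "a \<in> carrier G" and h: "h \<in> carrier G"
    show "differential M (\<lambda>x. a \<otimes>\<^bsub>G\<^esub> x) h (X h) f = X (a \<otimes>\<^bsub>G\<^esub> h) f"
    proof (cases "smooth_near M (a \<otimes>\<^bsub>G\<^esub> h) f")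
      case f: True
      have "X h (\<lambda>x. f (a \<otimes>\<^bsub>G\<^esub> x)) = w (\<lambda>x. f (a \<otimes>\<^bsub>G\<^esub> (h \<otimes>\<^bsub>G\<^esub> x)))"
        by (rule Xap[OF left_translation_smooth[OF a h f]])
      also have "\<dots> = w (\<lambda>x. f (a \<otimes>\<^bsub>G\<^esub> h \<otimes>\<^bsub>G\<^esub> x))"
        by (rule tangent_cong[OF w openin_topspace one_point]) (simp add: m_assoc a h carrier_eq[symmetric])
      finally show ?thesis
        using f by (simp add: differential_def comp_def Xap)
    qed (simp add: differential_def Xns)
  qed
  have "X g f = v f" for f
  proof (cases "smooth_near M g f")
    case f: True
    have i: "inv\<^bsub>G\<^esub> g \<in> carrier G" using g by simp
    have "smooth_near M (g \<otimes>\<^bsub>G\<^esub> \<one>\<^bsub>G\<^esub>) f" using f g by simp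
    then have "smooth_near M (inv\<^bsub>G\<^esub> g \<otimes>\<^bsub>G\<^esub> g) (\<lambda>x. f (g \<otimes>\<^bsub>G\<^esub> x))"
      using left_translation_smooth[OF g one_closed] g by simp
    then have "X g f = v (\<lambda>x. f (g \<otimes>\<^bsub>G\<^esub> (inv\<^bsub>G\<^esub> g \<otimes>\<^bsub>G\<^esub> x)))"
      by (simp add: Xap[OF f] w_def differential_def comp_def)
    also have "\<dots> = v f"
      by (rule tangent_cong[OF v openin_topspace gM])
         (simp add: m_assoc[symmetric] g i carrier_eq[symmetric])
    finally show ?thesis .
  qed (simp add: Xns tangent_nonsmooth[OF v])
  then show thesis
    using that[OF inv] by blast
qed

text \<open>Near \<open>(g, 1)\<close> consider \<open>F(x, y) = f(x y)\<close> in charts. Left invariance makes \<open>X f\<close> at \<open>x\<close> the derivative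
  of \<open>F\<close> in \<open>y\<close> at \<open>y = 1\<close>, and right invariance makes \<open>W f\<close> at \<open>g y\<close> the derivative of \<open>F\<close> in \<open>x\<close> at
  \<open>x = g\<close>. Both iterated derivatives are the same mixed second derivative of \<open>F\<close>.\<close>

lemma left_right_commute:
  assumes X: "left_invariant_field G M X" and W: "right_invariant_field G M W"
    and f: "smooth_near M g f"
  shows "X g (\<lambda>q. W q f) = W g (\<lambda>q. X q f)"
proof -
  have vX: "vector_field M X" and vW: "vector_field M W"
    using X W by (simp_all add: left_invariant_field_def right_invariant_field_def)
  have g: "g \<in> carrier G" using smooth_near_point[OF f] carrier_eq by simp
  have f1: "smooth_near M (g \<otimes>\<^bsub>G\<^esub> \<one>\<^bsub>G\<^esub>) f" using f g by simp
  have Wg: "W g \<in> tangent_space M g" and X1: "X \<one>\<^bsub>G\<^esub> \<in> tangent_space M \<one>\<^bsub>G\<^esub>"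
    using vector_fieldD(1)[OF vX one_point] vector_fieldD(1)[OF vW smooth_near_point[OF f]] by auto
  obtain c d where c: "c \<in> atlas M" "g \<in> fst c" and d: "d \<in> atlas M" "\<one>\<^bsub>G\<^esub> \<in> fst d"
    using chart_at g one_point carrier_eq by metis
  let ?F = "\<lambda>z. f (chart_inv c (fst z) \<otimes>\<^bsub>G\<^esub> chart_inv d (snd z))"
  obtain S where S: "open S" "(snd c g, snd d \<one>\<^bsub>G\<^esub>) \<in> S" "\<And>k. Ck_on k S ?F"
    "\<And>x y. x \<in> fst c \<Longrightarrow> y \<in> fst d \<Longrightarrow> (snd c x, snd d y) \<in> S \<Longrightarrow> smooth_near M (x \<otimes>\<^bsub>G\<^esub> y) f"
    using mult_smooth[OF c d f1] by meson
  have L: "bounded_linear (\<lambda>y. (0::real^'n, y))" "bounded_linear (\<lambda>y. (y, 0::real^'n))"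
    by (intro bounded_linear_Pair bounded_linear_zero bounded_linear_ident)+
  define b where "b = (0::real^'n, \<chi> i. X \<one>\<^bsub>G\<^esub> (coord d i))"
  define a where "a = (\<chi> i. W g (coord c i), 0::real^'n)"
  have FD: "Ck_on k S (\<lambda>z. frechet_derivative ?F (at z) u)" for k u
    by (rule Ck_on_Suc_derivative[OF S(3)])
  have Xq: "X q f = frechet_derivative ?F (at (snd c q, snd d \<one>\<^bsub>G\<^esub>)) b"
    if q: "q \<in> fst c" "(snd c q, snd d \<one>\<^bsub>G\<^esub>) \<in> S" for q
  proof -
    have qG: "q \<in> carrier G" using q chart_subset[OF c(1)] carrier_eq by auto
    have "X q f = X \<one>\<^bsub>G\<^esub> (\<lambda>x. f (q \<otimes>\<^bsub>G\<^esub> x))"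
      using left_invariant_apply[OF X qG one_closed S(4)[OF q(1) d(2) q(2)]] qG by simp
    also have "\<dots> = frechet_derivative ?F (at ((snd c q, 0) + (0, snd d \<one>\<^bsub>G\<^esub>))) (0, \<chi> i. X \<one>\<^bsub>G\<^esub> (coord d i))"
      by (rule smooth_near_slice(2)[OF d S(1) _ L(1) S(3) _ X1]) (use c d q in auto)
    finally show ?thesis by (simp add: b_def)
  qed
  have Wy: "W (g \<otimes>\<^bsub>G\<^esub> y) f = frechet_derivative ?F (at (snd c g, snd d y)) a"
    if y: "y \<in> fst d" "(snd c g, snd d y) \<in> S" for y
  proof -
    have yG: "y \<in> carrier G" using y chart_subset[OF d(1)] carrier_eq by auto
    have "W (g \<otimes>\<^bsub>G\<^esub> y) f = W g (\<lambda>x. f (x \<otimes>\<^bsub>G\<^esub> y))"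
      by (rule right_invariant_apply[OF W yG g S(4)[OF c(2) y]])
    also have "\<dots> = frechet_derivative ?F (at ((0, snd d y) + (snd c g, 0))) (\<chi> i. W g (coord c i), 0)"
      by (rule smooth_near_slice(2)[OF c S(1) _ L(2) S(3) _ Wg]) (use c d y in auto)
    finally show ?thesis by (simp add: a_def)
  qed
  have "W g (\<lambda>q. X q f) =
      frechet_derivative (\<lambda>z. frechet_derivative ?F (at z) b) (at ((0, snd d \<one>\<^bsub>G\<^esub>) + (snd c g, 0))) (\<chi> i. W g (coord c i), 0)"
    by (rule smooth_near_slice(2)[OF c S(1) _ L(2) FD _ Wg]) (use S(2) Xq in auto)
  moreover have "X g (\<lambda>q. W q f) = X \<one>\<^bsub>G\<^esub> (\<lambda>y. W (g \<otimes>\<^bsub>G\<^esub> y) f)"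
    using left_invariant_apply[OF X g one_closed vector_fieldD(2)[OF vW f1]] g by simp
  moreover have "X \<one>\<^bsub>G\<^esub> (\<lambda>y. W (g \<otimes>\<^bsub>G\<^esub> y) f) =
      frechet_derivative (\<lambda>z. frechet_derivative ?F (at z) a) (at ((snd c g, 0) + (0, snd d \<one>\<^bsub>G\<^esub>))) (0, \<chi> i. X \<one>\<^bsub>G\<^esub> (coord d i))"
    by (rule smooth_near_slice(2)[OF d S(1) _ L(1) FD _ X1]) (use S(2) Wy in auto)
  ultimately show ?thesis
    using second_derivative_symmetric[OF S(1,2,3), of a b] by (simp add: a_def[symmetric] b_def[symmetric])
qed

lemma lie_bracket_right_left:
  assumes X: "left_invariant_field G M X" and W: "right_invariant_field G M W"
  shows "lie_bracket M W X = 0"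
  using left_right_commute[OF assms] by (auto simp: lie_bracket_def fun_eq_iff)

text \<open>The left-invariant fields that extend a coordinate basis at the identity form a global frame: translating
  back to the identity expands each vector, with coefficients that are its components there. These coefficients
  also solve a linear system whose matrix consists of the chart components of the frame, so that
  Cramer's rule shows that they are smooth.\<close>

lemma vector_field_frame:
  "\<exists>E::'n \<Rightarrow> 'a vfield. (\<forall>i. left_invariant_field G M (E i)) \<and>
     (\<forall>X. vector_field M X \<longrightarrow> (\<exists>a. (\<forall>i. smooth_fun (a i)) \<and> X = (\<Sum>i\<in>UNIV. fun_scale (a i) (E i))))"
proof -
  obtain d where d: "d \<in> atlas M" "\<one>\<^bsub>G\<^esub> \<in> fst d"
    using chart_at one_point by blast
  have "\<exists>X. left_invariant_field G M X \<and> X \<one>\<^bsub>G\<^esub> = coord_vector M d i \<one>\<^bsub>G\<^esub>" for i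
    using left_invariant_field_exists[OF coord_vector_in_tangent_space[OF d]] by metis
  then obtain E where E: "\<And>i. left_invariant_field G M (E i)" "\<And>i. E i \<one>\<^bsub>G\<^esub> = coord_vector M d i \<one>\<^bsub>G\<^esub>"
    by metis
  have vE: "vector_field M (E i)" for i
    using E(1) by (simp add: left_invariant_field_def)
  define coeff where "coeff = (\<lambda>g v i. differential M (\<lambda>x. inv\<^bsub>G\<^esub> g \<otimes>\<^bsub>G\<^esub> x) g v (coord d i))"
  have expand: "v f = (\<Sum>i\<in>UNIV. coeff g v i * E i g f)" if v: "v \<in> tangent_space M g" for g v f
  proof -
    have g: "g \<in> carrier G" using tangent_space_point[OF v] carrier_eq by simp
    have w: "differential M (\<lambda>x. inv\<^bsub>G\<^esub> g \<otimes>\<^bsub>G\<^esub> x) g v \<in> tangent_space M \<one>\<^bsub>G\<^esub>"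
      using left_translation_tangent[OF inv_closed[OF g] g v] g by simp
    show ?thesis
    proof (cases "smooth_near M g f")
      case f: True
      have f1: "smooth_near M (g \<otimes>\<^bsub>G\<^esub> \<one>\<^bsub>G\<^esub>) f" using f g by simp
      have "smooth_near M (inv\<^bsub>G\<^esub> g \<otimes>\<^bsub>G\<^esub> g) (\<lambda>x. f (g \<otimes>\<^bsub>G\<^esub> x))"
        using left_translation_smooth[OF g one_closed f1] g by simp
      then have "differential M (\<lambda>x. inv\<^bsub>G\<^esub> g \<otimes>\<^bsub>G\<^esub> x) g v (\<lambda>x. f (g \<otimes>\<^bsub>G\<^esub> x)) =
          v (\<lambda>x. f (g \<otimes>\<^bsub>G\<^esub> (inv\<^bsub>G\<^esub> g \<otimes>\<^bsub>G\<^esub> x)))"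
        by (simp add: differential_def comp_def)
      also have "\<dots> = v f"
        by (rule tangent_cong[OF v openin_topspace tangent_space_point[OF v]])
           (simp add: m_assoc[symmetric] g carrier_eq[symmetric])
      finally have "v f = differential M (\<lambda>x. inv\<^bsub>G\<^esub> g \<otimes>\<^bsub>G\<^esub> x) g v (\<lambda>x. f (g \<otimes>\<^bsub>G\<^esub> x))" ..
      also have "\<dots> = (\<Sum>i\<in>UNIV. coeff g v i * E i \<one>\<^bsub>G\<^esub> (\<lambda>x. f (g \<otimes>\<^bsub>G\<^esub> x)))"
        by (subst tangent_expand[OF w d]) (simp add: coeff_def E(2))
      also have "\<dots> = (\<Sum>i\<in>UNIV. coeff g v i * E i g f)"
        using left_invariant_apply[OF E(1) g one_closed f1] g by simp
      finally show ?thesis .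
    next
      case False
      then show ?thesis
        using tangent_nonsmooth[OF v] vector_fieldD(3)[OF vE] by simp
    qed
  qed
  have "\<exists>a. (\<forall>i. smooth_fun (a i)) \<and> X = (\<Sum>i\<in>UNIV. fun_scale (a i) (E i))" if X: "vector_field M X" for X
  proof -
    define a where "a = (\<lambda>i g. coeff g (X g) i)"
    have sm: "smooth_near M g (a k)" if gM: "g \<in> points M" for g k
    proof -
      obtain c where c: "c \<in> atlas M" "g \<in> fst c" using chart_at gM by blast
      define A where "A = (\<lambda>q. \<chi> l i. E i q (coord c l))"
      define B where "B = (\<lambda>q. \<chi> l i. if i = k then X q (coord c l) else E i q (coord c l))"
      \<comment> \<open>Each vector of components in the chart comes from a tangent vector, which the frame expands: \<open>A q\<close> is onto.\<close>
      have det: "det (A q) \<noteq> 0" if q: "q \<in> fst c" for q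
      proof -
        have "\<exists>x. A q *v x = y" for y
        proof
          have "tangent_of_coords c q y (coord c l) = y $ l" for l
            by (rule tangent_of_coords_coord[OF c(1) q])
          then show "A q *v (\<chi> i. coeff q (tangent_of_coords c q y) i) = y"
            using expand[OF tangent_of_coords_in_tangent_space[OF c(1) q, of y], of "coord c l" for l]
            by (simp add: vec_eq_iff matrix_vector_mult_def A_def mult.commute)
        qed
        then have "surj ((*v) (A q))" by (metis surjI surj_def)
        then show ?thesis
          using matrix_right_invertible_surjective invertible_right_inverse invertible_det_nz by blast
      qed
      \<comment> \<open>Cramer's rule; \<open>B q\<close> is \<open>A q\<close> with the components of \<open>X q\<close> as its column \<open>k\<close>.\<close>
      have ak: "a k q = det (B q) * inverse (det (A q))" if q: "q \<in> fst c" for q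
      proof -
        have "X q \<in> tangent_space M q"
          by (rule vector_fieldD(1)[OF X]) (use q chart_subset[OF c(1)] in auto)
        then have "A q *v (\<chi> i. a i q) = (\<chi> l. X q (coord c l))"
          using expand[of "X q" q] by (simp add: vec_eq_iff matrix_vector_mult_def A_def a_def mult.commute)
        then have "(\<chi> i. a i q) = (\<chi> i. det (\<chi> l j. if j = i then (\<chi> l. X q (coord c l)) $ l else A q $ l $ j) / det (A q))"
          using cramer[OF det[OF q]] by blast
        then have "a k q = det (\<chi> l j. if j = k then (\<chi> l. X q (coord c l)) $ l else A q $ l $ j) / det (A q)"
          by (simp add: vec_eq_iff)
        also have "(\<chi> l j. if j = k then (\<chi> l. X q (coord c l)) $ l else A q $ l $ j) = B q"
          by (simp add: vec_eq_iff A_def B_def)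
        finally show ?thesis by (simp add: divide_inverse)
      qed
      have entries: "smooth_near M g (\<lambda>q. A q $ l $ i)" "smooth_near M g (\<lambda>q. B q $ l $ i)" for l i
        using vector_fieldD(2)[OF vE smooth_near_coord[OF c]] vector_fieldD(2)[OF X smooth_near_coord[OF c]]
        by (cases "i = k"; simp add: A_def B_def)+
      have "smooth_near M g (\<lambda>q. det (A q))" "smooth_near M g (\<lambda>q. det (B q))"
        unfolding det_def by (intro smooth_near_sum smooth_near_prod smooth_near_cmult gM entries)+
      then have "smooth_near M g (\<lambda>q. det (B q) * inverse (det (A q)))"
        using det[OF c(2)] by (intro smooth_near_mult smooth_near_inverse)
      then show ?thesis
        by (rule smooth_near_cong[OF chart_props(1)[OF c(1)] c(2), rotated]) (simp add: ak)
    qed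
    have sum_apply: "(\<Sum>i\<in>I. fun_scale (a i) (E i)) g f = (\<Sum>i\<in>I. a i g * E i g f)" for I g f
      by (induction I rule: infinite_finite_induct) auto
    have "X g f = (\<Sum>i\<in>UNIV. a i g * E i g f)" for g f
    proof (cases "g \<in> points M")
      case True
      then show ?thesis
        using expand[OF vector_fieldD(1)[OF X True]] by (simp add: a_def)
    next
      case False
      then show ?thesis
        using X vE by (simp add: vector_field_iff)
    qed
    then have "X = (\<Sum>i\<in>UNIV. fun_scale (a i) (E i))"
      by (simp add: fun_eq_iff sum_apply)
    moreover have "smooth_fun (a i)" for i
      using sm by (simp add: smooth_fun_iff)
    ultimately show ?thesis
      by (intro exI[of _ a] conjI allI)
  qed
  then show ?thesis
    using E(1) by (intro exI[of _ E]) simp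
qed

text \<open>Consequently an identity that is additive and compatible with multiplication by smooth functions
  has to be checked on left-invariant fields only.\<close>

lemma vector_field_induct [consumes 1, case_names left_invariant add scale]:
  assumes X: "vector_field M X"
    and left: "\<And>E. left_invariant_field G M E \<Longrightarrow> P E"
    and add: "\<And>Y Z. vector_field M Y \<Longrightarrow> P Y \<Longrightarrow> vector_field M Z \<Longrightarrow> P Z \<Longrightarrow> P (Y + Z)"
    and scale: "\<And>a Y. smooth_fun a \<Longrightarrow> vector_field M Y \<Longrightarrow> P Y \<Longrightarrow> P (fun_scale a Y)"
  shows "P X"
proof -
  obtain E where E: "\<And>i::'n. left_invariant_field G M (E i)"
    "\<And>X. vector_field M X \<Longrightarrow> \<exists>a. (\<forall>i. smooth_fun (a i)) \<and> X = (\<Sum>i\<in>UNIV. fun_scale (a i) (E i))"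
    using vector_field_frame by meson
  obtain a where a: "\<And>i. smooth_fun (a i)" "X = (\<Sum>i\<in>UNIV. fun_scale (a i) (E i))"
    using E(2)[OF X] by blast
  have vE: "vector_field M (E i)" for i
    using E(1) by (simp add: left_invariant_field_def)
  have c0: "smooth_fun (\<lambda>_. 0)"
    by (simp add: smooth_fun_iff smooth_near_const)
  have z: "(0 :: 'a vfield) = fun_scale (\<lambda>_. 0) (E i)" for i
    by (simp add: fun_eq_iff)
  have "vector_field M (\<Sum>i\<in>I. fun_scale (a i) (E i)) \<and> P (\<Sum>i\<in>I. fun_scale (a i) (E i))" if "finite I" for I
    using that
  proof induction
    case empty
    show ?case
      unfolding sum.empty z[of undefined]
      using vector_field_fun_scale[OF vE c0] scale[OF c0 vE left[OF E(1)]] by blast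
  next
    case (insert i I)
    show ?case
      unfolding sum.insert[OF insert(1,2)]
      using vector_field_add[OF vector_field_fun_scale[OF vE a(1)]] insert(3)
        add[OF vector_field_fun_scale[OF vE a(1)] scale[OF a(1) vE left[OF E(1)]]] by blast
  qed
  from this[OF finite] show ?thesis
    unfolding a(2) by blast
qed

end

section \<open>The Lie derivative of the canonical connection\<close>

locale canonical_connection_locale = lie_group_locale G M
  for G :: "('a, 'b) monoid_scheme" and M :: "('a, real^'n) manifold" +
  fixes nabla :: "'a vfield \<Rightarrow> 'a vfield \<Rightarrow> 'a vfield"
  assumes canonical: "canonical_connection G M nabla"
begin

lemma linear_connection: "linear_connection M nabla"
  using canonical by (simp add: canonical_connection_def)

lemma nabla_vector_field: "vector_field M X \<Longrightarrow> vector_field M Y \<Longrightarrow> vector_field M (nabla X Y)"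
  using linear_connection by (simp add: linear_connection_def)

lemma nabla_add_left: "vector_field M X \<Longrightarrow> vector_field M X' \<Longrightarrow> vector_field M Y \<Longrightarrow>
    nabla (X + X') Y = nabla X Y + nabla X' Y"
  using linear_connection by (simp add: linear_connection_def)

lemma nabla_add_right: "vector_field M X \<Longrightarrow> vector_field M Y \<Longrightarrow> vector_field M Y' \<Longrightarrow>
    nabla X (Y + Y') = nabla X Y + nabla X Y'"
  using linear_connection by (simp add: linear_connection_def)

lemma nabla_scale_left: "smooth_fun a \<Longrightarrow> vector_field M X \<Longrightarrow> vector_field M Y \<Longrightarrow>
    nabla (fun_scale a X) Y = fun_scale a (nabla X Y)"
  using linear_connection by (simp add: linear_connection_def)

lemma nabla_scale_right: "smooth_fun a \<Longrightarrow> vector_field M X \<Longrightarrow> vector_field M Y \<Longrightarrow>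
    nabla X (fun_scale a Y) = fun_scale (\<lambda>p. X p a) Y + fun_scale a (nabla X Y)"
  using linear_connection by (simp add: linear_connection_def)

lemma nabla_left_invariant: "left_invariant_field G M X \<Longrightarrow> left_invariant_field G M Y \<Longrightarrow>
    nabla X Y = fun_scale (\<lambda>_. 1/2) (lie_bracket M X Y)"
  using canonical by (simp add: canonical_connection_def)

lemma left_invariant_vector_field: "left_invariant_field G M X \<Longrightarrow> vector_field M X"
  by (simp add: left_invariant_field_def)

lemma right_invariant_vector_field: "right_invariant_field G M X \<Longrightarrow> vector_field M X"
  by (simp add: right_invariant_field_def)

lemma vector_field_zero: "vector_field M X \<Longrightarrow> vector_field M 0"
proof -
  assume X: "vector_field M X"
  have "smooth_fun (\<lambda>_. 0)"
    by (simp add: smooth_fun_iff smooth_near_const)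
  from vector_field_fun_scale[OF X this] have "vector_field M (fun_scale (\<lambda>_. 0) X)" .
  moreover have "fun_scale (\<lambda>_. 0) X = 0" by (simp add: fun_eq_iff)
  ultimately show ?thesis by simp
qed

text \<open>For left-invariant fields this is \<open>1/2 [X,Y] = 1/2 [Y,X] + [X,Y]\<close>. The difference of the two sides is a tensor, and the
  equation is symmetric in \<open>X\<close> and \<open>Y\<close>, so that one induction step, in the second argument, serves for both
  arguments.\<close>

lemma torsion_free:
  assumes X: "vector_field M X" and Y: "vector_field M Y"
  shows "nabla X Y = nabla Y X + lie_bracket M X Y"
proof -
  have step: "nabla X Y = nabla Y X + lie_bracket M X Y"
    if X: "vector_field M X" and base: "\<And>E. left_invariant_field G M E \<Longrightarrow> nabla X E = nabla E X + lie_bracket M X E"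
      and Y: "vector_field M Y" for X Y
    using Y
  proof (induction rule: vector_field_induct)
    case (left_invariant E)
    then show ?case by (rule base)
  next
    case (add Y Z)
    show ?case
      unfolding nabla_add_left[OF add.hyps X] nabla_add_right[OF X add.hyps] lie_bracket_add[OF X add.hyps]
        add.IH
      by (simp only: add_ac)
  next
    case (scale a Y)
    show ?case
      unfolding nabla_scale_left[OF scale.hyps X] nabla_scale_right[OF scale.hyps(1) X scale.hyps(2)]
        lie_bracket_fun_scale[OF X scale.hyps(2,1)] scale.IH
      by (simp add: fun_eq_iff algebra_simps)
  qed
  have left: "nabla E Y = nabla Y E + lie_bracket M E Y" if E: "left_invariant_field G M E" and Y: "vector_field M Y" for E Y
  proof (rule step[OF left_invariant_vector_field[OF E] _ Y])
    fix F assume F: "left_invariant_field G M F"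
    show "nabla E F = nabla F E + lie_bracket M E F"
      using lie_bracket_antisym[of E F]
      by (simp add: nabla_left_invariant E F fun_eq_iff)
  qed
  show ?thesis
  proof (rule step[OF X _ Y])
    fix E assume E: "left_invariant_field G M E"
    have "nabla E X p f = nabla X E p f + lie_bracket M E X p f" for p f
      using left[OF E X] by simp
    then show "nabla X E = nabla E X + lie_bracket M X E"
      using lie_bracket_antisym[of E X] by (simp add: fun_eq_iff)
  qed
qed

lemma apply_const:
  assumes X: "vector_field M X" shows "X p (\<lambda>_. a) = 0"
proof (cases "p \<in> points M")
  case True
  show ?thesis by (rule tangent_const[OF vector_fieldD(1)[OF X True]])
next
  case False
  then show ?thesis using X by (simp add: vector_field_iff)
qed

text \<open>The condition that the Lie derivative of the connection along \<open>W\<close> vanishes, that is, that the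
  local flow of \<open>W\<close> consists of affine maps.\<close>

definition preserves_connection :: "'a vfield \<Rightarrow> bool" where
  "preserves_connection W \<longleftrightarrow> (\<forall>X Y. vector_field M X \<longrightarrow> vector_field M Y \<longrightarrow>
     lie_bracket M W (nabla X Y) = nabla (lie_bracket M W X) Y + nabla X (lie_bracket M W Y))"

text \<open>The defect \<open>[W, \<nabla>\<^sub>X Y] - \<nabla>\<^bsub>[W,X]\<^esub> Y - \<nabla>\<^sub>X [W,Y]\<close> is linear over the smooth functions in \<open>X\<close> and in \<open>Y\<close>: after
  scaling \<open>Y\<close> by \<open>a\<close>, the additional terms cancel since \<open>[W,X] a = W (X a) - X (W a)\<close>. So it
  vanishes if it vanishes on left-invariant fields.\<close>

lemma preserves_connectionI:
  assumes W: "vector_field M W"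
    and left: "\<And>E F. left_invariant_field G M E \<Longrightarrow> left_invariant_field G M F \<Longrightarrow>
      lie_bracket M W (nabla E F) = nabla (lie_bracket M W E) F + nabla E (lie_bracket M W F)"
  shows "preserves_connection W"
proof -
  have right: "lie_bracket M W (nabla E Y) = nabla (lie_bracket M W E) Y + nabla E (lie_bracket M W Y)"
    if E: "left_invariant_field G M E" and Y: "vector_field M Y" for E Y
    using Y
  proof (induction rule: vector_field_induct)
    case (left_invariant F)
    then show ?case by (rule left[OF E])
  next
    case (add Y Z)
    note E' = left_invariant_vector_field[OF E]
    note I = vector_field_lie_bracket[OF W]
    show ?case
      unfolding nabla_add_right[OF E' add.hyps] lie_bracket_add[OF W nabla_vector_field[OF E' add.hyps(1)] nabla_vector_field[OF E' add.hyps(2)]]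
        nabla_add_right[OF I[OF E'] add.hyps] lie_bracket_add[OF W add.hyps] nabla_add_right[OF E' I[OF add.hyps(1)] I[OF add.hyps(2)]]
        add.IH
      by (simp only: add_ac)
  next
    case (scale a Y)
    note X = left_invariant_vector_field[OF E]
    note Y = scale(2)
    note a = scale(1)
    note aX = vector_field_apply_smooth[OF X a]
    note aW = vector_field_apply_smooth[OF W a]
    note I = vector_field_lie_bracket[OF W]
    have l: "lie_bracket M W (nabla E (fun_scale a Y)) =
        fun_scale (\<lambda>p. W p (\<lambda>q. E q a)) Y + fun_scale (\<lambda>p. E p a) (lie_bracket M W Y) +
        (fun_scale (\<lambda>p. W p a) (nabla E Y) + fun_scale a (lie_bracket M W (nabla E Y)))"
      using X Y a aX W
      by (simp add: nabla_scale_right lie_bracket_add lie_bracket_fun_scale vector_field_fun_scale nabla_vector_field)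
    have r1: "nabla (lie_bracket M W E) (fun_scale a Y) =
        fun_scale (\<lambda>p. lie_bracket M W E p a) Y + fun_scale a (nabla (lie_bracket M W E) Y)"
      by (rule nabla_scale_right[OF a I[OF X] Y])
    have r2: "nabla E (lie_bracket M W (fun_scale a Y)) =
        fun_scale (\<lambda>p. E p (\<lambda>q. W q a)) Y + fun_scale (\<lambda>p. W p a) (nabla E Y) +
        (fun_scale (\<lambda>p. E p a) (lie_bracket M W Y) + fun_scale a (nabla E (lie_bracket M W Y)))"
      using X Y a aW W
      by (simp add: nabla_scale_right nabla_add_right lie_bracket_fun_scale vector_field_fun_scale I)
    show ?case
    proof (rule vector_field_eqI)
      fix p f assume "smooth_near M p f"
      then have "smooth_near M p a" by (rule smooth_fun_near[OF a])
      then show "lie_bracket M W (nabla E (fun_scale a Y)) p f =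
        (nabla (lie_bracket M W E) (fun_scale a Y) + nabla E (lie_bracket M W (fun_scale a Y))) p f"
        using scale(3) by (simp add: l r1 r2 lie_bracket_apply algebra_simps)
    qed (intro vector_field_add vector_field_lie_bracket nabla_vector_field vector_field_fun_scale X Y W a)+
  qed
  have "lie_bracket M W (nabla X Y) = nabla (lie_bracket M W X) Y + nabla X (lie_bracket M W Y)"
    if X: "vector_field M X" and Y: "vector_field M Y" for X Y
    using X
  proof (induction rule: vector_field_induct)
    case (left_invariant E)
    then show ?case using Y by (rule right)
  next
    case (add X Z)
    note I = vector_field_lie_bracket[OF W]
    show ?case
      unfolding nabla_add_left[OF add.hyps Y] lie_bracket_add[OF W nabla_vector_field[OF add.hyps(1) Y] nabla_vector_field[OF add.hyps(2) Y]]
        lie_bracket_add[OF W add.hyps] nabla_add_left[OF I[OF add.hyps(1)] I[OF add.hyps(2)] Y]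
        nabla_add_left[OF add.hyps I[OF Y]] add.IH
      by (simp only: add_ac)
  next
    case (scale a X)
    note I = vector_field_lie_bracket[OF W]
    note aW = vector_field_apply_smooth[OF W scale(1)]
    show ?case
      unfolding nabla_scale_left[OF scale.hyps Y] lie_bracket_fun_scale[OF W scale.hyps(2,1)]
        lie_bracket_fun_scale[OF W nabla_vector_field[OF scale.hyps(2) Y] scale.hyps(1)]
        nabla_add_left[OF vector_field_fun_scale[OF scale.hyps(2) aW]
          vector_field_fun_scale[OF I[OF scale.hyps(2)] scale.hyps(1)] Y]
        nabla_scale_left[OF aW scale.hyps(2) Y] nabla_scale_left[OF scale.hyps(1) I[OF scale.hyps(2)] Y]
        nabla_scale_left[OF scale.hyps I[OF Y]] scale.IH
      by (simp add: fun_eq_iff algebra_simps)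
  qed
  then show ?thesis by (simp add: preserves_connection_def)
qed

lemma lie_bracket_half:
  assumes "vector_field M W" "vector_field M Z"
  shows "lie_bracket M W (fun_scale (\<lambda>_. 1/2) Z) = fun_scale (\<lambda>_. 1/2) (lie_bracket M W Z)"
proof -
  have "smooth_fun (\<lambda>_. 1/2)"
    by (simp add: smooth_fun_iff smooth_near_const)
  then show ?thesis
    using lie_bracket_fun_scale[OF assms, of "\<lambda>_. 1/2"] by (simp add: apply_const[OF assms(1)] fun_eq_iff)
qed

text \<open>On left-invariant fields the connection is half the bracket, and the claim is half the
  Jacobi identity.\<close>

lemma left_invariant_preserves_connection:
  assumes W: "left_invariant_field G M W"
  shows "preserves_connection W"
proof (rule preserves_connectionI[OF left_invariant_vector_field[OF W]])
  fix E F assume E: "left_invariant_field G M E" and F: "left_invariant_field G M F"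
  note v = left_invariant_vector_field[OF W] left_invariant_vector_field[OF E] left_invariant_vector_field[OF F]
  show "lie_bracket M W (nabla E F) = nabla (lie_bracket M W E) F + nabla E (lie_bracket M W F)"
    by (simp add: nabla_left_invariant E F W left_invariant_lie_bracket lie_bracket_half v vector_field_lie_bracket
      lie_bracket_jacobi[OF v] fun_eq_iff algebra_simps)
qed

lemma nabla_zero:
  assumes X: "vector_field M X" shows "nabla X 0 = 0" "nabla 0 X = 0"
  using nabla_add_right[OF X vector_field_zero[OF X] vector_field_zero[OF X]]
    nabla_add_left[OF vector_field_zero[OF X] vector_field_zero[OF X] X] by simp_all

text \<open>On left-invariant fields every term contains a bracket of the right-invariant field \<open>W\<close> with a left-invariant
  field, and these brackets vanish.\<close>

lemma right_invariant_preserves_connection: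
  assumes W: "right_invariant_field G M W"
  shows "preserves_connection W"
proof (rule preserves_connectionI[OF right_invariant_vector_field[OF W]])
  fix E F assume E: "left_invariant_field G M E" and F: "left_invariant_field G M F"
  note v = right_invariant_vector_field[OF W] left_invariant_vector_field[OF E] left_invariant_vector_field[OF F]
  have "lie_bracket M W (nabla E F) = 0"
    by (simp add: nabla_left_invariant E F lie_bracket_half v vector_field_lie_bracket
      lie_bracket_right_left[OF left_invariant_lie_bracket[OF E F] W] fun_eq_iff)
  then show "lie_bracket M W (nabla E F) = nabla (lie_bracket M W E) F + nabla E (lie_bracket M W F)"
    by (simp add: lie_bracket_right_left[OF E W] lie_bracket_right_left[OF F W] nabla_zero v)
qed

text \<open>Replacing \<open>\<nabla>\<^sub>Y W\<close> by \<open>\<nabla>\<^sub>W Y + [Y,W]\<close>, and likewise for \<open>\<nabla>\<^sub>X Y\<close> in place of \<open>Y\<close>, the curvature cancels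
  all second covariant derivatives. What remains of the collineation expression is exactly the defect
  \<open>[W, \<nabla>\<^sub>X Y] - \<nabla>\<^bsub>[W,X]\<^esub> Y - \<nabla>\<^sub>X [W,Y]\<close>.\<close>

lemma preserves_connection_imp_affine_collineation:
  assumes W: "vector_field M W" and p: "preserves_connection W"
  shows "affine_collineation M nabla W"
  unfolding affine_collineation_def
proof (intro conjI allI impI W)
  fix X Y assume "vector_field M X \<and> vector_field M Y"
  then have X: "vector_field M X" and Y: "vector_field M Y" by auto
  note I = vector_field_lie_bracket
  have 1: "nabla X (nabla Y W) = nabla X (nabla W Y) + nabla X (lie_bracket M Y W)"
    by (simp add: torsion_free[OF Y W] nabla_add_right X W Y I nabla_vector_field)
  have 2: "nabla (nabla X Y) W = nabla W (nabla X Y) + lie_bracket M (nabla X Y) W"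
    by (rule torsion_free[OF nabla_vector_field[OF X Y] W])
  have 3: "lie_bracket M W (nabla X Y) = nabla (lie_bracket M W X) Y + nabla X (lie_bracket M W Y)"
    using p X Y by (simp add: preserves_connection_def)
  have "lie_bracket M Y W + lie_bracket M W Y = 0"
    using lie_bracket_antisym[of Y W] by (simp add: fun_eq_iff)
  then have 4: "nabla X (lie_bracket M Y W) + nabla X (lie_bracket M W Y) = 0"
    using nabla_add_right[OF X I[OF Y W] I[OF W Y]] nabla_zero(1)[OF X] by simp
  have 5: "lie_bracket M (nabla X Y) W + lie_bracket M W (nabla X Y) = 0"
    using lie_bracket_antisym[of "nabla X Y" W] by (simp add: fun_eq_iff)
  have "nabla X (nabla Y W) - nabla (nabla X Y) W - curvature M nabla W X Y =
      (nabla X (lie_bracket M Y W) + nabla X (lie_bracket M W Y)) -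
      (lie_bracket M (nabla X Y) W + lie_bracket M W (nabla X Y))"
    unfolding curvature_def 1 2 3 by (simp add: algebra_simps)
  then show "nabla X (nabla Y W) - nabla (nabla X Y) W - curvature M nabla W X Y = 0"
    by (simp only: 4 5) simp
qed

end

section \<open>The opposite group\<close>

text \<open>Right-invariant objects are the left-invariant ones of the group with the reversed multiplication on the same
  manifold. The existence of right-invariant fields is transferred in this way.\<close>

definition opposite :: "('a, 'b) monoid_scheme \<Rightarrow> ('a, 'b) monoid_scheme" where
  "opposite G = G\<lparr>mult := \<lambda>x y. y \<otimes>\<^bsub>G\<^esub> x\<rparr>"

lemma opposite_simps [simp]:
  "x \<otimes>\<^bsub>opposite G\<^esub> y = y \<otimes>\<^bsub>G\<^esub> x" "\<one>\<^bsub>opposite G\<^esub> = \<one>\<^bsub>G\<^esub>" "carrier (opposite G) = carrier G"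
  by (simp_all add: opposite_def)

lemma inv_opposite: "inv\<^bsub>opposite G\<^esub> x = inv\<^bsub>G\<^esub> x"
  by (simp add: m_inv_def conj_commute)

lemma right_invariant_field_eq: "right_invariant_field G M X \<longleftrightarrow> left_invariant_field (opposite G) M X"
  by (simp add: right_invariant_field_def left_invariant_field_def)

context lie_group_locale
begin

text \<open>The chart expression of the multiplication is defined on this set. It has to be open for the
  \<open>C\<^sup>k\<close> calculus to apply to compositions with that expression.\<close>

lemma open_chart_mult_domain:
  assumes c: "c \<in> atlas M" and d: "d \<in> atlas M" and W: "openin (topo M) W"
  shows "open (map_prod (snd c) (snd d) ` {z \<in> fst c \<times> fst d. (case z of (x, y) \<Rightarrow> x \<otimes>\<^bsub>G\<^esub> y) \<in> W})"
    (is "open ?S")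
proof (rule Topological_Spaces.openI, goal_cases)
  case (1 z)
  then obtain x y where xy: "x \<in> fst c" "y \<in> fst d" "x \<otimes>\<^bsub>G\<^esub> y \<in> W" "z = (snd c x, snd d y)"
    by auto
  have G: "x \<in> carrier G" "y \<in> carrier G"
    using xy chart_subset[OF c] chart_subset[OF d] carrier_eq by auto
  from mult_nbhd[OF G W xy(3)] obtain A B where AB: "openin (topo M) A" "openin (topo M) B" "x \<in> A" "y \<in> B"
      "\<forall>x\<in>A. \<forall>y\<in>B. x \<otimes>\<^bsub>G\<^esub> y \<in> W"
    by blast
  have "(snd c ` (fst c \<inter> A)) \<times> (snd d ` (fst d \<inter> B)) \<subseteq> ?S"
  proof
    fix w assume "w \<in> (snd c ` (fst c \<inter> A)) \<times> (snd d ` (fst d \<inter> B))"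
    then obtain u v where w: "w = map_prod (snd c) (snd d) (u, v)" and uv: "u \<in> fst c" "u \<in> A" "v \<in> fst d" "v \<in> B"
      by auto
    have "u \<otimes>\<^bsub>G\<^esub> v \<in> W" using AB(5) uv by blast
    then show "w \<in> ?S" unfolding w using uv by (intro imageI) simp
  qed
  moreover have "open ((snd c ` (fst c \<inter> A)) \<times> (snd d ` (fst d \<inter> B)))"
    by (rule open_Times[OF open_chart_image[OF c AB(1)] open_chart_image[OF d AB(2)]])
  moreover have "z \<in> (snd c ` (fst c \<inter> A)) \<times> (snd d ` (fst d \<inter> B))"
    unfolding xy(4) using xy(1,2) AB(3,4) by simp
  ultimately show ?case
    by (intro exI[of _ "(snd c ` (fst c \<inter> A)) \<times> (snd d ` (fst d \<inter> B))"] conjI)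
qed

lemma group_opposite: "group (opposite G)"
proof (rule groupI)
  fix x assume "x \<in> carrier (opposite G)"
  then show "\<exists>y\<in>carrier (opposite G). y \<otimes>\<^bsub>opposite G\<^esub> x = \<one>\<^bsub>opposite G\<^esub>"
    by (intro bexI[of _ "inv\<^bsub>G\<^esub> x"]) simp_all
qed (simp_all add: m_assoc)

text \<open>The reversed multiplication is the multiplication after the exchange of the two factors, which in product
  charts is the linear exchange of the coordinate vectors.\<close>

lemma lie_group_opposite: "lie_group (opposite G) M"
proof -
  let ?m = "\<lambda>(x, y). y \<otimes>\<^bsub>G\<^esub> x" and ?P = "prod_topology (topo M) (topo M)"
  have swap: "continuous_map ?P ?P (\<lambda>z. (snd z, fst z))"
    by (simp add: continuous_map_pairwise comp_def continuous_map_fst continuous_map_snd)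
  have cont: "continuous_map ?P (topo M) ?m"
    using continuous_map_compose[OF swap mult_continuous] by (simp add: comp_def case_prod_unfold)
  have smooth: "smooth_on (map_prod (snd c) (snd d) ` {z \<in> fst c \<times> fst d. ?m z \<in> fst e})
      (snd e \<circ> ?m \<circ> inv_into (fst c \<times> fst d) (map_prod (snd c) (snd d)))"
    if c: "c \<in> atlas M" and d: "d \<in> atlas M" and e: "e \<in> atlas M" for c d e
    unfolding smooth_on_def
  proof
    fix k
    define A where "A = map_prod (snd d) (snd c) ` {z \<in> fst d \<times> fst c. (case z of (x, y) \<Rightarrow> x \<otimes>\<^bsub>G\<^esub> y) \<in> fst e}"
    define A' where "A' = map_prod (snd c) (snd d) ` {z \<in> fst c \<times> fst d. ?m z \<in> fst e}"
    have A: "open A"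
      unfolding A_def by (rule open_chart_mult_domain[OF d c chart_props(1)[OF e]])
    have eq: "A' = (\<lambda>z. (snd z, fst z)) -` A"
      by (fastforce simp: A_def A'_def image_iff)
    have A': "open A'"
      unfolding eq by (intro open_vimage A continuous_intros)
    have inv: "inv_into (fst c \<times> fst d) (map_prod (snd c) (snd d)) (snd c x, snd d y) = (x, y)"
      if "x \<in> fst c" "y \<in> fst d" "c \<in> atlas M" "d \<in> atlas M" for x y c d
      using inv_into_f_f[OF map_prod_inj_on[OF chart_inj[OF that(3)] chart_inj[OF that(4)]], of "(x, y)"] that by simp
    have "(fst d \<times> fst c, map_prod (snd d) (snd c)) \<in> atlas (prod_manifold M M)"
      using c d by (simp add: prod_manifold_def) (metis prod.collapse)
    then have "smooth_on A (snd e \<circ> (\<lambda>(x, y). x \<otimes>\<^bsub>G\<^esub> y) \<circ> inv_into (fst d \<times> fst c) (map_prod (snd d) (snd c)))"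
      using lie_group e unfolding A_def by (fastforce simp: lie_group_def smooth_map_def case_prod_beta)
    then have "Ck_on k A (\<lambda>z. snd e (case inv_into (fst d \<times> fst c) (map_prod (snd d) (snd c)) z of (x, y) \<Rightarrow> x \<otimes>\<^bsub>G\<^esub> y))"
      by (simp add: smooth_on_def comp_def)
    moreover have "Ck_on k A' (\<lambda>z. (snd z, fst z))"
      by (intro Ck_on_Pair Ck_on_linear A' bounded_linear_fst bounded_linear_snd)
    ultimately have K: "Ck_on k A' (\<lambda>z. snd e (case inv_into (fst d \<times> fst c) (map_prod (snd d) (snd c)) (snd z, fst z) of (x, y) \<Rightarrow> x \<otimes>\<^bsub>G\<^esub> y))"
      by (intro Ck_on_compose[OF A' A, of k "\<lambda>z. (snd z, fst z)" "\<lambda>z. snd e (case inv_into (fst d \<times> fst c) (map_prod (snd d) (snd c)) z of (x, y) \<Rightarrow> x \<otimes>\<^bsub>G\<^esub> y)"])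
         (auto simp: eq)
    show "Ck_on k (map_prod (snd c) (snd d) ` {z \<in> fst c \<times> fst d. ?m z \<in> fst e})
      (snd e \<circ> ?m \<circ> inv_into (fst c \<times> fst d) (map_prod (snd c) (snd d)))"
      unfolding A'_def[symmetric]
    proof (rule Ck_on_cong[OF A' _ K], rule ballI)
      fix z assume "z \<in> A'"
      then obtain x y where "x \<in> fst c" "y \<in> fst d" "z = (snd c x, snd d y)"
        by (auto simp: A'_def)
      then show "snd e (case inv_into (fst d \<times> fst c) (map_prod (snd d) (snd c)) (snd z, fst z) of (x, y) \<Rightarrow> x \<otimes>\<^bsub>G\<^esub> y) =
          (snd e \<circ> ?m \<circ> inv_into (fst c \<times> fst d) (map_prod (snd c) (snd d))) z"
        by (simp add: inv c d)
    qed
  qed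
  have "smooth_on (snd u ` {p \<in> fst u. ?m p \<in> fst e}) (snd e \<circ> ?m \<circ> inv_into (fst u) (snd u))"
    if "u \<in> atlas (prod_manifold M M)" "e \<in> atlas M" for u e
  proof -
    obtain U \<phi> V \<psi> where u: "(U, \<phi>) \<in> atlas M" "(V, \<psi>) \<in> atlas M" "u = (U \<times> V, map_prod \<phi> \<psi>)"
      using \<open>u \<in> atlas (prod_manifold M M)\<close> by (auto simp: prod_manifold_def)
    show ?thesis
      using smooth[OF u(1,2) that(2)] by (simp add: u(3))
  qed
  then have "smooth_map (prod_manifold M M) M ?m"
    using cont by (simp add: smooth_map_def case_prod_unfold) (simp add: prod_manifold_def)
  then show ?thesis
    using lie_group group_opposite by (simp add: lie_group_def inv_opposite)
qed

lemma right_invariant_field_exists: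
  assumes v: "v \<in> tangent_space M g"
  shows "\<exists>X. right_invariant_field G M X \<and> X g = v"
proof -
  interpret op: lie_group_locale "opposite G" M
    by unfold_locales (rule lie_group_opposite)
  show ?thesis
    unfolding right_invariant_field_eq using op.left_invariant_field_exists[OF v] by metis
qed

end

section \<open>First integrals of the geodesic system\<close>

context manifold_locale
begin

lemma one_form_expand:
  assumes \<alpha>: "one_form M \<alpha>" and c: "c \<in> atlas M" "p \<in> fst c" and v: "v \<in> tangent_space M p"
  shows "\<alpha> p v = (\<Sum>i\<in>UNIV. form_coeff M c \<alpha> i p * fiber_coord c i v)"
proof -
  have lin: "\<alpha> p (\<lambda>f. a * x f + b * y f) = a * \<alpha> p x + b * \<alpha> p y"
    if "x \<in> tangent_space M p" "y \<in> tangent_space M p" for x y a b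
    using \<alpha> that tangent_space_point[OF v] unfolding one_form_def by blast
  have "(\<lambda>f. \<Sum>i\<in>I. u i * coord_vector M c i p f) \<in> tangent_space M p \<and>
      \<alpha> p (\<lambda>f. \<Sum>i\<in>I. u i * coord_vector M c i p f) = (\<Sum>i\<in>I. u i * \<alpha> p (coord_vector M c i p))"
    if "finite I" for I u
    using that
  proof induction
    case empty
    show ?case
      using tangent_lincomb[OF v v, of 0 0] lin[OF v v, of 0 0] by simp
  next
    case (insert i I)
    show ?case
      using insert tangent_lincomb[OF coord_vector_in_tangent_space[OF c] conjunct1[OF insert(3)], of "u i" i 1]
        lin[OF coord_vector_in_tangent_space[OF c] conjunct1[OF insert(3)], of "u i" i 1] by simp
  qed
  from conjunct2[OF this[OF finite]]
  have "\<alpha> p (\<lambda>f. \<Sum>i\<in>UNIV. v (coord c i) * coord_vector M c i p f) =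
      (\<Sum>i\<in>UNIV. v (coord c i) * \<alpha> p (coord_vector M c i p))" .
  moreover have "v = (\<lambda>f. \<Sum>i\<in>UNIV. v (coord c i) * coord_vector M c i p f)"
    by (rule ext) (rule tangent_expand[OF v c])
  ultimately show ?thesis
    by (simp add: form_coeff_def fiber_coord_def mult.commute)
qed

lemma smooth_curve_coord_second_derivative:
  assumes \<gamma>: "smooth_curve M I \<gamma>" and t: "t \<in> I" and c: "c \<in> atlas M" "\<gamma> t \<in> fst c"
  shows "(deriv (coord c i \<circ> \<gamma>) has_real_derivative deriv (deriv (coord c i \<circ> \<gamma>)) t) (at t)"
proof -
  define N where "N = {s \<in> I. \<gamma> s \<in> fst c}"
  have N: "open N" "t \<in> N"
    using smooth_curve_chart(1)[OF \<gamma> c(1)] t c by (simp_all add: N_def)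
  have C: "Ck_on k N (coord c i \<circ> \<gamma>)" for k
    using Ck_on_linear_comp[OF bounded_linear_vec_nth[of i] N(1) smooth_curve_chart(2)[OF \<gamma> c(1), folded N_def]]
    by (simp add: coord_def comp_def)
  define D where "D = (\<lambda>s. frechet_derivative (coord c i \<circ> \<gamma>) (at s) 1)"
  have deriv_eq: "deriv (coord c i \<circ> \<gamma>) s = D s" if "s \<in> N" for s
  proof (rule DERIV_imp_deriv)
    have F: "((coord c i \<circ> \<gamma>) has_derivative frechet_derivative (coord c i \<circ> \<gamma>) (at s)) (at s)"
      by (rule Ck_on_Suc_has_derivative[OF C that])
    have lin: "frechet_derivative (coord c i \<circ> \<gamma>) (at s) h = D s * h" for h
      using linear_cmul[OF has_derivative_linear[OF F], of h 1] by (simp add: D_def)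
    show "((coord c i \<circ> \<gamma>) has_real_derivative D s) (at s)"
      unfolding has_field_derivative_def
      by (rule has_derivative_eq_rhs[OF F]) (rule ext, rule lin)
  qed
  have "D differentiable (at t)"
    using Ck_on_Suc_derivative[OF C[of 2, unfolded numeral_2_eq_2], of 1] N(2) by (simp add: D_def)
  then obtain D' where "(D has_derivative D') (at t)"
    by (auto simp: differentiable_def)
  then have "(deriv (coord c i \<circ> \<gamma>) has_derivative D') (at t)"
    by (rule has_derivative_transform_within_open[OF _ N]) (simp add: deriv_eq)
  then have "deriv (coord c i \<circ> \<gamma>) differentiable (at t)"
    by (auto simp: differentiable_def)
  then show ?thesis
    by (simp add: DERIV_deriv_iff_real_differentiable)
qed

text \<open>Suppose that every tangent vector \<open>v\<close> extends to a field \<open>X\<close> on which \<open>\<alpha>\<close> is constant and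
  that satisfies \<open>\<nabla>\<^sub>X X = 0\<close> at the base point. Take for \<open>v\<close> the velocity of a geodesic at time \<open>t\<close>. The geodesic
  equation and \<open>\<nabla>\<^sub>X X = 0\<close> have the same Christoffel term, hence the acceleration of the geodesic has the
  components \<open>v(X\<^sup>i)\<close>. The derivative of \<open>\<alpha>\<^sub>i u\<^sup>i\<close> along the geodesic is then
  \<open>v(\<alpha>\<^sub>i) X\<^sup>i + \<alpha>\<^sub>i v(X\<^sup>i) = v(\<alpha>(X)) = 0\<close>.\<close>

lemma first_integral_of_autoparallel_fields:
  assumes \<alpha>: "one_form M \<alpha>"
    and fields: "\<And>p v. v \<in> tangent_space M p \<Longrightarrow> \<exists>X a. vector_field M X \<and> X p = v \<and>
      (\<forall>q\<in>points M. \<alpha> q (X q) = a) \<and>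
      (\<forall>c \<Gamma> i. c \<in> atlas M \<longrightarrow> p \<in> fst c \<longrightarrow> christoffel M nabla c \<Gamma> \<longrightarrow>
        X p (\<lambda>q. X q (coord c i)) +
          (\<Sum>j\<in>UNIV. \<Sum>k\<in>UNIV. \<Gamma> i j k p * X p (coord c j) * X p (coord c k)) = 0)"
  shows "first_integral M nabla \<alpha>"
  unfolding first_integral_def
proof (intro allI impI)
  fix I \<gamma> assume geo: "geodesic M nabla I \<gamma>"
  then have \<gamma>: "smooth_curve M I \<gamma>" by (simp add: geodesic_def)
  then have I: "open I" "convex I"
    by (simp_all add: smooth_curve_def open_interval_def is_interval_convex)
  define h where "h = (\<lambda>t. \<alpha> (\<gamma> t) (velocity M \<gamma> t))"
  have "(h has_real_derivative 0) (at t)" if t: "t \<in> I" for t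
  proof -
    define p where "p = \<gamma> t"
    define v where "v = velocity M \<gamma> t"
    have v: "v \<in> tangent_space M p"
      unfolding v_def p_def by (rule velocity_in_tangent_space[OF \<gamma> t])
    obtain c where c: "c \<in> atlas M" "p \<in> fst c"
      using chart_at tangent_space_point[OF v] by blast
    obtain \<Gamma> where \<Gamma>: "christoffel M nabla c \<Gamma>"
      "\<And>i. deriv (deriv (coord c i \<circ> \<gamma>)) t + (\<Sum>j\<in>UNIV. \<Sum>k\<in>UNIV. \<Gamma> i j k (\<gamma> t) *
              deriv (coord c j \<circ> \<gamma>) t * deriv (coord c k \<circ> \<gamma>) t) = 0"
      using geo t c unfolding geodesic_def p_def by blast
    obtain X a where X: "vector_field M X" "X p = v" "\<forall>q\<in>points M. \<alpha> q (X q) = a"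
      and auto: "\<forall>c \<Gamma> i. c \<in> atlas M \<longrightarrow> p \<in> fst c \<longrightarrow> christoffel M nabla c \<Gamma> \<longrightarrow>
        X p (\<lambda>q. X q (coord c i)) +
          (\<Sum>j\<in>UNIV. \<Sum>k\<in>UNIV. \<Gamma> i j k p * X p (coord c j) * X p (coord c k)) = 0"
      using fields[OF v] by (elim exE conjE)
    have XX: "X p (\<lambda>q. X q (coord c i)) +
        (\<Sum>j\<in>UNIV. \<Sum>k\<in>UNIV. \<Gamma> i j k p * X p (coord c j) * X p (coord c k)) = 0" for i
      using auto c \<Gamma>(1) by blast
    have u: "deriv (coord c i \<circ> \<gamma>) s = fiber_coord c i (velocity M \<gamma> s)" if "s \<in> I" "\<gamma> s \<in> fst c" for s i
      using smooth_curve_has_derivative(1)[OF \<gamma> that(1) smooth_near_coord[OF c(1) that(2)], of i]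
      by (simp add: comp_def fiber_coord_def DERIV_imp_deriv)
    have Xp: "deriv (coord c j \<circ> \<gamma>) t = X p (coord c j)" for j
      using u[OF t c(2)[unfolded p_def], of j] unfolding X(2) v_def fiber_coord_def .
    have acc: "deriv (deriv (coord c i \<circ> \<gamma>)) t = X p (\<lambda>q. X q (coord c i))" for i
      using XX[of i] \<Gamma>(2)[of i] unfolding Xp p_def[symmetric] by linarith
    have coeff: "smooth_near M q (form_coeff M c \<alpha> i)" if "q \<in> fst c" for q i
      using \<alpha> c(1) that smooth_fun_on_iff[OF chart_props(1)[OF c(1)]] by (auto simp: one_form_def)
    have "v (\<lambda>q. \<Sum>i\<in>UNIV. form_coeff M c \<alpha> i q * X q (coord c i)) = v (\<lambda>q. a)"
    proof (rule tangent_cong[OF v chart_props(1)[OF c(1)] c(2)])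
      fix q assume q: "q \<in> fst c"
      then have "q \<in> points M" using chart_subset[OF c(1)] by auto
      then show "(\<Sum>i\<in>UNIV. form_coeff M c \<alpha> i q * X q (coord c i)) = a"
        using one_form_expand[OF \<alpha> c(1) q vector_fieldD(1)[OF X(1)]] X(3) by (simp add: fiber_coord_def)
    qed
    then have "0 = v (\<lambda>q. \<Sum>i\<in>UNIV. form_coeff M c \<alpha> i q * X q (coord c i))"
      by (simp add: tangent_const[OF v])
    also have "\<dots> = (\<Sum>i\<in>UNIV. v (\<lambda>q. form_coeff M c \<alpha> i q * X q (coord c i)))"
      by (intro tangent_sum[OF v] smooth_near_mult coeff c vector_fieldD(2)[OF X(1)] smooth_near_coord)
    also have "\<dots> = (\<Sum>i\<in>UNIV. form_coeff M c \<alpha> i p * v (\<lambda>q. X q (coord c i)) + v (form_coeff M c \<alpha> i) * X p (coord c i))"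
      by (intro sum.cong refl tangent_mult[OF v] coeff c vector_fieldD(2)[OF X(1)] smooth_near_coord)
    finally have zero: "(\<Sum>i\<in>UNIV. v (form_coeff M c \<alpha> i) * deriv (coord c i \<circ> \<gamma>) t +
        deriv (deriv (coord c i \<circ> \<gamma>)) t * form_coeff M c \<alpha> i (\<gamma> t)) = 0"
      unfolding Xp acc p_def[symmetric] X(2)[symmetric] by (simp add: add.commute mult.commute)
    have "((\<lambda>s. \<Sum>i\<in>UNIV. form_coeff M c \<alpha> i (\<gamma> s) * deriv (coord c i \<circ> \<gamma>) s) has_real_derivative
        (\<Sum>i\<in>UNIV. v (form_coeff M c \<alpha> i) * deriv (coord c i \<circ> \<gamma>) t +
        deriv (deriv (coord c i \<circ> \<gamma>)) t * form_coeff M c \<alpha> i (\<gamma> t))) (at t)"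
      unfolding v_def
      by (intro DERIV_sum DERIV_mult smooth_curve_has_derivative(1)[OF \<gamma> t] coeff
          smooth_curve_coord_second_derivative[OF \<gamma> t]) (use c in \<open>auto simp: p_def\<close>)
    then have "((\<lambda>s. \<Sum>i\<in>UNIV. form_coeff M c \<alpha> i (\<gamma> s) * deriv (coord c i \<circ> \<gamma>) s) has_real_derivative 0) (at t)"
      by (simp only: zero)
    moreover have "open {s \<in> I. \<gamma> s \<in> fst c}" "t \<in> {s \<in> I. \<gamma> s \<in> fst c}"
      using smooth_curve_chart(1)[OF \<gamma> c(1)] t c by (auto simp: p_def)
    moreover have "(\<Sum>i\<in>UNIV. form_coeff M c \<alpha> i (\<gamma> s) * deriv (coord c i \<circ> \<gamma>) s) = h s"
      if s: "s \<in> {s \<in> I. \<gamma> s \<in> fst c}" for s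
      using one_form_expand[OF \<alpha> c(1) _ velocity_in_tangent_space[OF \<gamma>], of s] s by (simp add: h_def u)
    ultimately show ?thesis
      unfolding has_field_derivative_def by (rule has_derivative_transform_within_open)
  qed
  then have "(h has_derivative (*) 0) (at t within I)" if "t \<in> I" for t
    using that has_field_derivative_at_within unfolding has_field_derivative_def by blast
  then have "(h has_derivative (\<lambda>_. 0)) (at t within I)" if "t \<in> I" for t
    by (rule has_derivative_eq_rhs) (auto simp: that)
  then have "\<exists>a. \<forall>t\<in>I. h t = a"
    by (rule has_derivative_zero_constant[OF I(2)])
  then show "(\<lambda>t. \<alpha> (\<gamma> t) (velocity M \<gamma> t)) constant_on I"
    by (simp add: constant_on_def h_def)
qed

end

context canonical_connection_locale
begin

text \<open>This is \<open>\<nabla>\<^sub>E E = 1/2 [E,E] = 0\<close> in coordinates.\<close>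

lemma left_invariant_autoparallel:
  assumes E: "left_invariant_field G M E" and c: "p \<in> fst c" and \<Gamma>: "christoffel M nabla c \<Gamma>"
  shows "E p (\<lambda>q. E q (coord c i)) +
    (\<Sum>j\<in>UNIV. \<Sum>k\<in>UNIV. \<Gamma> i j k p * E p (coord c j) * E p (coord c k)) = 0"
proof -
  have "fiber_coord c i (nabla E E p) = E p (\<lambda>q. fiber_coord c i (E q)) +
      (\<Sum>j\<in>UNIV. \<Sum>k\<in>UNIV. \<Gamma> i j k p * fiber_coord c j (E p) * fiber_coord c k (E p))"
    using \<Gamma> c left_invariant_vector_field[OF E] unfolding christoffel_def by blast
  moreover have "fiber_coord c i (nabla E E p) = 0"
    by (simp add: nabla_left_invariant[OF E E] lie_bracket_def fiber_coord_def)
  ultimately show ?thesis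
    by (simp add: fiber_coord_def)
qed

text \<open>Let \<open>E\<close> be the left-invariant field with the same value \<open>v\<close> at \<open>p\<close>. The fields commute, so at
  \<open>p\<close> one has \<open>v(X\<^sup>i) = E (X x\<^sup>i) = X (E x\<^sup>i) = v(E\<^sup>i)\<close>: both fields have the same first derivatives
  in direction \<open>v\<close>, and \<open>\<nabla>\<^sub>X X = \<nabla>\<^sub>E E\<close> at \<open>p\<close>.\<close>

lemma right_invariant_autoparallel:
  assumes X: "right_invariant_field G M X" and c: "c \<in> atlas M" "p \<in> fst c" and \<Gamma>: "christoffel M nabla c \<Gamma>"
  shows "X p (\<lambda>q. X q (coord c i)) +
    (\<Sum>j\<in>UNIV. \<Sum>k\<in>UNIV. \<Gamma> i j k p * X p (coord c j) * X p (coord c k)) = 0"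
proof -
  have "X p \<in> tangent_space M p"
    using vector_fieldD(1)[OF right_invariant_vector_field[OF X]] chart_subset[OF c(1)] c(2) by blast
  then obtain E where E: "left_invariant_field G M E" "E p = X p"
    by (rule left_invariant_field_exists)
  have "X p (\<lambda>q. X q (coord c i)) = E p (\<lambda>q. E q (coord c i))"
    using left_right_commute[OF E(1) X smooth_near_coord[OF c]] by (simp add: E(2))
  then show ?thesis
    using left_invariant_autoparallel[OF E(1) c(2) \<Gamma>, of i] by (simp add: E(2))
qed

lemma left_invariant_form_first_integral:
  assumes \<alpha>: "left_invariant_form G M \<alpha>"
  shows "first_integral M nabla \<alpha>"
proof (rule first_integral_of_autoparallel_fields)
  show "one_form M \<alpha>" using \<alpha> by (simp add: left_invariant_form_def)
  fix p v assume v: "v \<in> tangent_space M p"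
  obtain X where X: "left_invariant_field G M X" "X p = v"
    by (rule left_invariant_field_exists[OF v])
  have "\<alpha> q (X q) = \<alpha> \<one>\<^bsub>G\<^esub> (X \<one>\<^bsub>G\<^esub>)" if "q \<in> points M" for q
  proof -
    have q: "q \<in> carrier G" using that carrier_eq by simp
    have "\<alpha> (q \<otimes>\<^bsub>G\<^esub> \<one>\<^bsub>G\<^esub>) (differential M (\<lambda>x. q \<otimes>\<^bsub>G\<^esub> x) \<one>\<^bsub>G\<^esub> (X \<one>\<^bsub>G\<^esub>)) = \<alpha> \<one>\<^bsub>G\<^esub> (X \<one>\<^bsub>G\<^esub>)"
      using \<alpha> q vector_fieldD(1)[OF left_invariant_vector_field[OF X(1)] one_point]
      unfolding left_invariant_form_def by blast
    moreover have "differential M (\<lambda>x. q \<otimes>\<^bsub>G\<^esub> x) \<one>\<^bsub>G\<^esub> (X \<one>\<^bsub>G\<^esub>) = X (q \<otimes>\<^bsub>G\<^esub> \<one>\<^bsub>G\<^esub>)"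
      using X(1) q unfolding left_invariant_field_def by blast
    ultimately show ?thesis using q by simp
  qed
  then show "\<exists>X a. vector_field M X \<and> X p = v \<and> (\<forall>q\<in>points M. \<alpha> q (X q) = a) \<and>
      (\<forall>c \<Gamma> i. c \<in> atlas M \<longrightarrow> p \<in> fst c \<longrightarrow> christoffel M nabla c \<Gamma> \<longrightarrow>
        X p (\<lambda>q. X q (coord c i)) +
          (\<Sum>j\<in>UNIV. \<Sum>k\<in>UNIV. \<Gamma> i j k p * X p (coord c j) * X p (coord c k)) = 0)"
    by (intro exI[of _ X] exI[of _ "\<alpha> \<one>\<^bsub>G\<^esub> (X \<one>\<^bsub>G\<^esub>)"] conjI allI impI ballI X(2)
        left_invariant_vector_field[OF X(1)] left_invariant_autoparallel[OF X(1)])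
qed

lemma right_invariant_form_first_integral:
  assumes \<alpha>: "right_invariant_form G M \<alpha>"
  shows "first_integral M nabla \<alpha>"
proof (rule first_integral_of_autoparallel_fields)
  show "one_form M \<alpha>" using \<alpha> by (simp add: right_invariant_form_def)
  fix p v assume v: "v \<in> tangent_space M p"
  obtain X where X: "right_invariant_field G M X" "X p = v"
    using right_invariant_field_exists[OF v] by blast
  have "\<alpha> q (X q) = \<alpha> \<one>\<^bsub>G\<^esub> (X \<one>\<^bsub>G\<^esub>)" if "q \<in> points M" for q
  proof -
    have q: "q \<in> carrier G" using that carrier_eq by simp
    have "\<alpha> (\<one>\<^bsub>G\<^esub> \<otimes>\<^bsub>G\<^esub> q) (differential M (\<lambda>x. x \<otimes>\<^bsub>G\<^esub> q) \<one>\<^bsub>G\<^esub> (X \<one>\<^bsub>G\<^esub>)) = \<alpha> \<one>\<^bsub>G\<^esub> (X \<one>\<^bsub>G\<^esub>)"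
      using \<alpha> q vector_fieldD(1)[OF right_invariant_vector_field[OF X(1)] one_point]
      unfolding right_invariant_form_def by blast
    moreover have "differential M (\<lambda>x. x \<otimes>\<^bsub>G\<^esub> q) \<one>\<^bsub>G\<^esub> (X \<one>\<^bsub>G\<^esub>) = X (\<one>\<^bsub>G\<^esub> \<otimes>\<^bsub>G\<^esub> q)"
      using X(1) q unfolding right_invariant_field_def by blast
    ultimately show ?thesis using q by simp
  qed
  then show "\<exists>X a. vector_field M X \<and> X p = v \<and> (\<forall>q\<in>points M. \<alpha> q (X q) = a) \<and>
      (\<forall>c \<Gamma> i. c \<in> atlas M \<longrightarrow> p \<in> fst c \<longrightarrow> christoffel M nabla c \<Gamma> \<longrightarrow>
        X p (\<lambda>q. X q (coord c i)) +
          (\<Sum>j\<in>UNIV. \<Sum>k\<in>UNIV. \<Gamma> i j k p * X p (coord c j) * X p (coord c k)) = 0)"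
    by (intro exI[of _ X] exI[of _ "\<alpha> \<one>\<^bsub>G\<^esub> (X \<one>\<^bsub>G\<^esub>)"] conjI allI impI ballI X(2)
        right_invariant_vector_field[OF X(1)] right_invariant_autoparallel[OF X(1)])
qed

end

theorem proposition2p5:
  fixes G :: "('a, 'b) monoid_scheme"
    and M :: "('a, real^'n) manifold"
    and nabla :: "'a vfield \<Rightarrow> 'a vfield \<Rightarrow> 'a vfield"
  assumes "lie_group G M"
    and "canonical_connection G M nabla"
  shows "(\<forall>W. left_invariant_field G M W \<or> right_invariant_field G M W \<longrightarrow>
            affine_collineation M nabla W) \<and>
         (\<forall>\<alpha>. left_invariant_form G M \<alpha> \<or> right_invariant_form G M \<alpha> \<longrightarrow>
            (\<exists>F. (\<forall>c\<in>atlas M. \<forall>p\<in>fst c. \<forall>v\<in>tangent_space M p.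
                     F p v = (\<Sum>i\<in>UNIV. form_coeff M c \<alpha> i p * fiber_coord c i v)) \<and>
                 first_integral M nabla F))"
proof -
  interpret canonical_connection_locale G M nabla
    using assms by unfold_locales
  show ?thesis
  proof (intro conjI allI impI)
    fix W assume "left_invariant_field G M W \<or> right_invariant_field G M W"
    then show "affine_collineation M nabla W"
      using left_invariant_preserves_connection left_invariant_vector_field
        right_invariant_preserves_connection right_invariant_vector_field
        preserves_connection_imp_affine_collineation by blast
  next
    fix \<alpha> assume \<alpha>: "left_invariant_form G M \<alpha> \<or> right_invariant_form G M \<alpha>"
    then have "one_form M \<alpha>"
      by (auto simp: left_invariant_form_def right_invariant_form_def)
    moreover have "first_integral M nabla \<alpha>"
      using \<alpha> left_invariant_form_first_integral right_invariant_form_first_integral by blast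
    ultimately show "\<exists>F. (\<forall>c\<in>atlas M. \<forall>p\<in>fst c. \<forall>v\<in>tangent_space M p.
        F p v = (\<Sum>i\<in>UNIV. form_coeff M c \<alpha> i p * fiber_coord c i v)) \<and> first_integral M nabla F"
      using one_form_expand by blast
  qed
qed

end
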